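(* Let $\mathcal T$ be a rigidly-compactly generated tensor-triangulated category. Let $X$ be a weakly noetherian spectral space and let $\sigma$ be a support function for $\mathcal T$ taking values in subsets of $X$. Suppose that $\sigma$ stratifies $\mathcal T$, i.e. that the map $$\{\text{localizing }\otimes\text{-ideals of }\mathcal T\}\to\{\text{subsets of }X\},\qquad \mathcal L\mapsto\bigcup_{t\in\mathcal L}\sigma(t)$$ is a bijection, and that this is compatible with the usual classification of the thick $\otimes$-ideals of $\mathcal T^c$ in the sense that, under this bijection, the compactly generated localizing $\otimes$-ideals of $\mathcal T$ correspond exactly to the Thomason subsets of $X$. Then there is a unique homeomorphism $f\colon X\xrightarrow{\sim}\mathrm{Spc}(\mathcal T^c)$ (so that in particular $\mathrm{Spc}(\mathcal T^c)$ is weakly noetherian) such that $\sigma(t)=f^{-1}(\mathrm{Supp}(t))$ for every $t\in\mathcal T$, where $\mathrm{Supp}$ is the Balmer--Favi support.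
   Context: A tensor-triangulated category is a triangulated category with a compatible closed symmetric monoidal structure $(\otimes,\mathbb 1)$. It is rigidly-compactly generated if it is compactly generated as a triangulated category (in particular has all small coproducts) and its compact objects coincide with its rigid (dualizable) objects; in particular $\mathbb 1$ is compact. $\mathcal T^c$ is the full subcategory of compact objects. A localizing $\otimes$-ideal is a triangulated subcategory closed under coproducts and under tensoring with arbitrary objects; $\mathrm{Loc}_\otimes\langle\mathcal E\rangle$ is the smallest one containing $\mathcal E$; it is compactly generated if it is of the form $\mathrm{Loc}_\otimes\langle\mathcal E\rangle$ with $\mathcal E\subseteq\mathcal T^c$. A support function with values in subsets of a space $X$ assigns to each object $t\in\mathcal T$ a subset $\sigma(t)\subseteq X$ such that: (i) $\sigma(0)=\varnothing$ and $\sigma(\mathbb 1)=X$; (ii) $\sigma(\Sigma t)=\sigma(t)$; (iii) $\sigma(c)\subseteq\sigma(a)\cup\sigma(b)$ for every exact triangle $a\to b\to c\to\Sigma a$; (iv) $\sigma(\coprod_i t_i)=\bigcup_i\sigma(t_i)$ for any set of objects; (v) $\sigma(t_1\otimes t_2)\subseteq\sigma(t_1)\cap\sigma(t_2)$. $\mathrm{Spc}(\mathcal T^c)$ is the Balmer spectrum: the set of prime thick $\otimes$-ideals of $\mathcal T^c$, with the sets $\mathrm{supp}(x)=\{\mathcal P : x\notin\mathcal P\}$, $x\in\mathcal T^c$, as a basis of closed sets; it is a spectral space. A subset of a spectral space is Thomason if it is a union of closed subsets each with quasi-compact complement. A point $\mathcal P$ of a spectral space is weakly visible if $\{\mathcal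 P\}=Y_1\cap Y_2^c$ for some Thomason subsets $Y_1,Y_2$; the space is weakly noetherian if every point is weakly visible. For $Y\subseteq\mathrm{Spc}(\mathcal T^c)$ Thomason put $\mathcal T^c_Y=\{x\in\mathcal T^c:\mathrm{supp}(x)\subseteq Y\}$; there is an (essentially unique) exact triangle $e_Y\to\mathbb 1\to f_Y\to\Sigma e_Y$ with $e_Y\otimes f_Y=0$ and $\mathrm{Loc}_\otimes\langle e_Y\rangle=\mathrm{Ker}(f_Y\otimes-)=\mathrm{Loc}\langle\mathcal T^c_Y\rangle$. For a weakly visible point with $\{\mathcal P\}=Y_1\cap Y_2^c$ put $g(\mathcal P)=e_{Y_1}\otimes f_{Y_2}$ (independent of choices up to isomorphism). When $\mathrm{Spc}(\mathcal T^c)$ is weakly noetherian, the Balmer--Favi support is $\mathrm{Supp}(t)=\{\mathcal P: g(\mathcal P)\otimes t\neq0\}$. *)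

theory Defs
  imports "HOL-Analysis.Analysis" "HOL-Algebra.FiniteProduct"
begin

section \<open>Spectral spaces\<close>

definition thomason :: "'x topology \<Rightarrow> 'x set \<Rightarrow> bool" where
  "thomason X Y \<longleftrightarrow>
     (\<exists>\<C>. (\<forall>Z\<in>\<C>. closedin X Z \<and> compactin X (topspace X - Z)) \<and> Y = \<Union>\<C>)"

definition irreducible_closed :: "'x topology \<Rightarrow> 'x set \<Rightarrow> bool" where
  "irreducible_closed X Z \<longleftrightarrow> closedin X Z \<and> Z \<noteq> {} \<and>
     (\<forall>A B. closedin X A \<and> closedin X B \<and> Z \<subseteq> A \<union> B \<longrightarrow> Z \<subseteq> A \<or> Z \<subseteq> B)"

text \<open>Generic points are unique by the \<open>T\<^sub>0\<close> axiom.\<close>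

definition spectral_space :: "'x topology \<Rightarrow> bool" where
  "spectral_space X \<longleftrightarrow>
     compact_space X \<and> t0_space X \<and>
     (\<forall>U V. openin X U \<and> compactin X U \<and> openin X V \<and> compactin X V \<longrightarrow> compactin X (U \<inter> V)) \<and>
     (\<forall>U x. openin X U \<and> x \<in> U \<longrightarrow> (\<exists>V. openin X V \<and> compactin X V \<and> x \<in> V \<and> V \<subseteq> U)) \<and>
     (\<forall>Z. irreducible_closed X Z \<longrightarrow> (\<exists>x\<in>topspace X. X closure_of {x} = Z))"

definition weakly_visible :: "'x topology \<Rightarrow> 'x \<Rightarrow> bool" where
  "weakly_visible X x \<longleftrightarrow>
     (\<exists>Y1 Y2. thomason X Y1 \<and> thomason X Y2 \<and> {x} = Y1 \<inter> (topspace X - Y2))"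

definition weakly_noetherian :: "'x topology \<Rightarrow> bool" where
  "weakly_noetherian X \<longleftrightarrow> (\<forall>x\<in>topspace X. weakly_visible X x)"


section \<open>Categories\<close>

text \<open>
  Every element of \<open>'o\<close> is an object and every element of \<open>'m\<close> is a morphism; a composite
  \<open>g \<cdot> f\<close> is meaningful when \<open>Cod f = Dom g\<close>.

  Size: \<open>Univ\<close> plays the role of a Grothendieck universe. Only its cardinality matters; it is
  required to be inaccessible, and a set is small when it has strictly smaller cardinality. Small
  families are indexed by sets of elements of \<open>'u\<close>, which contain a copy of every small set.
  This cannot be avoided by asking for coproducts over all sets of a type: a category whose
  coproducts may be indexed by its own morphisms is a preorder.
\<close>

record ('o, 'm, 'u) category_data =
  Dom :: "'m \<Rightarrow> 'o"
  Cod :: "'m \<Rightarrow> 'o"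
  Ide :: "'o \<Rightarrow> 'm"
  Comp :: "'m \<Rightarrow> 'm \<Rightarrow> 'm"  (infixr "\<cdot>\<index>" 75)
  Univ :: "'u set"

context includes cardinal_syntax begin

definition inaccessible :: "'u set \<Rightarrow> bool" where
  "inaccessible U \<longleftrightarrow>
     |UNIV :: nat set| <o |U| \<and> regularCard |U| \<and>
     (\<forall>I :: 'u set. |I| <o |U| \<longrightarrow> |Pow I| <o |U| )"

definition small :: "('o, 'm, 'u, 'z) category_data_scheme \<Rightarrow> 'i set \<Rightarrow> bool" where
  "small C I \<longleftrightarrow> |I| <o |Univ C|"

end

context
  fixes C :: "('o, 'm, 'u, 'z) category_data_scheme" (structure)
begin

definition Hom :: "'o \<Rightarrow> 'o \<Rightarrow> 'm set" where
  "Hom x y = {f. Dom C f = x \<and> Cod C f = y}"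

definition inverse_arrows :: "'o \<Rightarrow> 'o \<Rightarrow> 'm \<Rightarrow> 'm \<Rightarrow> bool" where
  "inverse_arrows x y f g \<longleftrightarrow>
     f \<in> Hom x y \<and> g \<in> Hom y x \<and> g \<cdot> f = Ide C x \<and> f \<cdot> g = Ide C y"

definition iso_arrow :: "'o \<Rightarrow> 'o \<Rightarrow> 'm \<Rightarrow> bool" where
  "iso_arrow x y f \<longleftrightarrow> (\<exists>g. inverse_arrows x y f g)"

definition inv_arrow :: "'m \<Rightarrow> 'm" where
  "inv_arrow f = (THE g. inverse_arrows (Dom C f) (Cod C f) f g)"

definition isomorphic :: "'o \<Rightarrow> 'o \<Rightarrow> bool" where
  "isomorphic x y \<longleftrightarrow> (\<exists>f. iso_arrow x y f)"

definition is_coproduct :: "'u set \<Rightarrow> ('u \<Rightarrow> 'o) \<Rightarrow> 'o \<Rightarrow> ('u \<Rightarrow> 'm) \<Rightarrow> bool" where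
  "is_coproduct I t c \<iota> \<longleftrightarrow>
     (\<forall>i\<in>I. \<iota> i \<in> Hom (t i) c) \<and>
     (\<forall>z g. (\<forall>i\<in>I. g i \<in> Hom (t i) z) \<longrightarrow>
        (\<exists>!h. h \<in> Hom c z \<and> (\<forall>i\<in>I. h \<cdot> \<iota> i = g i)))"

definition has_small_coproducts :: bool where
  "has_small_coproducts \<longleftrightarrow>
     (\<forall>(I :: 'u set) t. small C I \<longrightarrow> (\<exists>c \<iota>. is_coproduct I t c \<iota>))"

end

locale category =
  fixes C :: "('o, 'm, 'u, 'z) category_data_scheme" (structure)
  assumes universe: "inaccessible (Univ C)"
    and locally_small: "small C (Hom C x y)"
    and Ide_in_Hom: "Ide C x \<in> Hom C x x"
    and Comp_in_Hom: "f \<in> Hom C x y \<Longrightarrow> g \<in> Hom C y z \<Longrightarrow> g \<cdot> f \<in> Hom C x z"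
    and Comp_Ide: "f \<in> Hom C x y \<Longrightarrow> f \<cdot> Ide C x = f"
    and Ide_Comp: "f \<in> Hom C x y \<Longrightarrow> Ide C y \<cdot> f = f"
    and Comp_assoc: "f \<in> Hom C w x \<Longrightarrow> g \<in> Hom C x y \<Longrightarrow> h \<in> Hom C y z \<Longrightarrow>
                       (h \<cdot> g) \<cdot> f = h \<cdot> (g \<cdot> f)"


section \<open>Additive categories\<close>

record ('o, 'm, 'u) additive_data = "('o, 'm, 'u) category_data" +
  Zero :: "'o \<Rightarrow> 'o \<Rightarrow> 'm"
  Add :: "'m \<Rightarrow> 'm \<Rightarrow> 'm"  (infixl "\<^bold>+\<index>" 65)

context
  fixes C :: "('o, 'm, 'u, 'z) additive_data_scheme" (structure)
begin

definition hom_group :: "'o \<Rightarrow> 'o \<Rightarrow> 'm monoid" where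
  "hom_group x y = \<lparr>carrier = Hom C x y, monoid.mult = Add C, one = Zero C x y\<rparr>"

definition Neg :: "'m \<Rightarrow> 'm" where
  "Neg f = inv\<^bsub>hom_group (Dom C f) (Cod C f)\<^esub> f"

definition is_zero :: "'o \<Rightarrow> bool" where
  "is_zero x \<longleftrightarrow> Ide C x = Zero C x x"

definition is_biproduct :: "'o \<Rightarrow> 'o \<Rightarrow> 'o \<Rightarrow> bool" where
  "is_biproduct s x y \<longleftrightarrow>
     (\<exists>i j p q. i \<in> Hom C x s \<and> j \<in> Hom C y s \<and> p \<in> Hom C s x \<and> q \<in> Hom C s y \<and>
        p \<cdot> i = Ide C x \<and> q \<cdot> j = Ide C y \<and> p \<cdot> j = Zero C y x \<and> q \<cdot> i = Zero C x y \<and>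
        (i \<cdot> p) \<^bold>+ (j \<cdot> q) = Ide C s)"

text \<open>
  \<open>Hom(x,-)\<close> preserves small coproducts: the canonical map from \<open>\<Oplus>\<^sub>i Hom(x, t\<^sub>i)\<close>, realised as
  the families of finite support, to \<open>Hom(x, \<Coprod>\<^sub>i t\<^sub>i)\<close> is bijective. The sum is
  \<^const>\<open>finprod\<close> in the multiplicatively written group \<^const>\<open>hom_group\<close>.
\<close>

definition is_compact :: "'o \<Rightarrow> bool" where
  "is_compact x \<longleftrightarrow>
     (\<forall>(I :: 'u set) t c \<iota>. small C I \<longrightarrow> is_coproduct C I t c \<iota> \<longrightarrow>
        bij_betw
          (\<lambda>g. finprod (hom_group x c) (\<lambda>i. \<iota> i \<cdot> g i) {i\<in>I. g i \<noteq> Zero C x (t i)})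
          {g \<in> (\<Pi>\<^sub>E i\<in>I. Hom C x (t i)). finite {i\<in>I. g i \<noteq> Zero C x (t i)}}
          (Hom C x c))"

definition compacts :: "'o set" where
  "compacts = {x. is_compact x}"

end

locale additive_category = category C
  for C :: "('o, 'm, 'u, 'z) additive_data_scheme" (structure) +
  assumes hom_comm_group: "comm_group (hom_group C x y)"
    and Comp_Add: "f \<in> Hom C x y \<Longrightarrow> f' \<in> Hom C x y \<Longrightarrow> g \<in> Hom C y z \<Longrightarrow>
                     g \<cdot> (f \<^bold>+ f') = (g \<cdot> f) \<^bold>+ (g \<cdot> f')"
    and Add_Comp: "f \<in> Hom C x y \<Longrightarrow> g \<in> Hom C y z \<Longrightarrow> g' \<in> Hom C y z \<Longrightarrow>
                     (g \<^bold>+ g') \<cdot> f = (g \<cdot> f) \<^bold>+ (g' \<cdot> f)"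
    and ex_zero: "\<exists>x. is_zero C x"
    and ex_biproduct: "\<exists>s. is_biproduct C s x y"


section \<open>Triangulated categories\<close>

record ('o, 'm, 'u) triangulated_data = "('o, 'm, 'u) additive_data" +
  Susp :: "'o \<Rightarrow> 'o"
  SuspMap :: "'m \<Rightarrow> 'm"
  Triangles :: "('m \<times> 'm \<times> 'm) set"

text \<open>
  The suspension is only required to be an additive equivalence. The axioms are
  Verdier's; \<open>octahedral\<close> is stated for the composite \<open>g \<cdot> f\<close>.
\<close>

locale triangulated_category = additive_category C
  for C :: "('o, 'm, 'u, 'z) triangulated_data_scheme" (structure) +
  assumes SuspMap_Ide: "SuspMap C (Ide C x) = Ide C (Susp C x)"
    and SuspMap_Comp: "f \<in> Hom C x y \<Longrightarrow> g \<in> Hom C y z \<Longrightarrow>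
                         SuspMap C (g \<cdot> f) = SuspMap C g \<cdot> SuspMap C f"
    and SuspMap_Add: "f \<in> Hom C x y \<Longrightarrow> g \<in> Hom C x y \<Longrightarrow>
                        SuspMap C (f \<^bold>+ g) = SuspMap C f \<^bold>+ SuspMap C g"
    and SuspMap_bij: "bij_betw (SuspMap C) (Hom C x y) (Hom C (Susp C x) (Susp C y))"
    and Susp_surj: "\<exists>x. isomorphic C (Susp C x) y"
    and triangle_Hom: "(f, g, h) \<in> Triangles C \<Longrightarrow>
          \<exists>x y z. f \<in> Hom C x y \<and> g \<in> Hom C y z \<and> h \<in> Hom C z (Susp C x)"
    and triangle_iso:
      "\<lbrakk>(f, g, h) \<in> Triangles C;
        f \<in> Hom C x y; g \<in> Hom C y z; h \<in> Hom C z (Susp C x);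
        f' \<in> Hom C x' y'; g' \<in> Hom C y' z'; h' \<in> Hom C z' (Susp C x');
        iso_arrow C x x' a; iso_arrow C y y' b; iso_arrow C z z' c;
        b \<cdot> f = f' \<cdot> a; c \<cdot> g = g' \<cdot> b; SuspMap C a \<cdot> h = h' \<cdot> c\<rbrakk>
       \<Longrightarrow> (f', g', h') \<in> Triangles C"
    and triangle_Ide: "is_zero C z \<Longrightarrow> (Ide C x, Zero C x z, Zero C z (Susp C x)) \<in> Triangles C"
    and triangle_exists: "\<exists>g h. (f, g, h) \<in> Triangles C"
    and triangle_rotate:
      "\<lbrakk>f \<in> Hom C x y; g \<in> Hom C y z; h \<in> Hom C z (Susp C x)\<rbrakk>
       \<Longrightarrow> (f, g, h) \<in> Triangles C \<longleftrightarrow> (g, h, Neg C (SuspMap C f)) \<in> Triangles C"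
    and triangle_fill:
      "\<lbrakk>(f, g, h) \<in> Triangles C; (f', g', h') \<in> Triangles C;
        f \<in> Hom C x y; g \<in> Hom C y z; f' \<in> Hom C x' y'; g' \<in> Hom C y' z';
        a \<in> Hom C x x'; b \<in> Hom C y y'; b \<cdot> f = f' \<cdot> a\<rbrakk>
       \<Longrightarrow> \<exists>c\<in>Hom C z z'. c \<cdot> g = g' \<cdot> b \<and> SuspMap C a \<cdot> h = h' \<cdot> c"
    and octahedral:
      "\<lbrakk>f \<in> Hom C x y; g \<in> Hom C y z;
        (f, f1, f2) \<in> Triangles C; f1 \<in> Hom C y z';
        (g, g1, g2) \<in> Triangles C; g1 \<in> Hom C z x';
        (g \<cdot> f, h1, h2) \<in> Triangles C; h1 \<in> Hom C z y'\<rbrakk>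
       \<Longrightarrow> \<exists>u\<in>Hom C z' y'. \<exists>v\<in>Hom C y' x'.
             (u, v, SuspMap C f1 \<cdot> g2) \<in> Triangles C \<and>
             u \<cdot> f1 = h1 \<cdot> g \<and> h2 \<cdot> u = f2 \<and> v \<cdot> h1 = g1 \<and> g2 \<cdot> v = SuspMap C f \<cdot> h2"

context
  fixes C :: "('o, 'm, 'u, 'z) triangulated_data_scheme" (structure)
begin

text \<open>
  Full replete subcategories are identified with isomorphism-closed sets of objects.
\<close>

definition triangulated_subcategory :: "'o set \<Rightarrow> bool" where
  "triangulated_subcategory S \<longleftrightarrow>
     (\<forall>x. is_zero C x \<longrightarrow> x \<in> S) \<and>
     (\<forall>x y. x \<in> S \<and> isomorphic C x y \<longrightarrow> y \<in> S) \<and>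
     (\<forall>x. Susp C x \<in> S \<longleftrightarrow> x \<in> S) \<and>
     (\<forall>f g h x y z. (f, g, h) \<in> Triangles C \<and> f \<in> Hom C x y \<and> g \<in> Hom C y z \<and>
        x \<in> S \<and> y \<in> S \<longrightarrow> z \<in> S)"

definition localizing_subcategory :: "'o set \<Rightarrow> bool" where
  "localizing_subcategory L \<longleftrightarrow> triangulated_subcategory L \<and>
     (\<forall>(I :: 'u set) t c \<iota>. small C I \<and> is_coproduct C I t c \<iota> \<and> (\<forall>i\<in>I. t i \<in> L) \<longrightarrow> c \<in> L)"

definition Loc :: "'o set \<Rightarrow> 'o set" where
  "Loc E = \<Inter>{L. localizing_subcategory L \<and> E \<subseteq> L}"

text \<open>
  The vanishing of \<open>Hom(\<Sigma>\<^sup>n g, t)\<close> for all integers \<open>n\<close>; negative \<open>n\<close> are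
  moved to the second argument.
\<close>

definition compactly_generated :: bool where
  "compactly_generated \<longleftrightarrow> has_small_coproducts C \<and>
     (\<exists>G \<subseteq> compacts C. small C G \<and>
        (\<forall>t. (\<forall>g\<in>G. \<forall>n. Hom C ((Susp C ^^ n) g) t = {Zero C ((Susp C ^^ n) g) t} \<and>
                       Hom C g ((Susp C ^^ n) t) = {Zero C g ((Susp C ^^ n) t)})
             \<longrightarrow> is_zero C t))"

end


section \<open>Tensor-triangulated categories\<close>

text \<open>
  \<open>Assoc x y z : (x \<boxtimes> y) \<boxtimes> z \<rightarrow> x \<boxtimes> (y \<boxtimes> z)\<close>, \<open>LUnit x : Unit \<boxtimes> x \<rightarrow> x\<close>,
  \<open>RUnit x : x \<boxtimes> Unit \<rightarrow> x\<close>, \<open>Braid x y : x \<boxtimes> y \<rightarrow> y \<boxtimes> x\<close>,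
  \<open>Ev y z : IHom y z \<boxtimes> y \<rightarrow> z\<close>, \<open>TSusp x y : \<Sigma>x \<boxtimes> y \<rightarrow> \<Sigma>(x \<boxtimes> y)\<close>.
\<close>

record ('o, 'm, 'u) tt_data = "('o, 'm, 'u) triangulated_data" +
  Tensor :: "'o \<Rightarrow> 'o \<Rightarrow> 'o"  (infixr "\<boxtimes>\<index>" 70)
  TensorMap :: "'m \<Rightarrow> 'm \<Rightarrow> 'm"  (infixr "\<boxtimes>\<^sub>m\<index>" 80)
  Unit :: "'o"
  Assoc :: "'o \<Rightarrow> 'o \<Rightarrow> 'o \<Rightarrow> 'm"
  LUnit :: "'o \<Rightarrow> 'm"
  RUnit :: "'o \<Rightarrow> 'm"
  Braid :: "'o \<Rightarrow> 'o \<Rightarrow> 'm"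
  IHom :: "'o \<Rightarrow> 'o \<Rightarrow> 'o"
  Ev :: "'o \<Rightarrow> 'o \<Rightarrow> 'm"
  TSusp :: "'o \<Rightarrow> 'o \<Rightarrow> 'm"

locale closed_symmetric_monoidal_category = category C
  for C :: "('o, 'm, 'u, 'z) tt_data_scheme" (structure) +
  assumes TensorMap_in_Hom: "f \<in> Hom C x x' \<Longrightarrow> g \<in> Hom C y y' \<Longrightarrow>
                               f \<boxtimes>\<^sub>m g \<in> Hom C (x \<boxtimes> y) (x' \<boxtimes> y')"
    and TensorMap_Ide: "Ide C x \<boxtimes>\<^sub>m Ide C y = Ide C (x \<boxtimes> y)"
    and TensorMap_Comp: "\<lbrakk>f \<in> Hom C x x'; f' \<in> Hom C x' x''; g \<in> Hom C y y'; g' \<in> Hom C y' y''\<rbrakk>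
          \<Longrightarrow> (f' \<cdot> f) \<boxtimes>\<^sub>m (g' \<cdot> g) = (f' \<boxtimes>\<^sub>m g') \<cdot> (f \<boxtimes>\<^sub>m g)"
    and Assoc_iso: "iso_arrow C ((x \<boxtimes> y) \<boxtimes> z) (x \<boxtimes> y \<boxtimes> z) (Assoc C x y z)"
    and Assoc_natural: "\<lbrakk>f \<in> Hom C x x'; g \<in> Hom C y y'; h \<in> Hom C z z'\<rbrakk>
          \<Longrightarrow> Assoc C x' y' z' \<cdot> ((f \<boxtimes>\<^sub>m g) \<boxtimes>\<^sub>m h) = (f \<boxtimes>\<^sub>m (g \<boxtimes>\<^sub>m h)) \<cdot> Assoc C x y z"
    and LUnit_iso: "iso_arrow C (Unit C \<boxtimes> x) x (LUnit C x)"
    and LUnit_natural: "f \<in> Hom C x y \<Longrightarrow> LUnit C y \<cdot> (Ide C (Unit C) \<boxtimes>\<^sub>m f) = f \<cdot> LUnit C x"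
    and RUnit_iso: "iso_arrow C (x \<boxtimes> Unit C) x (RUnit C x)"
    and RUnit_natural: "f \<in> Hom C x y \<Longrightarrow> RUnit C y \<cdot> (f \<boxtimes>\<^sub>m Ide C (Unit C)) = f \<cdot> RUnit C x"
    and Braid_in_Hom: "Braid C x y \<in> Hom C (x \<boxtimes> y) (y \<boxtimes> x)"
    and Braid_natural: "f \<in> Hom C x x' \<Longrightarrow> g \<in> Hom C y y' \<Longrightarrow>
                          Braid C x' y' \<cdot> (f \<boxtimes>\<^sub>m g) = (g \<boxtimes>\<^sub>m f) \<cdot> Braid C x y"
    and Braid_symmetric: "Braid C y x \<cdot> Braid C x y = Ide C (x \<boxtimes> y)"
    and pentagon:
      "Assoc C w x (y \<boxtimes> z) \<cdot> Assoc C (w \<boxtimes> x) y z =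
       (Ide C w \<boxtimes>\<^sub>m Assoc C x y z) \<cdot> Assoc C w (x \<boxtimes> y) z \<cdot> (Assoc C w x y \<boxtimes>\<^sub>m Ide C z)"
    and unit_triangle:
      "(Ide C x \<boxtimes>\<^sub>m LUnit C y) \<cdot> Assoc C x (Unit C) y = RUnit C x \<boxtimes>\<^sub>m Ide C y"
    and hexagon:
      "Assoc C y z x \<cdot> Braid C x (y \<boxtimes> z) \<cdot> Assoc C x y z =
       (Ide C y \<boxtimes>\<^sub>m Braid C x z) \<cdot> Assoc C y x z \<cdot> (Braid C x y \<boxtimes>\<^sub>m Ide C z)"
    and Ev_in_Hom: "Ev C y z \<in> Hom C (IHom C y z \<boxtimes> y) z"
    and Ev_universal: "f \<in> Hom C (x \<boxtimes> y) z \<Longrightarrow>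
          \<exists>!g. g \<in> Hom C x (IHom C y z) \<and> Ev C y z \<cdot> (g \<boxtimes>\<^sub>m Ide C y) = f"

context
  fixes T :: "('o, 'm, 'u, 'z) tt_data_scheme" (structure)
begin

definition curry_arrow :: "'o \<Rightarrow> 'o \<Rightarrow> 'o \<Rightarrow> 'm \<Rightarrow> 'm" where
  "curry_arrow x y z f = (THE g. g \<in> Hom T x (IHom T y z) \<and> Ev T y z \<cdot> (g \<boxtimes>\<^sub>m Ide T y) = f)"

definition IHom_right :: "'o \<Rightarrow> 'm \<Rightarrow> 'm" where
  "IHom_right w f = curry_arrow (IHom T w (Dom T f)) w (Cod T f) (f \<cdot> Ev T w (Dom T f))"

definition IHom_left :: "'m \<Rightarrow> 'o \<Rightarrow> 'm" where
  "IHom_left f w = curry_arrow (IHom T (Cod T f) w) (Dom T f) w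
     (Ev T (Cod T f) w \<cdot> (Ide T (IHom T (Cod T f) w) \<boxtimes>\<^sub>m f))"

text \<open>The canonical map \<open>x \<boxtimes> \<Sigma>y \<rightarrow> \<Sigma>(x \<boxtimes> y)\<close>.\<close>

definition TSusp_right :: "'o \<Rightarrow> 'o \<Rightarrow> 'm" where
  "TSusp_right x y = SuspMap T (Braid T y x) \<cdot> TSusp T y x \<cdot> Braid T x (Susp T y)"

text \<open>
  The canonical maps \<open>\<Sigma>[w,x] \<rightarrow> [w,\<Sigma>x]\<close> and \<open>\<Sigma>[\<Sigma>x,w] \<rightarrow> [x,w]\<close> adjoint to
  \<open>TSusp\<close> and \<open>TSusp_right\<close>.
\<close>

definition IHom_Susp_right :: "'o \<Rightarrow> 'o \<Rightarrow> 'm" where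
  "IHom_Susp_right w x = curry_arrow (Susp T (IHom T w x)) w (Susp T x)
     (SuspMap T (Ev T w x) \<cdot> TSusp T (IHom T w x) w)"

definition IHom_Susp_left :: "'o \<Rightarrow> 'o \<Rightarrow> 'm" where
  "IHom_Susp_left x w = curry_arrow (Susp T (IHom T (Susp T x) w)) x w
     (Ev T (Susp T x) w \<cdot> inv_arrow T (TSusp_right (IHom T (Susp T x) w) x)
        \<cdot> TSusp T (IHom T (Susp T x) w) x)"

end

text \<open>
  Compatibility of the closed symmetric monoidal structure with the triangulation, following
  Hovey, Palmieri and Strickland (Axiomatic stable homotopy theory, Definition A.2.1): the tensor
  product is exact in each variable (the second variable being covered by the symmetry), the
  internal hom is exact in the second variable and exact up to sign in the first one, and the
  symmetry is graded commutative on spheres. The last condition, stated here for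
  \<open>S\<^sup>1 \<boxtimes> S\<^sup>1\<close>, gives the sign \<open>(-1)\<^sup>r\<^sup>s\<close> on \<open>S\<^sup>r \<boxtimes> S\<^sup>s\<close> for all integers by coherence.
\<close>

locale tt_category =
  triangulated_category T + closed_symmetric_monoidal_category T
  for T :: "('o, 'm, 'u, 'z) tt_data_scheme" (structure) +
  assumes TSusp_iso: "iso_arrow T (Susp T x \<boxtimes> y) (Susp T (x \<boxtimes> y)) (TSusp T x y)"
    and TSusp_natural: "f \<in> Hom T x x' \<Longrightarrow> g \<in> Hom T y y' \<Longrightarrow>
          TSusp T x' y' \<cdot> (SuspMap T f \<boxtimes>\<^sub>m g) = SuspMap T (f \<boxtimes>\<^sub>m g) \<cdot> TSusp T x y"
    and TSusp_RUnit: "SuspMap T (RUnit T x) \<cdot> TSusp T x (Unit T) = RUnit T (Susp T x)"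
    and TSusp_Assoc:
      "SuspMap T (Assoc T x y z) \<cdot> TSusp T (x \<boxtimes> y) z \<cdot> (TSusp T x y \<boxtimes>\<^sub>m Ide T z) =
       TSusp T x (y \<boxtimes> z) \<cdot> Assoc T (Susp T x) y z"
    and tensor_exact:
      "\<lbrakk>(f, g, h) \<in> Triangles T; f \<in> Hom T x y\<rbrakk>
       \<Longrightarrow> (f \<boxtimes>\<^sub>m Ide T w, g \<boxtimes>\<^sub>m Ide T w, TSusp T x w \<cdot> (h \<boxtimes>\<^sub>m Ide T w)) \<in> Triangles T"
    and IHom_exact_right:
      "\<lbrakk>(f, g, h) \<in> Triangles T; f \<in> Hom T x y; g \<in> Hom T y z\<rbrakk>
       \<Longrightarrow> \<exists>k\<in>Hom T (IHom T w z) (Susp T (IHom T w x)).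
             IHom_Susp_right T w x \<cdot> k = IHom_right T w h \<and>
             (IHom_right T w f, IHom_right T w g, k) \<in> Triangles T"
    and IHom_exact_left:
      "\<lbrakk>(f, g, h) \<in> Triangles T; f \<in> Hom T x y; g \<in> Hom T y z\<rbrakk>
       \<Longrightarrow> \<exists>k\<in>Hom T (IHom T x w) (Susp T (IHom T z w)).
             k \<cdot> IHom_Susp_left T x w = SuspMap T (IHom_left T h w) \<and>
             ((IHom_left T g w, IHom_left T f w, k) \<in> Triangles T \<or>
              (IHom_left T g w, IHom_left T f w, Neg T k) \<in> Triangles T)"
    and Braid_sphere:
      "Braid T (Susp T (Unit T)) (Susp T (Unit T)) = Neg T (Ide T (Susp T (Unit T) \<boxtimes> Susp T (Unit T)))"

context
  fixes T :: "('o, 'm, 'u, 'z) tt_data_scheme" (structure)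
begin

definition is_rigid :: "'o \<Rightarrow> bool" where
  "is_rigid x \<longleftrightarrow>
     (\<exists>y. \<exists>\<eta>\<in>Hom T (Unit T) (x \<boxtimes> y). \<exists>\<epsilon>\<in>Hom T (y \<boxtimes> x) (Unit T).
        RUnit T x \<cdot> (Ide T x \<boxtimes>\<^sub>m \<epsilon>) \<cdot> Assoc T x y x \<cdot> (\<eta> \<boxtimes>\<^sub>m Ide T x) = LUnit T x \<and>
        LUnit T y \<cdot> (\<epsilon> \<boxtimes>\<^sub>m Ide T y) \<cdot> inv_arrow T (Assoc T y x y) \<cdot> (Ide T y \<boxtimes>\<^sub>m \<eta>) = RUnit T y)"

definition localizing_ideal :: "'o set \<Rightarrow> bool" where
  "localizing_ideal L \<longleftrightarrow> localizing_subcategory T L \<and> (\<forall>x\<in>L. \<forall>y. x \<boxtimes> y \<in> L)"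

definition Loc_tensor :: "'o set \<Rightarrow> 'o set" where
  "Loc_tensor E = \<Inter>{L. localizing_ideal L \<and> E \<subseteq> L}"

definition compactly_generated_ideal :: "'o set \<Rightarrow> bool" where
  "compactly_generated_ideal L \<longleftrightarrow> (\<exists>E \<subseteq> compacts T. L = Loc_tensor E)"

definition support_function :: "'x topology \<Rightarrow> ('o \<Rightarrow> 'x set) \<Rightarrow> bool" where
  "support_function X \<sigma> \<longleftrightarrow>
     (\<forall>t. \<sigma> t \<subseteq> topspace X) \<and>
     (\<forall>t. is_zero T t \<longrightarrow> \<sigma> t = {}) \<and>
     \<sigma> (Unit T) = topspace X \<and>
     (\<forall>t. \<sigma> (Susp T t) = \<sigma> t) \<and>
     (\<forall>f g h a b c. (f, g, h) \<in> Triangles T \<and> f \<in> Hom T a b \<and> g \<in> Hom T b c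
        \<longrightarrow> \<sigma> c \<subseteq> \<sigma> a \<union> \<sigma> b) \<and>
     (\<forall>(I :: 'u set) t c \<iota>. small T I \<and> is_coproduct T I t c \<iota> \<longrightarrow> \<sigma> c = (\<Union>i\<in>I. \<sigma> (t i))) \<and>
     (\<forall>t1 t2. \<sigma> (t1 \<boxtimes> t2) \<subseteq> \<sigma> t1 \<inter> \<sigma> t2)"


subsection \<open>The Balmer spectrum and the Balmer-Favi support\<close>

definition thick_ideal :: "'o set \<Rightarrow> bool" where
  "thick_ideal J \<longleftrightarrow> J \<subseteq> compacts T \<and> triangulated_subcategory T J \<and>
     (\<forall>s x y. s \<in> J \<and> is_biproduct T s x y \<longrightarrow> x \<in> J) \<and>
     (\<forall>x\<in>J. \<forall>y\<in>compacts T. x \<boxtimes> y \<in> J)"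

definition prime_ideal :: "'o set \<Rightarrow> bool" where
  "prime_ideal P \<longleftrightarrow> thick_ideal P \<and> P \<noteq> compacts T \<and>
     (\<forall>x\<in>compacts T. \<forall>y\<in>compacts T. x \<boxtimes> y \<in> P \<longrightarrow> x \<in> P \<or> y \<in> P)"

definition supp :: "'o \<Rightarrow> 'o set set" where
  "supp x = {P. prime_ideal P \<and> x \<notin> P}"

definition Spc :: "'o set topology" where
  "Spc = topology_generated_by {{P. prime_ideal P} - supp x | x. x \<in> compacts T}"

definition compacts_on :: "'o set set \<Rightarrow> 'o set" where
  "compacts_on Y = {x \<in> compacts T. supp x \<subseteq> Y}"

definition idempotent_triangle :: "'o set set \<Rightarrow> 'o \<Rightarrow> 'o \<Rightarrow> bool" where
  "idempotent_triangle Y e f \<longleftrightarrow>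
     (\<exists>u\<in>Hom T e (Unit T). \<exists>v\<in>Hom T (Unit T) f. \<exists>w\<in>Hom T f (Susp T e).
        (u, v, w) \<in> Triangles T) \<and>
     is_zero T (e \<boxtimes> f) \<and>
     Loc_tensor {e} = {t. is_zero T (f \<boxtimes> t)} \<and>
     Loc_tensor {e} = Loc T (compacts_on Y)"

text \<open>
  The triangle of a Thomason subset exists and is essentially unique, and \<open>g_object P\<close> does not
  depend, up to isomorphism, on the choices made here, provided \<open>P\<close> is weakly visible.
\<close>

definition idempotents :: "'o set set \<Rightarrow> 'o \<times> 'o" where
  "idempotents Y = (SOME (e, f). idempotent_triangle Y e f)"

definition e_object :: "'o set set \<Rightarrow> 'o" where
  "e_object Y = fst (idempotents Y)"

definition f_object :: "'o set set \<Rightarrow> 'o" where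
  "f_object Y = snd (idempotents Y)"

definition visibility_pair :: "'o set \<Rightarrow> 'o set set \<times> 'o set set" where
  "visibility_pair P = (SOME (Y1, Y2).
     thomason Spc Y1 \<and> thomason Spc Y2 \<and> {P} = Y1 \<inter> (topspace Spc - Y2))"

definition g_object :: "'o set \<Rightarrow> 'o" where
  "g_object P = e_object (fst (visibility_pair P)) \<boxtimes> f_object (snd (visibility_pair P))"

definition Supp :: "'o \<Rightarrow> 'o set set" where
  "Supp t = {P \<in> topspace Spc. \<not> is_zero T (g_object P \<boxtimes> t)}"

end

locale rigidly_compactly_generated_tt_category = tt_category T
  for T :: "('o, 'm, 'u, 'z) tt_data_scheme" (structure) +
  assumes compactly_generated: "compactly_generated T"
    and compact_iff_rigid: "is_compact T x \<longleftrightarrow> is_rigid T x"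

end

theory Submission
  imports Defs
begin

text \<open>
  Stratification makes \<open>S \<mapsto> {t. \<sigma>(t) \<subseteq> S}\<close> inverse to the given bijection. For \<open>Y\<close> Thomason, the
  objects supported on \<open>Y\<close> are generated by rigid objects, so they admit no maps to the objects
  supported off \<open>Y\<close>; hence the extensions of the latter by the former are a localizing ideal with
  full support, that is, everything. Decomposing the unit in this way gives the idempotent triangles of
  Thomason subsets without any localization theory, and with them objects detecting the points of the
  weakly noetherian space \<open>X\<close>, so that \<open>\<sigma>(s \<otimes> t) = \<sigma>(s) \<inter> \<sigma>(t)\<close>.

  A compact object in the localizing ideal generated by a thick ideal \<open>P\<close> of compact objects lies in
  \<open>P\<close>: the objects \<open>t\<close> such that every map from a compact object to \<open>t\<close> factors through \<open>P\<close> form a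
  localizing subcategory. This shows that compact objects have closed support with quasi-compact
  complement, and that the primes are exactly the ideals \<open>{a. x \<notin> \<sigma>(a)}\<close> for \<open>x \<in> X\<close>, where surjectivity
  rests on a compactness property of spectral spaces. The point \<open>x\<close> is recovered by \<open>T\<^sub>0\<close>, and the
  detecting objects are the \<open>g(\<P>)\<close> of the Balmer-Favi support.
\<close>

section \<open>Additive categories\<close>

text \<open>The support axioms give neither stability under retracts nor an intersection formula for
  tensor products; both have to be extracted from stratification. The lever is that annihilators are
  localizing ideals: an ideal containing \<open>t\<close> contains every object of smaller support,
  so vanishing of a tensor product can be tested on objects supported at one point.

  The definition of \<open>idempotent_triangle\<close> speaks of \<open>Loc\<close>, stratification
  of \<open>Loc_tensor\<close>. They agree on thick ideals because the compact objects generate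
  everything as a localizing subcategory. Compact generation is given as a vanishing test only,
  hence the homotopy colimit argument.

  The objects in \<open>Supp\<close> are arbitrary choices. The criterion for detecting a point is
  therefore proved for any triangles on the unit whose outer terms have supports on the two sides,
  and the chosen idempotents are characterised by exactly this condition.

  Two conventions shape the elementary part. The suspension is only an equivalence, so desuspensions
  exist up to isomorphism and some statements hold one suspension later. Coproducts are indexed by
  subsets of \<open>'u\<close>, so families are transported along injections.\<close>

lemma in_Hom_iff [simp]: "f \<in> Hom C x y \<longleftrightarrow> Dom C f = x \<and> Cod C f = y"
  by (simp add: Hom_def)

context category
begin

lemma Dom_Ide [simp]: "Dom C (Ide C x) = x" and Cod_Ide [simp]: "Cod C (Ide C x) = x"
  using Ide_in_Hom[of x] by auto

lemma Dom_Comp [simp]: "Cod C f = Dom C g \<Longrightarrow> Dom C (g \<cdot> f) = Dom C f"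
  and Cod_Comp [simp]: "Cod C f = Dom C g \<Longrightarrow> Cod C (g \<cdot> f) = Cod C g"
  using Comp_in_Hom[of f "Dom C f" "Cod C f" g "Cod C g"] by auto

lemma Comp_Ide_right [simp]: "Dom C f = x \<Longrightarrow> f \<cdot> Ide C x = f"
  using Comp_Ide[of f x "Cod C f"] by simp

lemma Ide_Comp_left [simp]: "Cod C f = x \<Longrightarrow> Ide C x \<cdot> f = f"
  using Ide_Comp[of f "Dom C f" x] by simp

lemma assoc [simp]: "Cod C f = Dom C g \<Longrightarrow> Cod C g = Dom C h \<Longrightarrow> (h \<cdot> g) \<cdot> f = h \<cdot> (g \<cdot> f)"
  using Comp_assoc[of f "Dom C f" "Dom C g" g "Dom C h" h "Cod C h"] by simp

text \<open>Composites are normalised to the right, which hides \<open>g \<cdot> f\<close> inside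
  \<open>g \<cdot> (f \<cdot> h)\<close>. This form applies a known equation for
  \<open>g \<cdot> f\<close> in front of such a tail.\<close>

lemma comp_reduce:
  assumes "g \<cdot> f = k" "Cod C f = Dom C g" "Cod C h = Dom C f"
  shows "g \<cdot> (f \<cdot> h) = k \<cdot> h"
  using assms assoc[of h f g] by simp

lemma inverse_arrows_sym: "inverse_arrows C x y f g \<Longrightarrow> inverse_arrows C y x g f"
  by (auto simp: inverse_arrows_def)

lemma iso_arrowE:
  assumes "iso_arrow C x y f"
  obtains g where "Dom C f = x" "Cod C f = y" "Dom C g = y" "Cod C g = x"
    "g \<cdot> f = Ide C x" "f \<cdot> g = Ide C y"
  using assms by (auto simp: iso_arrow_def inverse_arrows_def)

lemma iso_arrowI:
  assumes "Dom C f = x" "Cod C f = y" "Dom C g = y" "Cod C g = x"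
    "g \<cdot> f = Ide C x" "f \<cdot> g = Ide C y"
  shows "iso_arrow C x y f"
  using assms unfolding iso_arrow_def inverse_arrows_def by auto

lemma iso_Ide: "iso_arrow C x x (Ide C x)"
  by (rule iso_arrowI[where g = "Ide C x"]) simp_all

lemma iso_Comp:
  assumes "iso_arrow C x y f" "iso_arrow C y z g"
  shows "iso_arrow C x z (g \<cdot> f)"
proof -
  obtain f' where f: "Dom C f = x" "Cod C f = y" "Dom C f' = y" "Cod C f' = x"
    "f' \<cdot> f = Ide C x" "f \<cdot> f' = Ide C y" using assms(1) by (rule iso_arrowE)
  obtain g' where g: "Dom C g = y" "Cod C g = z" "Dom C g' = z" "Cod C g' = y"
    "g' \<cdot> g = Ide C y" "g \<cdot> g' = Ide C z" using assms(2) by (rule iso_arrowE)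
  show ?thesis
    by (rule iso_arrowI[where g = "f' \<cdot> g'"])
       (use f g in \<open>simp_all add: comp_reduce[OF f(6)] comp_reduce[OF g(5)]\<close>)
qed

lemma inverse_arrows_unique:
  assumes "inverse_arrows C x y f g" "inverse_arrows C x y f g'"
  shows "g = g'"
proof -
  have "g = g \<cdot> (f \<cdot> g')" using assms by (simp add: inverse_arrows_def)
  also have "\<dots> = (g \<cdot> f) \<cdot> g'"
    using assms unfolding inverse_arrows_def in_Hom_iff by (intro assoc[symmetric]) auto
  also have "\<dots> = g'" using assms by (simp add: inverse_arrows_def)
  finally show ?thesis .
qed

lemma inv_arrow:
  assumes "iso_arrow C x y f"
  shows "Dom C (inv_arrow C f) = y" "Cod C (inv_arrow C f) = x"
    "inv_arrow C f \<cdot> f = Ide C x" "f \<cdot> inv_arrow C f = Ide C y"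
    "iso_arrow C y x (inv_arrow C f)"
proof -
  obtain g where g: "inverse_arrows C x y f g" using assms by (auto simp: iso_arrow_def)
  have "Dom C f = x" "Cod C f = y" using g by (auto simp: inverse_arrows_def)
  then have "inv_arrow C f = (THE g. inverse_arrows C x y f g)" by (simp add: inv_arrow_def)
  also have "\<dots> = g" by (rule the_equality, rule g) (rule inverse_arrows_unique[OF _ g])
  finally have "inverse_arrows C x y f (inv_arrow C f)" using g by simp
  from this inverse_arrows_sym[OF this] show "Dom C (inv_arrow C f) = y" "Cod C (inv_arrow C f) = x"
    "inv_arrow C f \<cdot> f = Ide C x" "f \<cdot> inv_arrow C f = Ide C y"
    "iso_arrow C y x (inv_arrow C f)"
    by (auto simp: inverse_arrows_def iso_arrow_def)
qed

lemma iso_arrow_epi: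
  assumes "iso_arrow C x y a" "Dom C h = y" "Dom C h' = y" "h \<cdot> a = h' \<cdot> a" shows "h = h'"
proof -
  obtain b where b: "Dom C a = x" "Cod C a = y" "Dom C b = y" "Cod C b = x"
    "b \<cdot> a = Ide C x" "a \<cdot> b = Ide C y" using assms(1) by (rule iso_arrowE)
  have "(h \<cdot> a) \<cdot> b = (h' \<cdot> a) \<cdot> b" using assms(4) by simp
  then show ?thesis using b assms(2,3) by simp
qed

lemma isomorphic_refl: "isomorphic C x x"
  unfolding isomorphic_def by (rule exI) (rule iso_Ide)

lemma isomorphic_sym: "isomorphic C x y \<Longrightarrow> isomorphic C y x"
  unfolding isomorphic_def iso_arrow_def using inverse_arrows_sym by blast

lemma isomorphicE:
  assumes "isomorphic C x y"
  obtains f g where "Dom C f = x" "Cod C f = y" "Dom C g = y" "Cod C g = x"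
    "g \<cdot> f = Ide C x" "f \<cdot> g = Ide C y"
proof -
  obtain f where "iso_arrow C x y f" using assms by (auto simp: isomorphic_def)
  then show ?thesis by (rule iso_arrowE) (rule that)
qed

lemma isomorphic_trans [trans]: "isomorphic C x y \<Longrightarrow> isomorphic C y z \<Longrightarrow> isomorphic C x z"
  unfolding isomorphic_def using iso_Comp by blast

section \<open>Universal property of coproducts\<close>

lemma coproduct_inj:
  "is_coproduct C I t c \<iota> \<Longrightarrow> i \<in> I \<Longrightarrow> Dom C (\<iota> i) = t i \<and> Cod C (\<iota> i) = c"
  by (simp add: is_coproduct_def)

lemma ex1_eq: "\<exists>!x. P x \<Longrightarrow> P a \<Longrightarrow> P b \<Longrightarrow> a = b"
  by auto

lemma coproduct_ex1:
  assumes "is_coproduct C I t c \<iota>" "\<And>i. i \<in> I \<Longrightarrow> Dom C (g i) = t i \<and> Cod C (g i) = z"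
  shows "\<exists>!h. h \<in> Hom C c z \<and> (\<forall>i\<in>I. h \<cdot> \<iota> i = g i)"
proof -
  have "\<forall>z g. (\<forall>i\<in>I. g i \<in> Hom C (t i) z) \<longrightarrow>
    (\<exists>!h. h \<in> Hom C c z \<and> (\<forall>i\<in>I. h \<cdot> \<iota> i = g i))"
    using assms(1) unfolding is_coproduct_def by (rule conjunct2)
  from this[THEN spec, THEN spec, THEN mp, of g z] assms(2) show ?thesis by simp
qed

lemma coproduct_eqI:
  assumes "is_coproduct C I t c \<iota>" "Dom C h = c" "Dom C h' = c" "Cod C h = Cod C h'"
    "\<And>i. i \<in> I \<Longrightarrow> h \<cdot> \<iota> i = h' \<cdot> \<iota> i"
  shows "h = h'"
proof -
  have "\<exists>!k. k \<in> Hom C c (Cod C h) \<and> (\<forall>i\<in>I. k \<cdot> \<iota> i = h' \<cdot> \<iota> i)"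
    by (rule coproduct_ex1[OF assms(1)]) (use assms(1-4) coproduct_inj[OF assms(1)] in simp)
  then show ?thesis by (rule ex1_eq) (use assms in simp_all)
qed

lemma coproduct_map:
  assumes "is_coproduct C I t c \<iota>" "\<And>i. i \<in> I \<Longrightarrow> Dom C (g i) = t i \<and> Cod C (g i) = z"
  obtains h where "Dom C h = c" "Cod C h = z" "\<And>i. i \<in> I \<Longrightarrow> h \<cdot> \<iota> i = g i"
proof -
  have "\<exists>h. h \<in> Hom C c z \<and> (\<forall>i\<in>I. h \<cdot> \<iota> i = g i)"
    by (rule ex1_implies_ex, rule coproduct_ex1[OF assms(1)]) (rule assms(2))
  then obtain h where "h \<in> Hom C c z" "\<forall>i\<in>I. h \<cdot> \<iota> i = g i" by (elim exE conjE) simp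
  then show ?thesis by (intro that[of h]) simp_all
qed

lemma coproductI:
  assumes "\<And>i. i \<in> I \<Longrightarrow> Dom C (\<iota> i) = t i \<and> Cod C (\<iota> i) = c"
    and "\<And>z g. (\<And>i. i \<in> I \<Longrightarrow> Dom C (g i) = t i \<and> Cod C (g i) = z) \<Longrightarrow>
          \<exists>h. Dom C h = c \<and> Cod C h = z \<and> (\<forall>i\<in>I. h \<cdot> \<iota> i = g i)"
    and "\<And>h h'. Dom C h = c \<Longrightarrow> Dom C h' = c \<Longrightarrow> Cod C h = Cod C h' \<Longrightarrow>
          (\<And>i. i \<in> I \<Longrightarrow> h \<cdot> \<iota> i = h' \<cdot> \<iota> i) \<Longrightarrow> h = h'"
  shows "is_coproduct C I t c \<iota>"
  unfolding is_coproduct_def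
proof (intro conjI allI impI)
  show "\<forall>i\<in>I. \<iota> i \<in> Hom C (t i) c" using assms(1) by simp
  fix z g assume g: "\<forall>i\<in>I. g i \<in> Hom C (t i) z"
  have "\<exists>h. Dom C h = c \<and> Cod C h = z \<and> (\<forall>i\<in>I. h \<cdot> \<iota> i = g i)"
    by (rule assms(2)) (use g in simp)
  then obtain h where h: "Dom C h = c" "Cod C h = z" "\<forall>i\<in>I. h \<cdot> \<iota> i = g i"
    by (elim exE conjE)
  show "\<exists>!h. h \<in> Hom C c z \<and> (\<forall>i\<in>I. h \<cdot> \<iota> i = g i)"
  proof (rule ex1I[of _ h])
    fix k assume k: "k \<in> Hom C c z \<and> (\<forall>i\<in>I. k \<cdot> \<iota> i = g i)"
    show "k = h" by (rule assms(3)) (use h k in simp_all)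
  qed (use h in simp)
qed

lemma coproduct_iso:
  assumes "is_coproduct C I t c \<iota>" "is_coproduct C I t c' \<iota>'"
  obtains m where "iso_arrow C c c' m" "\<And>i. i \<in> I \<Longrightarrow> m \<cdot> \<iota> i = \<iota>' i"
proof -
  note i1 = coproduct_inj[OF assms(1)] and i2 = coproduct_inj[OF assms(2)]
  obtain m where m: "Dom C m = c" "Cod C m = c'" "\<And>i. i \<in> I \<Longrightarrow> m \<cdot> \<iota> i = \<iota>' i"
    using coproduct_map[OF assms(1) i2] by blast
  obtain n where n: "Dom C n = c'" "Cod C n = c" "\<And>i. i \<in> I \<Longrightarrow> n \<cdot> \<iota>' i = \<iota> i"
    using coproduct_map[OF assms(2) i1] by blast
  have nm: "n \<cdot> m = Ide C c"
    by (rule coproduct_eqI[OF assms(1)]) (use m n i1 in auto)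
  have mn: "m \<cdot> n = Ide C c'"
    by (rule coproduct_eqI[OF assms(2)]) (use m n i2 in auto)
  show ?thesis by (rule that[OF iso_arrowI[OF m(1,2) n(1,2) nm mn] m(3)])
qed

end

context additive_category
begin

lemma Zero_Hom [simp]: "Dom C (Zero C x y) = x" "Cod C (Zero C x y) = y"
  using monoid.one_closed[OF comm_group.axioms(2)[THEN group.is_monoid, OF hom_comm_group], of x y]
  by (auto simp: hom_group_def)

lemma Add_Hom [simp]:
  assumes "Dom C f = Dom C g" "Cod C f = Cod C g"
  shows "Dom C (f \<^bold>+ g) = Dom C g" "Cod C (f \<^bold>+ g) = Cod C g"
  using monoid.m_closed[OF comm_group.axioms(2)[THEN group.is_monoid, OF hom_comm_group[of "Dom C g" "Cod C g"]], of f g] assms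
  by (auto simp: hom_group_def)

lemma Neg_Hom [simp]: "Dom C (Neg C f) = Dom C f" "Cod C (Neg C f) = Cod C f"
  using group.inv_closed[OF comm_group.axioms(2)[OF hom_comm_group[of "Dom C f" "Cod C f"]], of f]
  by (auto simp: hom_group_def Neg_def)

lemma Add_commute: "Dom C f = Dom C g \<Longrightarrow> Cod C f = Cod C g \<Longrightarrow> f \<^bold>+ g = g \<^bold>+ f"
  using comm_monoid.m_comm[OF comm_group.axioms(1)[OF hom_comm_group[of "Dom C g" "Cod C g"]], of f g]
  by (auto simp: hom_group_def)

lemma Add_assoc:
  "Dom C f = Dom C g \<Longrightarrow> Cod C f = Cod C g \<Longrightarrow> Dom C g = Dom C h \<Longrightarrow> Cod C g = Cod C h \<Longrightarrow>
    (f \<^bold>+ g) \<^bold>+ h = f \<^bold>+ (g \<^bold>+ h)"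
  using monoid.m_assoc[OF comm_group.axioms(2)[THEN group.is_monoid, OF hom_comm_group[of "Dom C g" "Cod C g"]], of f g h]
  by (auto simp: hom_group_def)

lemma Zero_Add [simp]: "Dom C f = x \<Longrightarrow> Cod C f = y \<Longrightarrow> Zero C x y \<^bold>+ f = f"
  using monoid.l_one[OF comm_group.axioms(2)[THEN group.is_monoid, OF hom_comm_group[of x y]], of f]
  by (auto simp: hom_group_def)

lemma Add_Zero [simp]: "Dom C f = x \<Longrightarrow> Cod C f = y \<Longrightarrow> f \<^bold>+ Zero C x y = f"
  using Add_commute[of f "Zero C x y"] by simp

lemma Neg_Add: "Neg C f \<^bold>+ f = Zero C (Dom C f) (Cod C f)"
  using group.l_inv[OF comm_group.axioms(2)[OF hom_comm_group[of "Dom C f" "Cod C f"]], of f]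
  by (auto simp: hom_group_def Neg_def)

lemma Add_Neg: "f \<^bold>+ Neg C f = Zero C (Dom C f) (Cod C f)"
  using Neg_Add[of f] Add_commute[of f "Neg C f"] by simp

lemma Neg_unique:
  assumes "Dom C f = Dom C g" "Cod C f = Cod C g" "f \<^bold>+ g = Zero C (Dom C g) (Cod C g)"
  shows "Neg C f = g"
proof -
  have "Neg C f = Neg C f \<^bold>+ (f \<^bold>+ g)" using assms by simp
  also have "\<dots> = (Neg C f \<^bold>+ f) \<^bold>+ g" using assms by (subst Add_assoc) simp_all
  also have "\<dots> = g" using assms by (simp add: Neg_Add)
  finally show ?thesis .
qed

lemma Neg_Neg [simp]: "Neg C (Neg C f) = f"
  by (rule Neg_unique) (simp_all add: Neg_Add)

lemma Neg_Zero [simp]: "Neg C (Zero C x y) = Zero C x y"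
  by (rule Neg_unique) simp_all

lemma Comp_Add': "Dom C f = Dom C f' \<Longrightarrow> Cod C f = Cod C f' \<Longrightarrow> Dom C g = Cod C f' \<Longrightarrow>
    g \<cdot> (f \<^bold>+ f') = (g \<cdot> f) \<^bold>+ (g \<cdot> f')"
  using Comp_Add[of f "Dom C f'" "Cod C f'" f' g "Cod C g"] by simp

lemma Add_Comp': "Dom C g = Dom C g' \<Longrightarrow> Cod C g = Cod C g' \<Longrightarrow> Cod C f = Dom C g' \<Longrightarrow>
    (g \<^bold>+ g') \<cdot> f = (g \<cdot> f) \<^bold>+ (g' \<cdot> f)"
  using Add_Comp[of f "Dom C f" "Dom C g'" g "Cod C g'" g'] by simp

text \<open>Additivity applied to the zero map produces such an idempotent; this is how composition
  and suspension are seen to preserve zero maps.\<close>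

lemma Add_idem_Zero: "f \<^bold>+ f = f \<Longrightarrow> f = Zero C (Dom C f) (Cod C f)"
proof -
  assume *: "f \<^bold>+ f = f"
  have "f = Neg C f \<^bold>+ (f \<^bold>+ f)" by (subst Add_assoc[symmetric]) (simp_all add: Neg_Add)
  then show ?thesis using * by (simp add: Neg_Add)
qed

lemma Comp_Zero [simp]:
  assumes "Dom C g = y" shows "g \<cdot> Zero C x y = Zero C x (Cod C g)"
proof -
  have "g \<cdot> Zero C x y \<^bold>+ g \<cdot> Zero C x y = g \<cdot> Zero C x y"
    using assms by (simp add: Comp_Add'[symmetric])
  from Add_idem_Zero[OF this] assms show ?thesis by simp
qed

lemma Zero_Comp [simp]:
  assumes "Cod C g = x" shows "Zero C x y \<cdot> g = Zero C (Dom C g) y"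
proof -
  have "Zero C x y \<cdot> g \<^bold>+ Zero C x y \<cdot> g = Zero C x y \<cdot> g"
    using assms by (simp add: Add_Comp'[symmetric])
  from Add_idem_Zero[OF this] assms show ?thesis by simp
qed

lemma Comp_Neg: "Dom C g = Cod C f \<Longrightarrow> g \<cdot> Neg C f = Neg C (g \<cdot> f)"
  by (rule Neg_unique[symmetric]) (simp_all add: Comp_Add'[symmetric] Add_Neg)

lemma Neg_Comp: "Dom C g = Cod C f \<Longrightarrow> Neg C g \<cdot> f = Neg C (g \<cdot> f)"
  by (rule Neg_unique[symmetric]) (simp_all add: Add_Comp'[symmetric] Add_Neg)

lemma diff_eq_Zero:
  assumes "Dom C f = Dom C g" "Cod C f = Cod C g" "f \<^bold>+ Neg C g = Zero C x y"
  shows "f = g"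
proof -
  have "Dom C (f \<^bold>+ Neg C g) = Dom C g" "Cod C (f \<^bold>+ Neg C g) = Cod C g"
    using assms(1,2) by simp_all
  then have "Zero C x y = Zero C (Dom C g) (Cod C g)" unfolding assms(3) by simp
  then have "Neg C f = Neg C g" using assms by (intro Neg_unique) simp_all
  then show ?thesis by (metis Neg_Neg)
qed

lemma is_zero_from: "is_zero C x \<Longrightarrow> Dom C f = x \<Longrightarrow> f = Zero C x (Cod C f)"
  using Comp_Ide_right[of f x] Comp_Zero[of f x x] by (simp add: is_zero_def)

lemma is_zero_to: "is_zero C x \<Longrightarrow> Cod C f = x \<Longrightarrow> f = Zero C (Dom C f) x"
  using Ide_Comp_left[of f x] Zero_Comp[of f x x] by (simp add: is_zero_def)

lemma is_zero_retract:
  assumes "is_zero C y" "Dom C i = x" "Cod C i = y" "Dom C r = y" "r \<cdot> i = Ide C x"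
  shows "is_zero C x"
proof -
  have "Cod C r = x" using Cod_Comp[of i r] assms by simp
  moreover have "i = Zero C x y" using is_zero_to[OF assms(1,3)] assms(2) by simp
  ultimately show ?thesis using assms unfolding is_zero_def by simp
qed

lemma is_zero_isomorphic:
  assumes "is_zero C x" "isomorphic C x y" shows "is_zero C y"
proof -
  obtain f where "iso_arrow C x y f" using assms(2) by (auto simp: isomorphic_def)
  then obtain g where "Dom C f = x" "Cod C f = y" "Dom C g = y" "Cod C g = x" "f \<cdot> g = Ide C y"
    by (rule iso_arrowE)
  then show ?thesis by (intro is_zero_retract[OF assms(1)])
qed

lemma is_zero_unique_isomorphic:
  assumes "is_zero C x" "is_zero C y" "Dom C f = x" "Cod C f = y" shows "iso_arrow C x y f"
proof (rule iso_arrowI[where g = "Zero C y x"])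
  show "Zero C y x \<cdot> f = Ide C x" "f \<cdot> Zero C y x = Ide C y"
    using assms by (simp_all add: is_zero_def)
qed (use assms in simp_all)

lemma coproduct_is_zero:
  assumes "is_coproduct C I t c \<iota>" "\<And>i. i \<in> I \<Longrightarrow> is_zero C (t i)" shows "is_zero C c"
  unfolding is_zero_def
proof (rule coproduct_eqI[OF assms(1)])
  fix i assume i: "i \<in> I"
  note d = coproduct_inj[OF assms(1) i]
  have "\<iota> i = Zero C (t i) c" using is_zero_from[OF assms(2)[OF i]] d by metis
  then show "Ide C c \<cdot> \<iota> i = Zero C c c \<cdot> \<iota> i" using d by simp
qed simp_all

lemma coproduct_proj:
  assumes "is_coproduct C I t c \<iota>" "j \<in> I"
  obtains p where "Dom C p = c" "Cod C p = t j" "p \<cdot> \<iota> j = Ide C (t j)"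
    "\<And>i. i \<in> I \<Longrightarrow> i \<noteq> j \<Longrightarrow> p \<cdot> \<iota> i = Zero C (t i) (t j)"
proof -
  have "\<And>i. i \<in> I \<Longrightarrow> Dom C (if i = j then Ide C (t j) else Zero C (t i) (t j)) = t i \<and>
      Cod C (if i = j then Ide C (t j) else Zero C (t i) (t j)) = t j"
    by simp
  from coproduct_map[OF assms(1) this] obtain p where p: "Dom C p = c" "Cod C p = t j"
    "\<And>i. i \<in> I \<Longrightarrow> p \<cdot> \<iota> i = (if i = j then Ide C (t j) else Zero C (t i) (t j))"
    by blast
  show ?thesis by (rule that[OF p(1,2)]) (use p(3) assms(2) in auto)
qed

text \<open>Recovers \<open>v\<close> from an approximation \<open>u\<close> and the error; the
  pattern recurs whenever a map is corrected by a second factorisation.\<close>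

lemma retract_compl_sum:
  assumes "Dom C u = Dom C v" "Cod C u = Cod C v"
  shows "u \<^bold>+ (v \<^bold>+ Neg C u) = v"
proof -
  have "u \<^bold>+ (v \<^bold>+ Neg C u) = (v \<^bold>+ Neg C u) \<^bold>+ u"
    using assms by (subst Add_commute) simp_all
  also have "\<dots> = v" using assms by (simp add: Add_assoc Neg_Add)
  finally show ?thesis .
qed

end

section \<open>Triangulated categories\<close>

context triangulated_category
begin

text \<open>\<open>Triangles\<close> consists of triples of arrows; naming the three objects keeps
  the typing conditions attached to the triangle.\<close>

definition tri :: "'o \<Rightarrow> 'o \<Rightarrow> 'o \<Rightarrow> 'm \<Rightarrow> 'm \<Rightarrow> 'm \<Rightarrow> bool" where
  "tri x y z f g h \<longleftrightarrow> (f, g, h) \<in> Triangles C \<and>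
     f \<in> Hom C x y \<and> g \<in> Hom C y z \<and> h \<in> Hom C z (Susp C x)"

lemma triD:
  assumes "tri x y z f g h"
  shows "(f, g, h) \<in> Triangles C" "Dom C f = x" "Cod C f = y" "Dom C g = y" "Cod C g = z"
    "Dom C h = z" "Cod C h = Susp C x"
  using assms by (auto simp: tri_def)

lemma SuspMap_Hom [simp]: "Dom C (SuspMap C f) = Susp C (Dom C f)"
  "Cod C (SuspMap C f) = Susp C (Cod C f)"
  using bij_betwE[OF SuspMap_bij[of "Dom C f" "Cod C f"]] by auto

lemma SuspMap_Ide' [simp]: "SuspMap C (Ide C x) = Ide C (Susp C x)"
  by (rule SuspMap_Ide)

lemma SuspMap_Comp': "Cod C f = Dom C g \<Longrightarrow> SuspMap C (g \<cdot> f) = SuspMap C g \<cdot> SuspMap C f"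
  using SuspMap_Comp[of f "Dom C f" "Dom C g" g "Cod C g"] by simp

lemma SuspMap_Zero [simp]: "SuspMap C (Zero C x y) = Zero C (Susp C x) (Susp C y)"
  using Add_idem_Zero[of "SuspMap C (Zero C x y)"]
    SuspMap_Add[of "Zero C x y" x y "Zero C x y"] by simp

lemma SuspMap_Neg: "SuspMap C (Neg C f) = Neg C (SuspMap C f)"
  by (rule Neg_unique[symmetric])
     (use SuspMap_Add[of f "Dom C f" "Cod C f" "Neg C f"] in \<open>simp_all add: Add_Neg\<close>)

lemma SuspMap_inject:
  "SuspMap C f = SuspMap C g \<Longrightarrow> Dom C f = Dom C g \<Longrightarrow> Cod C f = Cod C g \<Longrightarrow> f = g"
  using bij_betw_imp_inj_on[OF SuspMap_bij[of "Dom C g" "Cod C g"]] by (auto simp: inj_on_def)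

lemma SuspMap_full:
  assumes "Dom C f = Susp C x" "Cod C f = Susp C y"
  obtains g where "Dom C g = x" "Cod C g = y" "SuspMap C g = f"
proof -
  have "f \<in> SuspMap C ` Hom C x y"
    using bij_betw_imp_surj_on[OF SuspMap_bij[of x y]] assms by simp
  then obtain g where "f = SuspMap C g" "g \<in> Hom C x y" by (rule imageE)
  then show ?thesis by (intro that[of g]) simp_all
qed

lemma Susp_isomorphic: "isomorphic C x y \<Longrightarrow> isomorphic C (Susp C x) (Susp C y)"
proof -
  assume "isomorphic C x y"
  then obtain f g where f: "Dom C f = x" "Cod C f = y" "Dom C g = y" "Cod C g = x"
    "g \<cdot> f = Ide C x" "f \<cdot> g = Ide C y" by (rule isomorphicE)
  have "iso_arrow C (Susp C x) (Susp C y) (SuspMap C f)"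
    by (rule iso_arrowI[where g = "SuspMap C g"])
       (use f in \<open>simp_all flip: SuspMap_Comp'\<close>)
  then show ?thesis by (auto simp: isomorphic_def)
qed

lemma is_zero_Susp: "is_zero C x \<Longrightarrow> is_zero C (Susp C x)"
  using SuspMap_Ide[of x] by (simp add: is_zero_def)

lemma is_zero_Susp_iff: "is_zero C (Susp C x) \<longleftrightarrow> is_zero C x"
proof
  assume "is_zero C (Susp C x)"
  then have "SuspMap C (Ide C x) = SuspMap C (Zero C x x)" by (simp add: is_zero_def)
  then show "is_zero C x" unfolding is_zero_def by (rule SuspMap_inject) simp_all
qed (rule is_zero_Susp)

lemma tri_exists:
  assumes "Dom C f = x" "Cod C f = y" obtains z g h where "tri x y z f g h"
proof -
  obtain g h where t: "(f, g, h) \<in> Triangles C" using triangle_exists by blast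
  from triangle_Hom[OF this] assms have "tri x y (Cod C g) f g h"
    using t by (auto simp: tri_def)
  then show ?thesis by (rule that)
qed

lemma tri_rotate: "tri x y z f g h \<Longrightarrow> tri y z (Susp C x) g h (Neg C (SuspMap C f))"
  using triangle_rotate[of f x y g z h] by (auto simp: tri_def)

lemma tri_rotate_back:
  "tri y z (Susp C x) g h (Neg C (SuspMap C f)) \<Longrightarrow> Dom C f = x \<Longrightarrow> Cod C f = y \<Longrightarrow> tri x y z f g h"
  using triangle_rotate[of f x y g z h] by (auto simp: tri_def)

lemma tri_iso:
  assumes "tri x y z f g h" "iso_arrow C x x' a" "iso_arrow C y y' b" "iso_arrow C z z' c"
    "b \<cdot> f = f' \<cdot> a" "c \<cdot> g = g' \<cdot> b" "SuspMap C a \<cdot> h = h' \<cdot> c"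
    "Dom C f' = x'" "Cod C f' = y'" "Dom C g' = y'" "Cod C g' = z'" "Dom C h' = z'" "Cod C h' = Susp C x'"
  shows "tri x' y' z' f' g' h'"
  using triangle_iso[of f g h x y z f' x' y' g' z' h' a b c] assms by (auto simp: tri_def)

lemma tri_fill:
  assumes "tri x y z f g h" "tri x' y' z' f' g' h'"
    "Dom C a = x" "Cod C a = x'" "Dom C b = y" "Cod C b = y'" "b \<cdot> f = f' \<cdot> a"
  obtains c where "Dom C c = z" "Cod C c = z'" "c \<cdot> g = g' \<cdot> b" "SuspMap C a \<cdot> h = h' \<cdot> c"
  using triangle_fill[of f g h f' g' h' x y z x' y' z' a b] assms by (auto simp: tri_def)

lemma tri_Ide: "is_zero C z \<Longrightarrow> tri x x z (Ide C x) (Zero C x z) (Zero C z (Susp C x))"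
  using triangle_Ide[of z x] by (simp add: tri_def)

lemma tri_Ide_right: "is_zero C z \<Longrightarrow> tri z x x (Zero C z x) (Ide C x) (Zero C x (Susp C z))"
  by (rule tri_rotate_back) (simp_all add: tri_Ide is_zero_Susp)

text \<open>The cone \<open>w\<close> of \<open>g\<close> is only isomorphic to a suspension.
  Fullness of \<Sigma> turns its connecting map into some \<open>SuspMap C f'\<close>, and the sign
  in \<open>Neg C f'\<close> cancels the one introduced by rotation.\<close>

lemma tri_fibre:
  assumes "Dom C g = y" "Cod C g = z" obtains x f h where "tri x y z f g h"
proof -
  obtain w k l where t: "tri y z w g k l" using tri_exists assms by blast
  obtain x where "isomorphic C (Susp C x) w" using Susp_surj by blast
  then obtain \<phi> where \<phi>: "iso_arrow C w (Susp C x) \<phi>"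
    using isomorphic_sym unfolding isomorphic_def by blast
  then obtain \<psi> where \<psi>: "Dom C \<phi> = w" "Cod C \<phi> = Susp C x" "Dom C \<psi> = Susp C x" "Cod C \<psi> = w"
    "\<psi> \<cdot> \<phi> = Ide C w" "\<phi> \<cdot> \<psi> = Ide C (Susp C x)" by (rule iso_arrowE)
  note d = triD[OF t]
  obtain f' where f': "Dom C f' = x" "Cod C f' = y" "SuspMap C f' = l \<cdot> \<psi>"
    by (rule SuspMap_full[of "l \<cdot> \<psi>" x y]) (use \<psi> d in simp_all)
  have "tri y z (Susp C x) g (\<phi> \<cdot> k) (Neg C (SuspMap C (Neg C f')))"
    by (rule tri_iso[OF t iso_Ide iso_Ide \<phi>])
       (use d \<psi> f' in \<open>simp_all add: SuspMap_Neg\<close>)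
  then have "tri x y z (Neg C f') g (\<phi> \<cdot> k)"
    by (rule tri_rotate_back) (use f' in simp_all)
  then show ?thesis by (rule that)
qed

text \<open>Comparison with the triangle on \<open>Ide C x\<close>, whose third object is zero: the
  fill-in exhibits \<open>g \<cdot> f\<close> as a composite through a zero object.\<close>

lemma tri_comp_Zero: assumes "tri x y z f g h" shows "g \<cdot> f = Zero C x z"
proof -
  obtain o' where o': "is_zero C o'" using ex_zero by blast
  note d = triD[OF assms]
  obtain c where "Dom C c = o'" "Cod C c = z" "c \<cdot> Zero C x o' = g \<cdot> f"
    by (rule tri_fill[OF tri_Ide[OF o'] assms, where a = "Ide C x" and b = f]) (use d in auto)
  then show ?thesis by simp
qed

lemma tri_comp_Zero'': assumes "tri x y z f g h" shows "SuspMap C f \<cdot> h = Zero C z (Susp C y)"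
proof -
  note d = triD[OF assms]
  have "Neg C (SuspMap C f) \<cdot> h = Zero C z (Susp C y)"
    using tri_comp_Zero[OF tri_rotate[OF tri_rotate[OF assms]]] .
  then have "Neg C (SuspMap C f \<cdot> h) = Zero C z (Susp C y)" using d by (simp add: Neg_Comp)
  then show ?thesis by (metis Neg_Neg Neg_Zero)
qed

text \<open>Comparison with a triangle whose first object is zero and whose second map is an
  identity; the fill-in is the factorisation.\<close>

lemma tri_weak_cokernel:
  assumes t: "tri x y z f g h" and k: "Dom C k = y" "k \<cdot> f = Zero C x (Cod C k)"
  obtains l where "Dom C l = z" "Cod C l = Cod C k" "l \<cdot> g = k"
proof -
  obtain o' where o': "is_zero C o'" using ex_zero by blast
  note d = triD[OF t]
  obtain c where "Dom C c = z" "Cod C c = Cod C k" "c \<cdot> g = Ide C (Cod C k) \<cdot> k"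
    by (rule tri_fill[OF t tri_Ide_right[OF o'], where a = "Zero C x o'" and b = k]) (use d k in auto)
  then show ?thesis using that by simp
qed

text \<open>The fill-in axiom produces a map on third objects only, so both triangles of the dual
  comparison are rotated and the fill-in is desuspended; the two rotation signs cancel.\<close>

lemma tri_weak_kernel:
  assumes t: "tri x y z f g h" and k: "Cod C k = y" "g \<cdot> k = Zero C (Dom C k) z"
  obtains l where "Dom C l = Dom C k" "Cod C l = x" "f \<cdot> l = k"
proof -
  obtain o' where o': "is_zero C o'" using ex_zero by blast
  note d = triD[OF t]
  let ?w = "Dom C k"
  obtain c where c: "Dom C c = Susp C ?w" "Cod C c = Susp C x"
     "SuspMap C k \<cdot> Neg C (SuspMap C (Ide C ?w)) = Neg C (SuspMap C f) \<cdot> c"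
    by (rule tri_fill[OF tri_rotate[OF tri_Ide[OF o', of ?w]] tri_rotate[OF t], where a = k and b = "Zero C o' z"])
       (use d k in auto)
  have "Neg C (SuspMap C k) = Neg C (SuspMap C f \<cdot> c)"
    using c d k by (simp add: Comp_Neg Neg_Comp)
  then have e: "SuspMap C k = SuspMap C f \<cdot> c" by (metis Neg_Neg)
  obtain l where l: "Dom C l = ?w" "Cod C l = x" "SuspMap C l = c"
    using SuspMap_full[OF c(1,2)] by metis
  have "f \<cdot> l = k"
    by (rule SuspMap_inject) (use e l d k in \<open>simp_all add: SuspMap_Comp'\<close>)
  then show ?thesis using that l by simp
qed

text \<open>A map killing \<open>g\<close> factors through the connecting map \<open>h\<close>,
  which vanishes here: \<open>g\<close> is an epimorphism.\<close>

lemma tri_epi: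
  assumes t: "tri x y z f g h" and "h = Zero C z (Susp C x)"
    and k: "Dom C k = z" "k \<cdot> g = Zero C y (Cod C k)"
  shows "k = Zero C z (Cod C k)"
proof -
  obtain l where "Dom C l = Susp C x" "Cod C l = Cod C k" "l \<cdot> h = k"
    using tri_weak_cokernel[OF tri_rotate[OF t], of k] k by auto
  then show ?thesis using assms(2) by auto
qed

lemma tri_epi_eq:
  assumes t: "tri x y z f g h" and "h = Zero C z (Susp C x)"
    and k: "Dom C k = z" "Dom C k' = z" "Cod C k = Cod C k'" "k \<cdot> g = k' \<cdot> g"
  shows "k = k'"
proof -
  note d = triD[OF t]
  have "(k \<^bold>+ Neg C k') \<cdot> g = Zero C y (Cod C k')"
    using k d by (simp add: Add_Comp' Neg_Comp Add_Neg)
  then have "k \<^bold>+ Neg C k' = Zero C z (Cod C k')"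
    using tri_epi[OF t assms(2), of "k \<^bold>+ Neg C k'"] k by simp
  then show ?thesis by (rule diff_eq_Zero[rotated 2]) (use k in auto)
qed

text \<open>Exactness makes both \<open>g\<close> and \<open>h\<close> vanish, and then the identity
  of \<open>z\<close> factors through \<open>g\<close>.\<close>

lemma third_zero_if_iso_arrow:
  assumes t: "tri x y z f g h" and "iso_arrow C x y f" shows "is_zero C z"
proof -
  note d = triD[OF t]
  obtain k where k: "Dom C k = y" "Cod C k = x" "k \<cdot> f = Ide C x" "f \<cdot> k = Ide C y"
    using assms(2) by (rule iso_arrowE)
  have "g = g \<cdot> (f \<cdot> k)" using k d by simp
  also have "\<dots> = Zero C y z"
    using comp_reduce[OF tri_comp_Zero[OF t], of k] k d by simp
  finally have g: "g = Zero C y z" .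
  have "h = (SuspMap C k \<cdot> SuspMap C f) \<cdot> h" using k d by (simp flip: SuspMap_Comp')
  also have "\<dots> = Zero C z (Susp C x)"
    using tri_comp_Zero''[OF t] k d by simp
  finally have h: "h = Zero C z (Susp C x)" .
  obtain l where "Dom C l = z" "Cod C l = y" "g \<cdot> l = Ide C z"
    using tri_weak_kernel[OF tri_rotate[OF t], of "Ide C z"] d h by auto
  then show ?thesis using g by (simp add: is_zero_def)
qed

lemma tri_octahedral:
  assumes "tri x y z' f f1 f2" "tri y z x' g g1 g2" "tri x z y' (g \<cdot> f) h1 h2"
  obtains u v where "tri z' y' x' u v (SuspMap C f1 \<cdot> g2)"
    "u \<cdot> f1 = h1 \<cdot> g" "h2 \<cdot> u = f2" "v \<cdot> h1 = g1" "g2 \<cdot> v = SuspMap C f \<cdot> h2"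
proof -
  note d = triD[OF assms(1)] triD[OF assms(2)] triD[OF assms(3)]
  have "\<exists>u\<in>Hom C z' y'. \<exists>v\<in>Hom C y' x'. (u, v, SuspMap C f1 \<cdot> g2) \<in> Triangles C \<and>
      u \<cdot> f1 = h1 \<cdot> g \<and> h2 \<cdot> u = f2 \<and> v \<cdot> h1 = g1 \<and> g2 \<cdot> v = SuspMap C f \<cdot> h2"
    by (rule octahedral) (use d in simp_all)
  then obtain u v where uv: "u \<in> Hom C z' y'" "v \<in> Hom C y' x'"
    "(u, v, SuspMap C f1 \<cdot> g2) \<in> Triangles C"
    "u \<cdot> f1 = h1 \<cdot> g" "h2 \<cdot> u = f2" "v \<cdot> h1 = g1" "g2 \<cdot> v = SuspMap C f \<cdot> h2"
    by (elim bexE conjE)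
  have "tri z' y' x' u v (SuspMap C f1 \<cdot> g2)" unfolding tri_def using uv(1-3) d by simp
  then show ?thesis by (rule that[OF _ uv(4-7)])
qed

text \<open>The retraction \<open>p\<close> forces the connecting map to vanish, so \<open>g\<close>
  is epi. The inclusion \<open>m\<close> of the complement comes from factoring the complementary
  idempotent \<open>?e\<close> through \<open>g\<close>.\<close>

lemma split_mono_biproduct:
  assumes "Dom C i = x" "Cod C i = b" "Dom C p = b" "p \<cdot> i = Ide C x" "Cod C p = x"
  obtains d g h where "tri x b d i g h" "is_biproduct C b x d"
proof -
  obtain d g h where t: "tri x b d i g h" using tri_exists assms by blast
  note D = triD[OF t]
  have "h = (SuspMap C p \<cdot> SuspMap C i) \<cdot> h" using assms D by (simp flip: SuspMap_Comp')
  also have "\<dots> = Zero C d (Susp C x)"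
    using tri_comp_Zero''[OF t] assms D by simp
  finally have h: "h = Zero C d (Susp C x)" .
  let ?e = "Ide C b \<^bold>+ Neg C (i \<cdot> p)"
  have "?e \<cdot> i = Zero C x b"
    using assms D by (simp add: Add_Comp' Neg_Comp Add_Neg)
  then obtain m where m: "Dom C m = d" "Cod C m = b" "m \<cdot> g = ?e"
    using tri_weak_cokernel[OF t, of ?e] assms by auto
  have gi: "g \<cdot> i = Zero C x d" by (rule tri_comp_Zero[OF t])
  have ge: "g \<cdot> ?e = g"
    using assms D by (simp add: Comp_Add' Comp_Neg comp_reduce[OF gi])
  have gm: "g \<cdot> m = Ide C d"
    by (rule tri_epi_eq[OF t h]) (use m D ge in auto)
  have pe: "p \<cdot> ?e = Zero C b x"
    using assms D by (simp add: Comp_Add' Comp_Neg comp_reduce[OF assms(4)] Add_Neg)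
  have pm: "p \<cdot> m = Zero C d x"
    by (rule tri_epi_eq[OF t h]) (use m D assms pe in auto)
  have "i \<cdot> p \<^bold>+ m \<cdot> g = Ide C b"
    unfolding m by (rule retract_compl_sum) (use assms in auto)
  then have "is_biproduct C b x d" unfolding is_biproduct_def
    using assms m D gm pm gi
    by (intro exI[of _ i] exI[of _ m] exI[of _ p] exI[of _ g]) auto
  then show ?thesis using t that by blast
qed

lemma tri_split_section:
  assumes t: "tri x y z f g (Zero C z (Susp C x))"
  obtains m where "Dom C m = z" "Cod C m = y" "g \<cdot> m = Ide C z"
  using tri_weak_kernel[OF tri_rotate[OF t], of "Ide C z"] triD[OF t] by auto

text \<open>\<open>q\<close> factors through the cone of \<open>i\<close>, and
  \<open>g \<cdot> j\<close> inverts the factor; so the cone can be replaced by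
  \<open>y\<close>.\<close>

lemma biproduct_tri:
  assumes "is_biproduct C s x y"
  obtains f g h where "tri x s y f g h"
proof -
  obtain i j p q where b: "i \<in> Hom C x s" "j \<in> Hom C y s" "p \<in> Hom C s x" "q \<in> Hom C s y"
        "p \<cdot> i = Ide C x" "q \<cdot> j = Ide C y" "p \<cdot> j = Zero C y x" "q \<cdot> i = Zero C x y"
        "(i \<cdot> p) \<^bold>+ (j \<cdot> q) = Ide C s" using assms by (auto simp: is_biproduct_def)
  then have B: "Dom C i = x" "Cod C i = s" "Dom C j = y" "Cod C j = s"
    "Dom C p = s" "Cod C p = x" "Dom C q = s" "Cod C q = y" by auto
  obtain d g h where t: "tri x s d i g h" using tri_exists B by blast
  note D = triD[OF t]
  have "h = (SuspMap C p \<cdot> SuspMap C i) \<cdot> h" using B D b(5) by (simp flip: SuspMap_Comp')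
  also have "\<dots> = Zero C d (Susp C x)"
    using tri_comp_Zero''[OF t] B D by simp
  finally have h: "h = Zero C d (Susp C x)" .
  obtain r where r: "Dom C r = d" "Cod C r = y" "r \<cdot> g = q"
    using tri_weak_cokernel[OF t, of q] B b(8) by auto
  have gi: "g \<cdot> i = Zero C x d" by (rule tri_comp_Zero[OF t])
  have "g \<cdot> (i \<cdot> p \<^bold>+ j \<cdot> q) = g" using b(9) D by simp
  then have gjq: "g \<cdot> (j \<cdot> q) = g"
    using B D by (simp add: Comp_Add' comp_reduce[OF gi])
  have gjr: "(g \<cdot> j) \<cdot> r = Ide C d"
    by (rule tri_epi_eq[OF t h]) (use r B D gjq in auto)
  have rgj: "r \<cdot> (g \<cdot> j) = Ide C y"
    using comp_reduce[OF r(3)] r B D b(6) by simp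
  have iso: "iso_arrow C d y r"
    by (rule iso_arrowI[where g = "g \<cdot> j"]) (use r B D gjr rgj in auto)
  have "tri x s y i q (Zero C y (Susp C x))"
    by (rule tri_iso[OF t iso_Ide iso_Ide iso]) (use r B D h in auto)
  then show ?thesis by (rule that)
qed

text \<open>\<Sigma> is an equivalence: every target is replaced by an isomorphic suspension, where
  maps and equations desuspend.\<close>

lemma Susp_coproduct:
  assumes "is_coproduct C I t c \<iota>"
  shows "is_coproduct C I (\<lambda>i. Susp C (t i)) (Susp C c) (\<lambda>i. SuspMap C (\<iota> i))"
proof -
  note inj = coproduct_inj[OF assms]
  have desusp: "\<exists>w \<phi> \<psi>. Dom C \<phi> = Susp C w \<and> Cod C \<phi> = z \<and> Dom C \<psi> = z \<and> Cod C \<psi> = Susp C w \<and>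
    \<psi> \<cdot> \<phi> = Ide C (Susp C w) \<and> \<phi> \<cdot> \<psi> = Ide C z" for z
  proof -
    obtain w where "isomorphic C (Susp C w) z" using Susp_surj by blast
    then show ?thesis by (rule isomorphicE) blast
  qed
  show ?thesis
  proof (rule coproductI)
    fix i assume "i \<in> I"
    then show "Dom C (SuspMap C (\<iota> i)) = Susp C (t i) \<and> Cod C (SuspMap C (\<iota> i)) = Susp C c"
      using inj by simp
  next
    fix z g assume g: "\<And>i. i \<in> I \<Longrightarrow> Dom C (g i) = Susp C (t i) \<and> Cod C (g i) = z"
    obtain w \<phi> \<psi> where w: "Dom C \<phi> = Susp C w" "Cod C \<phi> = z" "Dom C \<psi> = z" "Cod C \<psi> = Susp C w"
      "\<psi> \<cdot> \<phi> = Ide C (Susp C w)" "\<phi> \<cdot> \<psi> = Ide C z" using desusp by blast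
    have "\<exists>k. Dom C k = t i \<and> Cod C k = w \<and> SuspMap C k = \<psi> \<cdot> g i" if "i \<in> I" for i
      by (rule SuspMap_full[of "\<psi> \<cdot> g i" "t i" w]) (use g w that in auto)
    then obtain k where k: "\<And>i. i \<in> I \<Longrightarrow> Dom C (k i) = t i \<and> Cod C (k i) = w \<and> SuspMap C (k i) = \<psi> \<cdot> g i"
      by metis
    obtain h where h: "Dom C h = c" "Cod C h = w" "\<And>i. i \<in> I \<Longrightarrow> h \<cdot> \<iota> i = k i"
      using coproduct_map[OF assms, of k w] k by metis
    have "(\<phi> \<cdot> SuspMap C h) \<cdot> SuspMap C (\<iota> i) = g i" if i: "i \<in> I" for i
    proof -
      have "SuspMap C h \<cdot> SuspMap C (\<iota> i) = \<psi> \<cdot> g i"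
        using SuspMap_Comp'[of "\<iota> i" h] h inj[OF i] i k by simp
      then show ?thesis using w h inj[OF i] g[OF i] comp_reduce[OF w(6)] by simp
    qed
    then show "\<exists>h. Dom C h = Susp C c \<and> Cod C h = z \<and> (\<forall>i\<in>I. h \<cdot> SuspMap C (\<iota> i) = g i)"
      using w h by (intro exI[of _ "\<phi> \<cdot> SuspMap C h"]) auto
  next
    fix h h' assume h: "Dom C h = Susp C c" "Dom C h' = Susp C c" "Cod C h = Cod C h'"
      "\<And>i. i \<in> I \<Longrightarrow> h \<cdot> SuspMap C (\<iota> i) = h' \<cdot> SuspMap C (\<iota> i)"
    obtain w \<phi> \<psi> where w: "Dom C \<phi> = Susp C w" "Cod C \<phi> = Cod C h'" "Dom C \<psi> = Cod C h'" "Cod C \<psi> = Susp C w"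
      "\<psi> \<cdot> \<phi> = Ide C (Susp C w)" "\<phi> \<cdot> \<psi> = Ide C (Cod C h')" using desusp by blast
    obtain k where k: "Dom C k = c" "Cod C k = w" "SuspMap C k = \<psi> \<cdot> h"
      using SuspMap_full[of "\<psi> \<cdot> h" c w] h w by auto
    obtain k' where k': "Dom C k' = c" "Cod C k' = w" "SuspMap C k' = \<psi> \<cdot> h'"
      using SuspMap_full[of "\<psi> \<cdot> h'" c w] h w by auto
    have "k = k'"
    proof (rule coproduct_eqI[OF assms])
      fix i assume i: "i \<in> I"
      show "k \<cdot> \<iota> i = k' \<cdot> \<iota> i"
        by (rule SuspMap_inject) (use k k' inj[OF i] h(1-3) h(4)[OF i] w in \<open>auto simp: SuspMap_Comp'\<close>)
    qed (use k k' in auto)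
    then have "\<phi> \<cdot> (\<psi> \<cdot> h) = \<phi> \<cdot> (\<psi> \<cdot> h')" using k k' by simp
    then show "h = h'" using h w by (simp add: comp_reduce[OF w(6)])
  qed
qed

end

section \<open>Small coproducts and compact objects\<close>

context category
begin

context includes cardinal_syntax begin

section \<open>Small sets and coproducts of small families\<close>

lemma Cinfinite_Univ: "Cinfinite |Univ C|"
proof -
  have "|UNIV :: nat set| <o |Univ C|" using universe by (simp add: inaccessible_def)
  then have "infinite (Univ C)"
    using infinite_UNIV_nat card_of_ordLeq_infinite ordLess_imp_ordLeq by blast
  then show ?thesis by (simp add: cinfinite_def card_of_card_order_on Field_card_of)
qed

lemma small_subset: "A \<subseteq> B \<Longrightarrow> small C B \<Longrightarrow> small C A"
  unfolding small_def by (rule ordLeq_ordLess_trans[OF card_of_mono1])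

lemma small_image: "small C A \<Longrightarrow> small C (f ` A)"
  unfolding small_def by (rule ordLeq_ordLess_trans[OF card_of_image])

lemma small_nat: "small C (UNIV :: nat set)"
  using universe by (simp add: inaccessible_def small_def)

text \<open>Here the regularity of the universe cardinal enters.\<close>

lemma small_UN:
  "small C I \<Longrightarrow> (\<And>i. i \<in> I \<Longrightarrow> small C (A i)) \<Longrightarrow> small C (\<Union>i\<in>I. A i)"
  unfolding small_def
  by (rule card_of_UNION_ordLess_infinite_Field_regularCard[OF _ Cinfinite_Univ])
     (use universe in \<open>simp_all add: inaccessible_def\<close>)

lemma small_Un: "small C A \<Longrightarrow> small C B \<Longrightarrow> small C (A \<union> B)"
proof -
  assume "small C A" "small C B"
  \<comment> \<open>A two-element index set, written as an image of the naturals so that its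
    smallness is already known.\<close>
  have "A \<union> B = (\<Union>b\<in>range (\<lambda>n. n = (0::nat)). if b then A else B)"
    by (auto simp: image_def)
  also have "small C \<dots>"
    by (rule small_UN[OF small_image[OF small_nat]]) (use \<open>small C A\<close> \<open>small C B\<close> in simp)
  finally show ?thesis .
qed

lemma small_inj: assumes "small C A" obtains e :: "'i \<Rightarrow> 'u" where "inj_on e (A :: 'i set)"
  using assms card_of_ordLeq[of A "Univ C"] ordLess_imp_ordLeq unfolding small_def by blast

end

text \<open>Coproducts are available for index sets inside \<open>'u\<close>. A small family over
  any type is re-indexed along an injection into \<open>'u\<close>, inverted by
  \<open>the_inv_into\<close>.\<close>

lemma small_family_coproduct:
  fixes A :: "'i set"
  assumes "has_small_coproducts C" "small C A"
  obtains e :: "'i \<Rightarrow> 'u" and c \<iota> where "inj_on e A" "small C (e ` A)"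
    "is_coproduct C (e ` A) (\<lambda>i. t (the_inv_into A e i)) c \<iota>"
proof -
  obtain e :: "'i \<Rightarrow> 'u" where e: "inj_on e A" by (rule small_inj[OF assms(2)])
  moreover have s: "small C (e ` A)" by (rule small_image[OF assms(2)])
  ultimately show ?thesis using assms(1) that unfolding has_small_coproducts_def by blast
qed

end

section \<open>Compactness in terms of truncations of coproducts\<close>

context additive_category
begin

text \<open>The idempotent of the coproduct onto the summands indexed by \<open>F\<close>. The
  equation \<open>\<tau> \<cdot> h = h\<close> expresses that \<open>h\<close> lands in a
  subcoproduct, without forming that subcoproduct.\<close>

definition trunc :: "'u set \<Rightarrow> ('u \<Rightarrow> 'o) \<Rightarrow> 'o \<Rightarrow> ('u \<Rightarrow> 'm) \<Rightarrow> 'u set \<Rightarrow> 'm \<Rightarrow> bool" where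
  "trunc I t c \<iota> F \<tau> \<longleftrightarrow> Dom C \<tau> = c \<and> Cod C \<tau> = c \<and>
     (\<forall>i\<in>I. \<tau> \<cdot> \<iota> i = (if i \<in> F then \<iota> i else Zero C (t i) c))"

definition projections :: "'u set \<Rightarrow> ('u \<Rightarrow> 'o) \<Rightarrow> 'o \<Rightarrow> ('u \<Rightarrow> 'm) \<Rightarrow> ('u \<Rightarrow> 'm) \<Rightarrow> bool" where
  "projections I t c \<iota> p \<longleftrightarrow> (\<forall>j\<in>I. Dom C (p j) = c \<and> Cod C (p j) = t j \<and>
     (\<forall>i\<in>I. p j \<cdot> \<iota> i = (if i = j then Ide C (t j) else Zero C (t i) (t j))))"

lemma trunc_exists:
  assumes "is_coproduct C I t c \<iota>" obtains \<tau> where "trunc I t c \<iota> F \<tau>"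
proof -
  have "\<And>i. i \<in> I \<Longrightarrow> Dom C (if i \<in> F then \<iota> i else Zero C (t i) c) = t i \<and>
      Cod C (if i \<in> F then \<iota> i else Zero C (t i) c) = c"
    using coproduct_inj[OF assms] by simp
  from coproduct_map[OF assms this] obtain \<tau> where "Dom C \<tau> = c" "Cod C \<tau> = c"
    "\<And>i. i \<in> I \<Longrightarrow> \<tau> \<cdot> \<iota> i = (if i \<in> F then \<iota> i else Zero C (t i) c)" by blast
  then show ?thesis by (intro that[of \<tau>]) (simp add: trunc_def)
qed

lemma trunc_unique:
  assumes "is_coproduct C I t c \<iota>" "trunc I t c \<iota> F \<tau>" "trunc I t c \<iota> F \<tau>'" shows "\<tau> = \<tau>'"
  by (rule coproduct_eqI[OF assms(1)]) (use assms(2,3) in \<open>simp_all add: trunc_def\<close>)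

lemma projections_exist:
  assumes "is_coproduct C I t c \<iota>" obtains p where "projections I t c \<iota> p"
proof -
  have "\<exists>p. Dom C p = c \<and> Cod C p = t j \<and>
     (\<forall>i\<in>I. p \<cdot> \<iota> i = (if i = j then Ide C (t j) else Zero C (t i) (t j)))" if j: "j \<in> I" for j
  proof -
    obtain p where p: "Dom C p = c" "Cod C p = t j" "p \<cdot> \<iota> j = Ide C (t j)"
      "\<And>i. i \<in> I \<Longrightarrow> i \<noteq> j \<Longrightarrow> p \<cdot> \<iota> i = Zero C (t i) (t j)"
      using coproduct_proj[OF assms j] by blast
    then show ?thesis by (intro exI[of _ p]) simp
  qed
  then obtain p where "\<forall>j\<in>I. Dom C (p j) = c \<and> Cod C (p j) = t j \<and>
     (\<forall>i\<in>I. p j \<cdot> \<iota> i = (if i = j then Ide C (t j) else Zero C (t i) (t j)))"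
    by metis
  then show ?thesis by (intro that[of p]) (simp add: projections_def)
qed

lemma trunc_empty:
  assumes "is_coproduct C I t c \<iota>" shows "trunc I t c \<iota> {} (Zero C c c)"
  using coproduct_inj[OF assms] by (simp add: trunc_def)

lemma trunc_insert:
  assumes cp: "is_coproduct C I t c \<iota>" and p: "projections I t c \<iota> p" and \<tau>: "trunc I t c \<iota> F \<tau>"
    and i: "i \<in> I" "i \<notin> F"
  shows "trunc I t c \<iota> (insert i F) (\<tau> \<^bold>+ \<iota> i \<cdot> p i)"
proof -
  note inj = coproduct_inj[OF cp]
  have pi: "Dom C (p i) = c" "Cod C (p i) = t i"
    "\<And>j. j \<in> I \<Longrightarrow> p i \<cdot> \<iota> j = (if j = i then Ide C (t i) else Zero C (t j) (t i))"
    using p i by (simp_all add: projections_def)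
  have t: "Dom C \<tau> = c" "Cod C \<tau> = c"
    "\<And>j. j \<in> I \<Longrightarrow> \<tau> \<cdot> \<iota> j = (if j \<in> F then \<iota> j else Zero C (t j) c)"
    using \<tau> by (simp_all add: trunc_def)
  have "(\<tau> \<^bold>+ \<iota> i \<cdot> p i) \<cdot> \<iota> j = (if j \<in> insert i F then \<iota> j else Zero C (t j) c)" if j: "j \<in> I" for j
    using pi t inj[OF i(1)] inj[OF j] i(2) j by (simp add: Add_Comp')
  then show ?thesis using t pi inj[OF i(1)] by (simp add: trunc_def)
qed

lemma trunc_trunc:
  assumes "is_coproduct C I t c \<iota>" "trunc I t c \<iota> F \<tau>" "trunc I t c \<iota> F' \<tau>'" "F \<subseteq> F'"
  shows "\<tau>' \<cdot> \<tau> = \<tau>"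
proof (rule coproduct_eqI[OF assms(1)])
  fix i assume "i \<in> I"
  then show "(\<tau>' \<cdot> \<tau>) \<cdot> \<iota> i = \<tau> \<cdot> \<iota> i"
    using assms coproduct_inj[OF assms(1)] by (auto simp: trunc_def)
qed (use assms in \<open>simp_all add: trunc_def\<close>)

text \<open>For finite \<open>F\<close> the truncation is the sum of the
  \<open>\<iota> i \<cdot> p i\<close>, so \<open>\<tau> \<cdot> h\<close> is reached from zero by
  adding one component at a time. The predicate \<open>Q\<close> keeps explicit finite sums out of
  the applications.\<close>

lemma trunc_induct:
  assumes cp: "is_coproduct C I t c \<iota>" and p: "projections I t c \<iota> p"
    and F: "finite F" "F \<subseteq> I" and \<tau>: "trunc I t c \<iota> F \<tau>" and h: "Cod C h = c"
    and zero: "Q (Zero C (Dom C h) c)"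
    and step: "\<And>k i. i \<in> I \<Longrightarrow> Dom C k = Dom C h \<Longrightarrow> Cod C k = c \<Longrightarrow> Q k \<Longrightarrow> Q (k \<^bold>+ \<iota> i \<cdot> (p i \<cdot> h))"
  shows "Q (\<tau> \<cdot> h)"
  using F \<tau>
proof (induction F arbitrary: \<tau> rule: finite_induct)
  case empty
  then have "\<tau> = Zero C c c" using trunc_unique[OF cp _ trunc_empty[OF cp]] by blast
  then show ?case using zero h by simp
next
  case (insert i F)
  obtain \<tau>0 where \<tau>0: "trunc I t c \<iota> F \<tau>0" using trunc_exists[OF cp] by blast
  have i: "i \<in> I" using insert by blast
  have pi: "Dom C (p i) = c" "Cod C (p i) = t i" using p i by (simp_all add: projections_def)
  have "\<tau> = \<tau>0 \<^bold>+ \<iota> i \<cdot> p i"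
    using trunc_unique[OF cp insert.prems(2) trunc_insert[OF cp p \<tau>0 i insert.hyps(2)]] .
  then have "\<tau> \<cdot> h = \<tau>0 \<cdot> h \<^bold>+ \<iota> i \<cdot> (p i \<cdot> h)"
    using \<tau>0 pi h coproduct_inj[OF cp i] by (simp add: Add_Comp' trunc_def)
  then show ?case
    using step[OF i, of "\<tau>0 \<cdot> h"] insert.IH[OF _ \<tau>0] insert.prems(1) \<tau>0 h by (simp add: trunc_def)
qed

lemma trunc_fixes_finprod:
  assumes cp: "is_coproduct C I t c \<iota>" and F: "finite F" "F \<subseteq> I" and \<tau>: "trunc I t c \<iota> G \<tau>" "F \<subseteq> G"
    and g: "\<And>i. i \<in> F \<Longrightarrow> Dom C (g i) = x \<and> Cod C (g i) = t i"
  shows "\<tau> \<cdot> finprod (hom_group C x c) (\<lambda>i. \<iota> i \<cdot> g i) F = finprod (hom_group C x c) (\<lambda>i. \<iota> i \<cdot> g i) F \<and>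
    finprod (hom_group C x c) (\<lambda>i. \<iota> i \<cdot> g i) F \<in> Hom C x c"
  using F(1) F(2) \<tau>(2) g
proof (induction F rule: finite_induct)
  interpret G: comm_group "hom_group C x c" by (rule hom_comm_group)
  {
    case empty
    show ?case unfolding G.finprod_empty using \<tau>(1) by (simp add: hom_group_def trunc_def)
  next
    case (insert i F)
    note inj = coproduct_inj[OF cp]
    have ty: "\<iota> j \<cdot> g j \<in> carrier (hom_group C x c)" if "j \<in> insert i F" for j
      using inj[of j] insert.prems that by (auto simp: hom_group_def)
    let ?S = "finprod (hom_group C x c) (\<lambda>i. \<iota> i \<cdot> g i) F"
    have eq: "finprod (hom_group C x c) (\<lambda>i. \<iota> i \<cdot> g i) (insert i F) = (\<iota> i \<cdot> g i) \<^bold>+ ?S"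
      using insert.hyps ty by (subst G.finprod_insert) (auto simp: hom_group_def)
    have IH: "\<tau> \<cdot> ?S = ?S" "?S \<in> Hom C x c" using insert by auto
    have i: "Dom C (\<iota> i) = t i" "Cod C (\<iota> i) = c" "Dom C (g i) = x" "Cod C (g i) = t i"
      "\<tau> \<cdot> \<iota> i = \<iota> i" "Dom C \<tau> = c" "Cod C \<tau> = c"
      using inj[of i] insert.prems \<tau>(1) by (auto simp: trunc_def)
    show ?case unfolding eq using IH i by (simp add: Comp_Add' comp_reduce[OF i(5)])
  }
qed

lemma trunc_finprod:
  assumes cp: "is_coproduct C I t c \<iota>" and p: "projections I t c \<iota> p"
    and F: "finite F" "F \<subseteq> I" and \<tau>: "trunc I t c \<iota> F \<tau>" and h: "Cod C h = c" "Dom C h = x"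
  shows "\<tau> \<cdot> h = finprod (hom_group C x c) (\<lambda>i. \<iota> i \<cdot> (p i \<cdot> h)) F"
  using F \<tau>
proof (induction F arbitrary: \<tau> rule: finite_induct)
  interpret G: comm_group "hom_group C x c" by (rule hom_comm_group)
  {
    case empty
    then have "\<tau> = Zero C c c" using trunc_unique[OF cp _ trunc_empty[OF cp]] by blast
    then show ?case unfolding G.finprod_empty using h by (simp add: hom_group_def)
  next
    case (insert i F)
    note inj = coproduct_inj[OF cp]
    obtain \<tau>0 where \<tau>0: "trunc I t c \<iota> F \<tau>0" using trunc_exists[OF cp] by blast
    have pi: "\<And>j. j \<in> I \<Longrightarrow> Dom C (p j) = c" "\<And>j. j \<in> I \<Longrightarrow> Cod C (p j) = t j"
      using p by (simp_all add: projections_def)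
    have i: "i \<in> I" using insert by blast
    have ty: "\<iota> j \<cdot> (p j \<cdot> h) \<in> carrier (hom_group C x c)" if "j \<in> insert i F" for j
      using inj[of j] insert.prems that pi h by (auto simp: hom_group_def)
    let ?S = "finprod (hom_group C x c) (\<lambda>i. \<iota> i \<cdot> (p i \<cdot> h)) F"
    have eq: "finprod (hom_group C x c) (\<lambda>i. \<iota> i \<cdot> (p i \<cdot> h)) (insert i F) = (\<iota> i \<cdot> (p i \<cdot> h)) \<^bold>+ ?S"
      using insert.hyps ty by (subst G.finprod_insert) (auto simp: hom_group_def)
    have IH: "\<tau>0 \<cdot> h = ?S" using insert.IH[OF _ \<tau>0] insert.prems by blast
    have t0: "Dom C \<tau>0 = c" "Cod C \<tau>0 = c" using \<tau>0 by (simp_all add: trunc_def)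
    have "\<tau> = \<tau>0 \<^bold>+ \<iota> i \<cdot> p i"
      using trunc_unique[OF cp insert.prems(2) trunc_insert[OF cp p \<tau>0 i insert.hyps(2)]] .
    then have "\<tau> \<cdot> h = \<tau>0 \<cdot> h \<^bold>+ \<iota> i \<cdot> (p i \<cdot> h)"
      using t0 pi[OF i] h inj[OF i] by (simp add: Add_Comp')
    also have "\<dots> = (\<iota> i \<cdot> (p i \<cdot> h)) \<^bold>+ \<tau>0 \<cdot> h"
      using t0 pi[OF i] h inj[OF i] by (subst Add_commute) simp_all
    finally show ?case unfolding eq IH .
  }
qed

lemma proj_finprod:
  assumes cp: "is_coproduct C I t c \<iota>" and p: "projections I t c \<iota> p" and j: "j \<in> I"
    and F: "finite F" "F \<subseteq> I" and g: "\<And>i. i \<in> F \<Longrightarrow> Dom C (g i) = x \<and> Cod C (g i) = t i"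
  shows "p j \<cdot> finprod (hom_group C x c) (\<lambda>i. \<iota> i \<cdot> g i) F = (if j \<in> F then g j else Zero C x (t j)) \<and>
     finprod (hom_group C x c) (\<lambda>i. \<iota> i \<cdot> g i) F \<in> Hom C x c"
  using F g
proof (induction F rule: finite_induct)
  interpret G: comm_group "hom_group C x c" by (rule hom_comm_group)
  have pj: "Dom C (p j) = c" "Cod C (p j) = t j"
    "\<And>i. i \<in> I \<Longrightarrow> p j \<cdot> \<iota> i = (if i = j then Ide C (t j) else Zero C (t i) (t j))"
    using p j by (simp_all add: projections_def)
  {
    case empty
    show ?case unfolding G.finprod_empty using pj by (simp add: hom_group_def)
  next
    case (insert i F)
    note inj = coproduct_inj[OF cp]
    have i: "i \<in> I" "Dom C (\<iota> i) = t i" "Cod C (\<iota> i) = c" "Dom C (g i) = x" "Cod C (g i) = t i"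
      using inj[of i] insert.prems by auto
    have ty: "\<iota> j \<cdot> g j \<in> carrier (hom_group C x c)" if "j \<in> insert i F" for j
      using inj[of j] insert.prems that by (auto simp: hom_group_def)
    let ?S = "finprod (hom_group C x c) (\<lambda>i. \<iota> i \<cdot> g i) F"
    have eq: "finprod (hom_group C x c) (\<lambda>i. \<iota> i \<cdot> g i) (insert i F) = (\<iota> i \<cdot> g i) \<^bold>+ ?S"
      using insert.hyps ty by (subst G.finprod_insert) (auto simp: hom_group_def)
    have IH: "p j \<cdot> ?S = (if j \<in> F then g j else Zero C x (t j))" "?S \<in> Hom C x c"
      using insert by auto
    have "p j \<cdot> (\<iota> i \<cdot> g i) = (if i = j then g j else Zero C x (t j))"
      using comp_reduce[OF pj(3)[OF i(1)], of "g i"] i pj by auto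
    then show ?case unfolding eq using IH i pj insert.hyps insert.prems by (auto simp: Comp_Add')
  }
qed

text \<open>Surjectivity of the canonical map onto \<open>Hom C x c\<close> is the truncation
  condition; injectivity always holds, because the projections recover the components of a finite
  sum.\<close>

lemma compact_iff_trunc:
  "is_compact C x \<longleftrightarrow> (\<forall>I t c \<iota> h. small C I \<longrightarrow> is_coproduct C I t c \<iota> \<longrightarrow> h \<in> Hom C x c \<longrightarrow>
      (\<exists>F \<tau>. finite F \<and> F \<subseteq> I \<and> trunc I t c \<iota> F \<tau> \<and> \<tau> \<cdot> h = h))" (is "_ \<longleftrightarrow> ?R")
proof
  assume x: "is_compact C x"
  show ?R
  proof (intro allI impI)
    fix I t c \<iota> h assume I: "small C I" and cp: "is_coproduct C I t c \<iota>" and h: "h \<in> Hom C x c"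
    have "bij_betw
          (\<lambda>g. finprod (hom_group C x c) (\<lambda>i. \<iota> i \<cdot> g i) {i\<in>I. g i \<noteq> Zero C x (t i)})
          {g \<in> (\<Pi>\<^sub>E i\<in>I. Hom C x (t i)). finite {i\<in>I. g i \<noteq> Zero C x (t i)}}
          (Hom C x c)" using x I cp unfolding is_compact_def by blast
    from bij_betw_imp_surj_on[OF this] h obtain g where
      g: "h = finprod (hom_group C x c) (\<lambda>i. \<iota> i \<cdot> g i) {i\<in>I. g i \<noteq> Zero C x (t i)}"
        "g \<in> (\<Pi>\<^sub>E i\<in>I. Hom C x (t i))" "finite {i\<in>I. g i \<noteq> Zero C x (t i)}" by blast
    obtain \<tau> where \<tau>: "trunc I t c \<iota> {i\<in>I. g i \<noteq> Zero C x (t i)} \<tau>"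
      using trunc_exists[OF cp] by blast
    have "\<tau> \<cdot> h = h" unfolding g(1)
      by (rule trunc_fixes_finprod[OF cp g(3) _ \<tau>, THEN conjunct1]) (use g(2) in \<open>auto simp: PiE_def Pi_def\<close>)
    then show "\<exists>F \<tau>. finite F \<and> F \<subseteq> I \<and> trunc I t c \<iota> F \<tau> \<and> \<tau> \<cdot> h = h"
      using g(3) \<tau> by (intro exI conjI) auto
  qed
next
  assume R: ?R
  show "is_compact C x" unfolding is_compact_def
  proof (intro allI impI)
    fix I t c \<iota> assume I: "small C I" and cp: "is_coproduct C I t c \<iota>"
    obtain p where p: "projections I t c \<iota> p" by (rule projections_exist[OF cp])
    interpret G: comm_group "hom_group C x c" by (rule hom_comm_group)
    note inj = coproduct_inj[OF cp]
    let ?s = "\<lambda>g. {i\<in>I. g i \<noteq> Zero C x (t i)}"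
    let ?A = "{g \<in> (\<Pi>\<^sub>E i\<in>I. Hom C x (t i)). finite (?s g)}"
    let ?f = "\<lambda>g. finprod (hom_group C x c) (\<lambda>i. \<iota> i \<cdot> g i) (?s g)"
    have pr: "p j \<cdot> ?f g = g j \<and> ?f g \<in> Hom C x c" if "g \<in> ?A" "j \<in> I" for g j
      using proj_finprod[OF cp p that(2), of "?s g" g x] that by (auto simp: PiE_def Pi_def)
    show "bij_betw ?f ?A (Hom C x c)"
    proof (rule bij_betw_imageI)
      show "inj_on ?f ?A"
      proof (rule inj_onI)
        fix g g' assume g: "g \<in> ?A" "g' \<in> ?A" "?f g = ?f g'"
        have "g j = g' j" if "j \<in> I" for j
          using conjunct1[OF pr[OF g(1) that]] conjunct1[OF pr[OF g(2) that]] g(3) by simp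
        then show "g = g'" using g(1,2) by (intro PiE_ext[of g I _ g']) auto
      qed
      have "?f g \<in> Hom C x c" if g: "g \<in> ?A" for g
      proof -
        have "\<iota> i \<cdot> g i \<in> Hom C x c" if "i \<in> ?s g" for i
          using g inj[of i] that by (simp add: PiE_def Pi_def)
        then have "?f g \<in> carrier (hom_group C x c)"
          by (intro G.finprod_closed) (simp add: hom_group_def)
        then show ?thesis by (simp only: hom_group_def monoid.simps partial_object.simps)
      qed
      moreover have "h \<in> ?f ` ?A" if h: "h \<in> Hom C x c" for h
      proof -
        obtain F \<tau> where F: "finite F" "F \<subseteq> I" "trunc I t c \<iota> F \<tau>" "\<tau> \<cdot> h = h"
          using R[rule_format, OF I cp h] by blast
        \<comment> \<open>The components of \<open>h\<close> on \<open>F\<close>, and zero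
          elsewhere. Components on \<open>F\<close> may vanish as well, so the support can be
          smaller than \<open>F\<close> and the two sums are compared by dropping neutral
          terms.\<close>
        let ?g = "\<lambda>i\<in>I. if i \<in> F then p i \<cdot> h else Zero C x (t i)"
        have pt: "\<And>i. i \<in> I \<Longrightarrow> Dom C (p i) = c \<and> Cod C (p i) = t i"
          using p by (simp add: projections_def)
        have s: "?s ?g \<subseteq> F" by auto
        have A: "?g \<in> ?A" using h pt finite_subset[OF s F(1)] by auto
        have "h = finprod (hom_group C x c) (\<lambda>i. \<iota> i \<cdot> (p i \<cdot> h)) F"
          using trunc_finprod[OF cp p F(1,2,3)] F(4) h by auto
        also have "\<dots> = ?f ?g"
        proof (rule G.finprod_mono_neutral_cong_left[OF F(1) s, symmetric])
          show "\<iota> i \<cdot> (p i \<cdot> h) = \<one>\<^bsub>hom_group C x c\<^esub>" if "i \<in> F - ?s ?g" for i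
            using that F(2) inj by (auto simp: hom_group_def)
          show "(\<lambda>i. \<iota> i \<cdot> (p i \<cdot> h)) \<in> F \<rightarrow> carrier (hom_group C x c)"
            using F(2) pt inj h by (auto simp: hom_group_def)
          show "\<iota> i \<cdot> ?g i = \<iota> i \<cdot> (p i \<cdot> h)" if "i \<in> ?s ?g" for i
            using that by (auto split: if_splits)
        qed
        finally show ?thesis using A by blast
      qed
      ultimately show "?f ` ?A = Hom C x c" by blast
    qed
  qed
qed

lemma compact_factors:
  assumes "is_compact C x" "small C I" "is_coproduct C I t c \<iota>" "Dom C h = x" "Cod C h = c"
  obtains F \<tau> where "finite F" "F \<subseteq> I" "trunc I t c \<iota> F \<tau>" "\<tau> \<cdot> h = h"
proof -
  have "h \<in> Hom C x c" using assms(4,5) by simp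
  from iffD1[OF compact_iff_trunc assms(1), rule_format, OF assms(2,3) this] show ?thesis
    using that by blast
qed

text \<open>By compactness some truncation fixes the map, which is thereby a finite sum of maps
  through single summands; this is induction over such a sum.\<close>

lemma compact_induct:
  assumes x: "is_compact C x" "small C I" and cp: "is_coproduct C I t c \<iota>" and h: "Dom C h = x" "Cod C h = c"
    and zero: "Q (Zero C x c)"
    and step: "\<And>k i g. i \<in> I \<Longrightarrow> Dom C k = x \<Longrightarrow> Cod C k = c \<Longrightarrow> Dom C g = x \<Longrightarrow> Cod C g = t i \<Longrightarrow>
       Q k \<Longrightarrow> Q (k \<^bold>+ \<iota> i \<cdot> g)"
  shows "Q h"
proof -
  obtain F \<tau> where F: "finite F" "F \<subseteq> I" "trunc I t c \<iota> F \<tau>" "\<tau> \<cdot> h = h"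
    using compact_factors[OF x cp h] .
  obtain p where p: "projections I t c \<iota> p" by (rule projections_exist[OF cp])
  have "Q (\<tau> \<cdot> h)"
  proof (rule trunc_induct[OF cp p F(1-3) h(2)])
    show "Q (Zero C (Dom C h) c)" using zero h by simp
    fix k i assume "i \<in> I" "Dom C k = Dom C h" "Cod C k = c" "Q k"
    then show "Q (k \<^bold>+ \<iota> i \<cdot> (p i \<cdot> h))"
      using p h by (intro step) (simp_all add: projections_def)
  qed
  then show ?thesis using F by simp
qed

lemma compact_eq_ZeroI:
  assumes x: "is_compact C x" "small C I" and cp: "is_coproduct C I t c \<iota>" and h: "Dom C h = x" "Cod C h = c"
    and p: "projections I t c \<iota> p" "\<And>i. i \<in> I \<Longrightarrow> p i \<cdot> h = Zero C x (t i)"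
  shows "h = Zero C x c"
proof -
  obtain F \<tau> where F: "finite F" "F \<subseteq> I" "trunc I t c \<iota> F \<tau>" "\<tau> \<cdot> h = h"
    using compact_factors[OF x cp h] .
  have "\<tau> \<cdot> h = Zero C x c"
    by (rule trunc_induct[OF cp p(1) F(1-3) h(2)]) (use coproduct_inj[OF cp] h p(2) in simp_all)
  then show ?thesis using F by simp
qed

text \<open>Two coproducts of one family are isomorphic compatibly with their injections, and
  conjugation carries truncations along. One conveniently built coproduct per family therefore
  suffices.\<close>

lemma compactI:
  assumes "\<And>I t c \<iota>. small C I \<Longrightarrow> is_coproduct C I t c \<iota> \<Longrightarrow> \<exists>c \<iota>. is_coproduct C I t c \<iota> \<and>
      (\<forall>h. Dom C h = x \<longrightarrow> Cod C h = c \<longrightarrow> (\<exists>F \<tau>. finite F \<and> F \<subseteq> I \<and> trunc I t c \<iota> F \<tau> \<and> \<tau> \<cdot> h = h))"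
  shows "is_compact C x"
  unfolding compact_iff_trunc
proof (intro allI impI)
  fix I t c \<iota> h assume I: "small C I" and cp: "is_coproduct C I t c \<iota>" and h: "h \<in> Hom C x c"
  obtain c' \<iota>' where cp': "is_coproduct C I t c' \<iota>'" and
    *: "\<And>h. Dom C h = x \<Longrightarrow> Cod C h = c' \<Longrightarrow> (\<exists>F \<tau>. finite F \<and> F \<subseteq> I \<and> trunc I t c' \<iota>' F \<tau> \<and> \<tau> \<cdot> h = h)"
    using assms[OF I cp] by blast
  obtain m where m: "iso_arrow C c c' m" "\<And>i. i \<in> I \<Longrightarrow> m \<cdot> \<iota> i = \<iota>' i"
    using coproduct_iso[OF cp cp'] by blast
  obtain n where n: "Dom C m = c" "Cod C m = c'" "Dom C n = c'" "Cod C n = c"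
    "n \<cdot> m = Ide C c" "m \<cdot> n = Ide C c'" using m(1) by (rule iso_arrowE)
  have hm: "Dom C (m \<cdot> h) = x" "Cod C (m \<cdot> h) = c'" using n h by simp_all
  from *[OF this] obtain F \<tau> where F: "finite F" "F \<subseteq> I" "trunc I t c' \<iota>' F \<tau>" "\<tau> \<cdot> (m \<cdot> h) = m \<cdot> h"
    by blast
  have \<tau>: "Dom C \<tau> = c'" "Cod C \<tau> = c'" using F(3) by (simp_all add: trunc_def)
  have "(n \<cdot> \<tau> \<cdot> m) \<cdot> \<iota> i = (if i \<in> F then \<iota> i else Zero C (t i) c)" if i: "i \<in> I" for i
  proof -
    have "(n \<cdot> \<tau> \<cdot> m) \<cdot> \<iota> i = n \<cdot> (\<tau> \<cdot> \<iota>' i)"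
      using n \<tau> m(2)[OF i] coproduct_inj[OF cp i] by simp
    also have "\<dots> = (if i \<in> F then n \<cdot> \<iota>' i else Zero C (t i) c)"
      using F(3) i n by (simp add: trunc_def)
    also have "n \<cdot> \<iota>' i = \<iota> i"
      using m(2)[OF i, symmetric] n coproduct_inj[OF cp i] comp_reduce[OF n(5)] by simp
    finally show ?thesis .
  qed
  then have "trunc I t c \<iota> F (n \<cdot> \<tau> \<cdot> m)" using n \<tau> by (simp add: trunc_def)
  moreover have "(n \<cdot> \<tau> \<cdot> m) \<cdot> h = h" using F(4) n \<tau> h comp_reduce[OF n(5), of h] by simp
  ultimately show "\<exists>F \<tau>. finite F \<and> F \<subseteq> I \<and> trunc I t c \<iota> F \<tau> \<and> \<tau> \<cdot> h = h" using F by blast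
qed

lemma compact_retract:
  assumes "is_compact C b" "Dom C i = x" "Cod C i = b" "Dom C r = b" "r \<cdot> i = Ide C x"
  shows "is_compact C x"
  unfolding compact_iff_trunc
proof (intro allI impI)
  fix I t c \<iota> h assume I: "small C I" and cp: "is_coproduct C I t c \<iota>" and h: "h \<in> Hom C x c"
  have r: "Cod C r = x" using Cod_Comp[of i r] assms by simp
  have "Dom C (h \<cdot> r) = b" "Cod C (h \<cdot> r) = c" using assms r h by simp_all
  from compact_factors[OF assms(1) I cp this] obtain F \<tau> where
    F: "finite F" "F \<subseteq> I" "trunc I t c \<iota> F \<tau>" "\<tau> \<cdot> (h \<cdot> r) = h \<cdot> r" .
  have \<tau>: "Dom C \<tau> = c" using F(3) by (simp add: trunc_def)
  have "\<tau> \<cdot> h = (\<tau> \<cdot> (h \<cdot> r)) \<cdot> i" using assms r h \<tau> by simp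
  also have "\<dots> = h" using F(4) assms r h by simp
  finally show "\<exists>F \<tau>. finite F \<and> F \<subseteq> I \<and> trunc I t c \<iota> F \<tau> \<and> \<tau> \<cdot> h = h" using F by blast
qed

lemma compact_isomorphic:
  assumes "is_compact C b" "isomorphic C b x" shows "is_compact C x"
proof -
  obtain f g where "Dom C f = b" "Cod C f = x" "Dom C g = x" "Cod C g = b"
    "g \<cdot> f = Ide C b" "f \<cdot> g = Ide C x" using assms(2) by (rule isomorphicE)
  then show ?thesis by (intro compact_retract[OF assms(1), of g x f])
qed

lemma compact_zero: assumes "is_zero C x" shows "is_compact C x"
  unfolding compact_iff_trunc
proof (intro allI impI)
  fix I t c \<iota> h assume I: "small C I" and cp: "is_coproduct C I t c \<iota>" and h: "h \<in> Hom C x c"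
  have "h = Zero C x c" using is_zero_from[OF assms, of h] h by simp
  then show "\<exists>F \<tau>. finite F \<and> F \<subseteq> I \<and> trunc I t c \<iota> F \<tau> \<and> \<tau> \<cdot> h = h"
    using trunc_empty[OF cp] by (intro exI[of _ "{}"] exI[of _ "Zero C c c"]) simp
qed

end

section \<open>Triangulated subcategories\<close>

context triangulated_category
begin

lemma triangulated_subcategoryI:
  assumes "\<And>x. is_zero C x \<Longrightarrow> x \<in> S"
    and "\<And>x y. x \<in> S \<Longrightarrow> isomorphic C x y \<Longrightarrow> y \<in> S"
    and "\<And>x. Susp C x \<in> S \<longleftrightarrow> x \<in> S"
    and "\<And>x y z f g h. tri x y z f g h \<Longrightarrow> x \<in> S \<Longrightarrow> y \<in> S \<Longrightarrow> z \<in> S"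
  shows "triangulated_subcategory C S"
  unfolding triangulated_subcategory_def
proof (intro conjI allI impI)
  fix f g h x y z
  assume *: "(f, g, h) \<in> Triangles C \<and> f \<in> Hom C x y \<and> g \<in> Hom C y z \<and> x \<in> S \<and> y \<in> S"
  then obtain x' y' z' where "f \<in> Hom C x' y'" "g \<in> Hom C y' z'" "h \<in> Hom C z' (Susp C x')"
    using triangle_Hom by blast
  then have "tri x y z f g h" using * by (simp add: tri_def)
  then show "z \<in> S" using assms(4) * by blast
qed (use assms(1,2,3) in blast)+

lemma triangulated_subcategoryD:
  assumes "triangulated_subcategory C S"
  shows "\<forall>x. is_zero C x \<longrightarrow> x \<in> S"
    "\<forall>x y. x \<in> S \<and> isomorphic C x y \<longrightarrow> y \<in> S"
    "\<forall>x. Susp C x \<in> S \<longleftrightarrow> x \<in> S"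
    "\<forall>f g h x y z. (f, g, h) \<in> Triangles C \<and> f \<in> Hom C x y \<and> g \<in> Hom C y z \<and>
      x \<in> S \<and> y \<in> S \<longrightarrow> z \<in> S"
  using assms unfolding triangulated_subcategory_def by - (elim conjE, assumption)+

lemma tsub_zero: "triangulated_subcategory C S \<Longrightarrow> is_zero C x \<Longrightarrow> x \<in> S"
  using triangulated_subcategoryD(1) by blast

lemma tsub_isomorphic: "triangulated_subcategory C S \<Longrightarrow> x \<in> S \<Longrightarrow> isomorphic C x y \<Longrightarrow> y \<in> S"
  using triangulated_subcategoryD(2) by blast

lemma tsub_Susp: "triangulated_subcategory C S \<Longrightarrow> Susp C x \<in> S \<longleftrightarrow> x \<in> S"
  using triangulated_subcategoryD(3) by blast

lemma tsub_third:
  assumes "triangulated_subcategory C S" "tri x y z f g h" "x \<in> S" "y \<in> S" shows "z \<in> S"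
  using triangulated_subcategoryD(4)[OF assms(1), rule_format, of f g h x y z] assms(2-4)
  by (simp add: tri_def)

lemma tsub_first:
  assumes "triangulated_subcategory C S" "tri x y z f g h" "y \<in> S" "z \<in> S" shows "x \<in> S"
  using tsub_third[OF assms(1) tri_rotate[OF assms(2)] assms(3,4)] tsub_Susp[OF assms(1)] by blast

lemma tsub_second:
  assumes "triangulated_subcategory C S" "tri x y z f g h" "x \<in> S" "z \<in> S" shows "y \<in> S"
  using tsub_first[OF assms(1) tri_rotate[OF assms(2)] assms(4)] tsub_Susp[OF assms(1)] assms(3) by blast

lemma tsub_biproduct:
  assumes "triangulated_subcategory C S" "is_biproduct C s x y" "x \<in> S" "y \<in> S" shows "s \<in> S"
  using biproduct_tri[OF assms(2)] tsub_second[OF assms(1) _ assms(3,4)] by blast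

lemma zero_objects_triangulated: "triangulated_subcategory C {x. is_zero C x}"
proof (rule triangulated_subcategoryI)
  fix x y z f g h assume t: "tri x y z f g h" "x \<in> {x. is_zero C x}" "y \<in> {x. is_zero C x}"
  then have "iso_arrow C x y f" using is_zero_unique_isomorphic triD(2,3)[OF t(1)] by simp
  then show "z \<in> {x. is_zero C x}" using third_zero_if_iso_arrow[OF t(1)] by simp
qed (auto simp: is_zero_Susp_iff intro: is_zero_isomorphic)

lemma localizing_zero_objects: "localizing_subcategory C {x. is_zero C x}"
  unfolding localizing_subcategory_def
  using zero_objects_triangulated coproduct_is_zero by blast

lemma localizing_coproduct:
  assumes "localizing_subcategory C L" "small C I" "is_coproduct C I t c \<iota>" "\<And>i. i \<in> I \<Longrightarrow> t i \<in> L"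
  shows "c \<in> L"
  using assms unfolding localizing_subcategory_def by blast

lemma localizing_triangulated: "localizing_subcategory C L \<Longrightarrow> triangulated_subcategory C L"
  by (simp add: localizing_subcategory_def)

lemma triangulated_subcategory_Inter:
  assumes "\<And>S. S \<in> F \<Longrightarrow> triangulated_subcategory C S"
  shows "triangulated_subcategory C (\<Inter>F)"
proof (rule triangulated_subcategoryI)
  show "x \<in> \<Inter>F" if "is_zero C x" for x using tsub_zero[OF assms that] by blast
  show "y \<in> \<Inter>F" if "x \<in> \<Inter>F" "isomorphic C x y" for x y
    using tsub_isomorphic[OF assms _ that(2)] that(1) by blast
  show "Susp C x \<in> \<Inter>F \<longleftrightarrow> x \<in> \<Inter>F" for x using tsub_Susp[OF assms] by blast
  show "z \<in> \<Inter>F" if "tri x y z f g h" "x \<in> \<Inter>F" "y \<in> \<Inter>F" for x y z f g h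
    using tsub_third[OF assms that(1)] that(2,3) by blast
qed

lemma localizing_Inter:
  assumes "\<And>S. S \<in> F \<Longrightarrow> localizing_subcategory C S"
  shows "localizing_subcategory C (\<Inter>F)"
  unfolding localizing_subcategory_def
proof (intro conjI allI impI)
  show "triangulated_subcategory C (\<Inter>F)"
    by (rule triangulated_subcategory_Inter) (rule localizing_triangulated, rule assms)
  show "c \<in> \<Inter>F" if "small C I \<and> is_coproduct C I t c \<iota> \<and> (\<forall>i\<in>I. t i \<in> \<Inter>F)" for I t c \<iota>
    using localizing_coproduct[OF assms, of _ I t c \<iota>] that by blast
qed

lemma localizing_Loc: "localizing_subcategory C (Loc C E)"
  unfolding Loc_def by (rule localizing_Inter) blast

lemma Loc_superset: "E \<subseteq> Loc C E"
  unfolding Loc_def by blast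

lemma Loc_minimal: "localizing_subcategory C L \<Longrightarrow> E \<subseteq> L \<Longrightarrow> Loc C E \<subseteq> L"
  unfolding Loc_def by blast

text \<open>Completing the coproduct of the first maps to a triangle, the induced map from the coproduct of
  the third objects is invertible by the five lemma for \<open>Hom(-, z)\<close>: \<open>inj\<close> and \<open>surj\<close> below.\<close>

lemma coproduct_tri:
  assumes A: "is_coproduct C I a A \<alpha>" and B: "is_coproduct C I b B \<beta>" and Z: "is_coproduct C I c Z \<zeta>"
    and t: "\<And>i. i \<in> I \<Longrightarrow> tri (a i) (b i) (c i) (f i) (g i) (h i)"
  obtains F G H where "tri A B Z F G H"
proof -
  note ia = coproduct_inj[OF A] and ib = coproduct_inj[OF B] and ic = coproduct_inj[OF Z]
  note d = triD[OF t]
  have "\<And>i. i \<in> I \<Longrightarrow> Dom C (\<beta> i \<cdot> f i) = a i \<and> Cod C (\<beta> i \<cdot> f i) = B" using d ib by simp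
  from coproduct_map[OF A this] obtain F where
    F: "Dom C F = A" "Cod C F = B" "\<And>i. i \<in> I \<Longrightarrow> F \<cdot> \<alpha> i = \<beta> i \<cdot> f i" by blast
  have "\<And>i. i \<in> I \<Longrightarrow> Dom C (\<zeta> i \<cdot> g i) = b i \<and> Cod C (\<zeta> i \<cdot> g i) = Z" using d ic by simp
  from coproduct_map[OF B this] obtain G where
    G: "Dom C G = B" "Cod C G = Z" "\<And>i. i \<in> I \<Longrightarrow> G \<cdot> \<beta> i = \<zeta> i \<cdot> g i" by blast
  have "\<And>i. i \<in> I \<Longrightarrow> Dom C (SuspMap C (\<alpha> i) \<cdot> h i) = c i \<and> Cod C (SuspMap C (\<alpha> i) \<cdot> h i) = Susp C A"
    using d ia by simp
  from coproduct_map[OF Z this] obtain H where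
    H: "Dom C H = Z" "Cod C H = Susp C A" "\<And>i. i \<in> I \<Longrightarrow> H \<cdot> \<zeta> i = SuspMap C (\<alpha> i) \<cdot> h i" by blast
  obtain W G' H' where t0: "tri A B W F G' H'" using tri_exists[OF F(1,2)] by blast
  note d0 = triD[OF t0]
  have "\<forall>i\<in>I. \<exists>m. Dom C m = c i \<and> Cod C m = W \<and> m \<cdot> g i = G' \<cdot> \<beta> i \<and> SuspMap C (\<alpha> i) \<cdot> h i = H' \<cdot> m"
  proof
    fix i assume i: "i \<in> I"
    show "\<exists>m. Dom C m = c i \<and> Cod C m = W \<and> m \<cdot> g i = G' \<cdot> \<beta> i \<and> SuspMap C (\<alpha> i) \<cdot> h i = H' \<cdot> m"
      by (rule tri_fill[OF t[OF i] t0, where a = "\<alpha> i" and b = "\<beta> i"])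
         (use ia[OF i] ib[OF i] F(3)[OF i] in auto)
  qed
  from bchoice[OF this] obtain m' where m': "\<forall>i\<in>I. Dom C (m' i) = c i \<and> Cod C (m' i) = W \<and>
     m' i \<cdot> g i = G' \<cdot> \<beta> i \<and> SuspMap C (\<alpha> i) \<cdot> h i = H' \<cdot> m' i" by (elim exE)
  then have "\<And>i. i \<in> I \<Longrightarrow> Dom C (m' i) = c i \<and> Cod C (m' i) = W" by simp
  from coproduct_map[OF Z this] obtain m where
    m: "Dom C m = Z" "Cod C m = W" "\<And>i. i \<in> I \<Longrightarrow> m \<cdot> \<zeta> i = m' i" by blast
  have mG: "m \<cdot> G = G'"
  proof (rule coproduct_eqI[OF B])
    fix i assume i: "i \<in> I"
    have "(m \<cdot> G) \<cdot> \<beta> i = (m \<cdot> \<zeta> i) \<cdot> g i"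
      using G m(1,2) ib[OF i] ic[OF i] d[OF i] i by simp
    then show "(m \<cdot> G) \<cdot> \<beta> i = G' \<cdot> \<beta> i" using m(3)[OF i] m' i by simp
  qed (use m G d0 in simp_all)
  have Hm: "H' \<cdot> m = H"
  proof (rule coproduct_eqI[OF Z])
    fix i assume i: "i \<in> I"
    have "(H' \<cdot> m) \<cdot> \<zeta> i = H' \<cdot> m' i" using m ic[OF i] d0 i by simp
    then show "(H' \<cdot> m) \<cdot> \<zeta> i = H \<cdot> \<zeta> i" using m' H i by simp
  qed (use m H d0 in simp_all)
  note SA = Susp_coproduct[OF A] and SB = Susp_coproduct[OF B]
  have inj: "k = Zero C W (Cod C k)" if k: "Dom C k = W" "k \<cdot> m = Zero C Z (Cod C k)" for k
  proof -
    let ?z = "Cod C k"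
    have "k \<cdot> G' = (k \<cdot> m) \<cdot> G" using mG k(1) m G by simp
    then have "k \<cdot> G' = Zero C B ?z" using k m G by simp
    then obtain k' where k': "Dom C k' = Susp C A" "Cod C k' = ?z" "k' \<cdot> H' = k"
      using tri_weak_cokernel[OF tri_rotate[OF t0], of k] k by blast
    \<comment> \<open>On each summand \<open>k'\<close> kills \<open>h i\<close>, hence factors
      through the suspension of \<open>f i\<close> up to sign. Assembled over \<open>I\<close>, this
      factors \<open>k'\<close> through \<open>SuspMap C F\<close>, whose composite with
      \<open>H'\<close> is zero.\<close>
    have "\<forall>i\<in>I. \<exists>l. Dom C l = Susp C (b i) \<and> Cod C l = ?z \<and>
        l \<cdot> Neg C (SuspMap C (f i)) = k' \<cdot> SuspMap C (\<alpha> i)"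
    proof
      fix i assume i: "i \<in> I"
      let ?k = "k' \<cdot> SuspMap C (\<alpha> i)"
      have "?k \<cdot> h i = k' \<cdot> (H' \<cdot> m' i)" using k' ia[OF i] d[OF i] m' i by simp
      also have "\<dots> = k \<cdot> m' i" using k' m' i d0 by (simp add: comp_reduce[OF k'(3)])
      also have "\<dots> = (k \<cdot> m) \<cdot> \<zeta> i" using m i ic[OF i] k(1) by simp
      also have "\<dots> = Zero C (c i) (Cod C ?k)" using k k' ia[OF i] ic[OF i] by simp
      finally have z: "?k \<cdot> h i = Zero C (c i) (Cod C ?k)" .
      have dk: "Dom C ?k = Susp C (a i)" using k' ia[OF i] by simp
      obtain l where "Dom C l = Susp C (b i)" "Cod C l = Cod C ?k" "l \<cdot> Neg C (SuspMap C (f i)) = ?k"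
        by (rule tri_weak_cokernel[OF tri_rotate[OF tri_rotate[OF t[OF i]]] dk z])
      then show "\<exists>l. Dom C l = Susp C (b i) \<and> Cod C l = ?z \<and>
        l \<cdot> Neg C (SuspMap C (f i)) = k' \<cdot> SuspMap C (\<alpha> i)" using k' ia[OF i] by auto
    qed
    from bchoice[OF this] obtain l' where l': "\<forall>i\<in>I. Dom C (l' i) = Susp C (b i) \<and> Cod C (l' i) = ?z \<and>
        l' i \<cdot> Neg C (SuspMap C (f i)) = k' \<cdot> SuspMap C (\<alpha> i)" by (elim exE)
    then have "\<And>i. i \<in> I \<Longrightarrow> Dom C (l' i) = Susp C (b i) \<and> Cod C (l' i) = ?z" by simp
    from coproduct_map[OF SB this] obtain l where
      l: "Dom C l = Susp C B" "Cod C l = ?z" "\<And>i. i \<in> I \<Longrightarrow> l \<cdot> SuspMap C (\<beta> i) = l' i" by blast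
    have k'eq: "k' = l \<cdot> Neg C (SuspMap C F)"
    proof (rule coproduct_eqI[OF SA])
      fix i assume i: "i \<in> I"
      have "SuspMap C F \<cdot> SuspMap C (\<alpha> i) = SuspMap C (\<beta> i) \<cdot> SuspMap C (f i)"
        using F(3)[OF i] F ia[OF i] ib[OF i] d[OF i] by (simp flip: SuspMap_Comp')
      then have "(l \<cdot> Neg C (SuspMap C F)) \<cdot> SuspMap C (\<alpha> i) = Neg C ((l \<cdot> SuspMap C (\<beta> i)) \<cdot> SuspMap C (f i))"
        using l(1,2) F ia[OF i] ib[OF i] d[OF i] by (simp add: Comp_Neg Neg_Comp)
      also have "\<dots> = l' i \<cdot> Neg C (SuspMap C (f i))"
        using l(3)[OF i] l' i d[OF i] by (simp add: Comp_Neg)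
      finally show "k' \<cdot> SuspMap C (\<alpha> i) = (l \<cdot> Neg C (SuspMap C F)) \<cdot> SuspMap C (\<alpha> i)"
        using l' i by simp
    qed (use k' l F in simp_all)
    have "k = (l \<cdot> Neg C (SuspMap C F)) \<cdot> H'" using k'(3) k'eq by simp
    also have "\<dots> = Zero C W ?z"
      using l F d0 tri_comp_Zero''[OF t0] by (simp add: Neg_Comp)
    finally show ?thesis .
  qed
  have surj: "\<exists>k'. Dom C k' = W \<and> Cod C k' = Cod C k \<and> k' \<cdot> m = k" if k: "Dom C k = Z" for k
  proof -
    let ?z = "Cod C k"
    have "(k \<cdot> G) \<cdot> F = Zero C A ?z"
    proof (rule coproduct_eqI[OF A])
      fix i assume i: "i \<in> I"
      have "((k \<cdot> G) \<cdot> F) \<cdot> \<alpha> i = k \<cdot> ((G \<cdot> \<beta> i) \<cdot> f i)"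
        using k G(1,2) F ia[OF i] ib[OF i] d[OF i] i by simp
      also have "\<dots> = Zero C (a i) ?z"
        using G(3)[OF i] tri_comp_Zero[OF t[OF i]] k ic[OF i] d[OF i] by simp
      finally show "((k \<cdot> G) \<cdot> F) \<cdot> \<alpha> i = Zero C A ?z \<cdot> \<alpha> i" using ia[OF i] by simp
    qed (use k G F in simp_all)
    then obtain k' where k': "Dom C k' = W" "Cod C k' = ?z" "k' \<cdot> G' = k \<cdot> G"
      using tri_weak_cokernel[OF t0, of "k \<cdot> G"] k G by auto
    \<comment> \<open>\<open>k' \<cdot> m\<close> agrees with \<open>k\<close> only after
      composition with \<open>G\<close>. The error kills \<open>G\<close>, so on every summand it
      factors through \<open>h i\<close>; the resulting \<open>l\<close> corrects \<open>k'\<close>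
      by \<open>l \<cdot> H'\<close>.\<close>
    let ?d = "k \<^bold>+ Neg C (k' \<cdot> m)"
    have dd: "Dom C ?d = Z" "Cod C ?d = ?z" using k k' m by simp_all
    have "\<forall>i\<in>I. \<exists>l. Dom C l = Susp C (a i) \<and> Cod C l = ?z \<and> l \<cdot> h i = ?d \<cdot> \<zeta> i"
    proof
      fix i assume i: "i \<in> I"
      have "?d \<cdot> G = k \<cdot> G \<^bold>+ Neg C (k' \<cdot> (m \<cdot> G))"
        using k k' m G by (simp add: Add_Comp' Neg_Comp)
      also have "\<dots> = Zero C B ?z" using mG k'(3) k G by (simp add: Add_Neg)
      finally have dG: "?d \<cdot> G = Zero C B ?z" .
      have "(?d \<cdot> \<zeta> i) \<cdot> g i = ?d \<cdot> (G \<cdot> \<beta> i)"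
        using dd ic[OF i] d[OF i] G(3)[OF i] by simp
      also have "\<dots> = (?d \<cdot> G) \<cdot> \<beta> i" using dd G(1,2) ib[OF i] by simp
      also have "\<dots> = Zero C (b i) (Cod C (?d \<cdot> \<zeta> i))" using dG dd ib[OF i] ic[OF i] by simp
      finally have z: "(?d \<cdot> \<zeta> i) \<cdot> g i = Zero C (b i) (Cod C (?d \<cdot> \<zeta> i))" .
      have dz: "Dom C (?d \<cdot> \<zeta> i) = c i" using dd ic[OF i] by simp
      obtain l where "Dom C l = Susp C (a i)" "Cod C l = Cod C (?d \<cdot> \<zeta> i)" "l \<cdot> h i = ?d \<cdot> \<zeta> i"
        by (rule tri_weak_cokernel[OF tri_rotate[OF t[OF i]] dz z])
      then show "\<exists>l. Dom C l = Susp C (a i) \<and> Cod C l = ?z \<and> l \<cdot> h i = ?d \<cdot> \<zeta> i"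
        using dd ic[OF i] by auto
    qed
    from bchoice[OF this] obtain l' where
      l': "\<forall>i\<in>I. Dom C (l' i) = Susp C (a i) \<and> Cod C (l' i) = ?z \<and> l' i \<cdot> h i = ?d \<cdot> \<zeta> i" by (elim exE)
    then have "\<And>i. i \<in> I \<Longrightarrow> Dom C (l' i) = Susp C (a i) \<and> Cod C (l' i) = ?z" by simp
    from coproduct_map[OF SA this] obtain l where
      l: "Dom C l = Susp C A" "Cod C l = ?z" "\<And>i. i \<in> I \<Longrightarrow> l \<cdot> SuspMap C (\<alpha> i) = l' i" by blast
    have dlH: "?d = l \<cdot> H"
    proof (rule coproduct_eqI[OF Z])
      fix i assume i: "i \<in> I"
      have "(l \<cdot> H) \<cdot> \<zeta> i = (l \<cdot> SuspMap C (\<alpha> i)) \<cdot> h i"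
        using l(1,2) H ic[OF i] ia[OF i] d[OF i] i by simp
      then show "?d \<cdot> \<zeta> i = (l \<cdot> H) \<cdot> \<zeta> i" using l(3)[OF i] l' i by simp
    qed (use dd l H in simp_all)
    have "(k' \<^bold>+ l \<cdot> H') \<cdot> m = k' \<cdot> m \<^bold>+ l \<cdot> (H' \<cdot> m)"
      using k' l d0 m by (simp add: Add_Comp')
    also have "\<dots> = k' \<cdot> m \<^bold>+ ?d" using Hm dlH by simp
    also have "\<dots> = k" by (rule retract_compl_sum) (use k k' m in simp_all)
    finally show ?thesis using k' l d0 by (intro exI[of _ "k' \<^bold>+ l \<cdot> H'"]) simp
  qed
  obtain n where n: "Dom C n = W" "Cod C n = Z" "n \<cdot> m = Ide C Z"
    using surj[of "Ide C Z"] by auto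
  let ?e = "m \<cdot> n \<^bold>+ Neg C (Ide C W)"
  have "?e \<cdot> m = Zero C Z (Cod C ?e)"
    using m n by (simp add: Add_Comp' Neg_Comp Add_Neg)
  from inj[OF _ this] have "?e = Zero C W W" using m n by simp
  then have mn: "m \<cdot> n = Ide C W" by (rule diff_eq_Zero[rotated 2]) (use m n in simp_all)
  have iso: "iso_arrow C W Z n" by (rule iso_arrowI[OF n(1,2) m(1,2) mn n(3)])
  have nG: "n \<cdot> G' = G" using n m G mG comp_reduce[OF n(3), of G] by simp
  have Hn: "H \<cdot> n = H'" using Hm[symmetric] mn d0 m n by simp
  have "tri A B Z F G H"
    by (rule tri_iso[OF t0 iso_Ide iso_Ide iso]) (use nG Hn F G H d0 in simp_all)
  then show ?thesis by (rule that)
qed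

lemma coproduct_change:
  assumes cp: "is_coproduct C I t c \<iota>"
    and \<psi>: "\<And>i. i \<in> I \<Longrightarrow> Dom C (\<psi> i) = t' i \<and> Cod C (\<psi> i) = t i \<and> Dom C (\<phi> i) = t i \<and> Cod C (\<phi> i) = t' i \<and>
       \<phi> i \<cdot> \<psi> i = Ide C (t' i) \<and> \<psi> i \<cdot> \<phi> i = Ide C (t i)"
  shows "is_coproduct C I t' c (\<lambda>i. \<iota> i \<cdot> \<psi> i)"
proof (rule coproductI)
  fix i assume i: "i \<in> I"
  show "Dom C (\<iota> i \<cdot> \<psi> i) = t' i \<and> Cod C (\<iota> i \<cdot> \<psi> i) = c" using coproduct_inj[OF cp i] \<psi>[OF i] by simp
next
  fix z g assume g: "\<And>i. i \<in> I \<Longrightarrow> Dom C (g i) = t' i \<and> Cod C (g i) = z"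
  have "\<And>i. i \<in> I \<Longrightarrow> Dom C (g i \<cdot> \<phi> i) = t i \<and> Cod C (g i \<cdot> \<phi> i) = z" using g \<psi> by simp
  from coproduct_map[OF cp this] obtain h where
    h: "Dom C h = c" "Cod C h = z" "\<And>i. i \<in> I \<Longrightarrow> h \<cdot> \<iota> i = g i \<cdot> \<phi> i" by blast
  have "h \<cdot> (\<iota> i \<cdot> \<psi> i) = g i" if i: "i \<in> I" for i
    using comp_reduce[OF h(3)[OF i], of "\<psi> i"] h(1,2) coproduct_inj[OF cp i] \<psi>[OF i] g[OF i] by simp
  then show "\<exists>h. Dom C h = c \<and> Cod C h = z \<and> (\<forall>i\<in>I. h \<cdot> (\<iota> i \<cdot> \<psi> i) = g i)" using h(1,2) by blast
next
  fix h h' assume h: "Dom C h = c" "Dom C h' = c" "Cod C h = Cod C h'"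
    "\<And>i. i \<in> I \<Longrightarrow> h \<cdot> (\<iota> i \<cdot> \<psi> i) = h' \<cdot> (\<iota> i \<cdot> \<psi> i)"
  show "h = h'"
  proof (rule coproduct_eqI[OF cp h(1-3)])
    fix i assume i: "i \<in> I"
    note d = coproduct_inj[OF cp i] \<psi>[OF i]
    have "(h \<cdot> (\<iota> i \<cdot> \<psi> i)) \<cdot> \<phi> i = (h' \<cdot> (\<iota> i \<cdot> \<psi> i)) \<cdot> \<phi> i" using h(4)[OF i] by simp
    then show "h \<cdot> \<iota> i = h' \<cdot> \<iota> i" using d h(1-3) by simp
  qed
qed

lemma desuspension:
  obtains w \<phi> \<psi> where "Dom C \<phi> = Susp C w" "Cod C \<phi> = z" "Dom C \<psi> = z" "Cod C \<psi> = Susp C w"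
    "\<psi> \<cdot> \<phi> = Ide C (Susp C w)" "\<phi> \<cdot> \<psi> = Ide C z"
proof -
  obtain w where "isomorphic C (Susp C w) z" using Susp_surj by blast
  then show ?thesis by (rule isomorphicE) (rule that)
qed

section \<open>Closure properties of compact objects\<close>

lemma trunc_Susp:
  assumes "is_coproduct C I t c \<iota>" "trunc I t c \<iota> F \<tau>"
  shows "trunc I (\<lambda>i. Susp C (t i)) (Susp C c) (\<lambda>i. SuspMap C (\<iota> i)) F (SuspMap C \<tau>)"
  using assms(2) coproduct_inj[OF assms(1)] by (auto simp: trunc_def simp flip: SuspMap_Comp')

text \<open>Every summand is isomorphic to a suspension of some \<open>w i\<close>, so the suspended
  coproduct of the \<open>w i\<close> serves as test coproduct; maps from \<open>Susp C x\<close>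
  into it desuspend.\<close>

lemma compact_Susp:
  assumes hc: "has_small_coproducts C" and x: "is_compact C x" shows "is_compact C (Susp C x)"
proof (rule compactI)
  fix I t c \<iota> assume I: "small C (I :: 'u set)" and "is_coproduct C I t c \<iota>"
  have "\<forall>i\<in>I. \<exists>w \<phi> \<psi>. Dom C \<phi> = Susp C w \<and> Cod C \<phi> = t i \<and> Dom C \<psi> = t i \<and> Cod C \<psi> = Susp C w \<and>
    \<psi> \<cdot> \<phi> = Ide C (Susp C w) \<and> \<phi> \<cdot> \<psi> = Ide C (t i)"
  proof
    fix i
    show "\<exists>w \<phi> \<psi>. Dom C \<phi> = Susp C w \<and> Cod C \<phi> = t i \<and> Dom C \<psi> = t i \<and> Cod C \<psi> = Susp C w \<and>
      \<psi> \<cdot> \<phi> = Ide C (Susp C w) \<and> \<phi> \<cdot> \<psi> = Ide C (t i)" by (rule desuspension[of "t i"]) blast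
  qed
  from bchoice[OF this] obtain w where w: "\<forall>i\<in>I. \<exists>\<phi> \<psi>. Dom C \<phi> = Susp C (w i) \<and> Cod C \<phi> = t i \<and>
    Dom C \<psi> = t i \<and> Cod C \<psi> = Susp C (w i) \<and>
    \<psi> \<cdot> \<phi> = Ide C (Susp C (w i)) \<and> \<phi> \<cdot> \<psi> = Ide C (t i)" by (elim exE)
  from bchoice[OF w] obtain \<phi> where \<phi>: "\<forall>i\<in>I. \<exists>\<psi>. Dom C (\<phi> i) = Susp C (w i) \<and> Cod C (\<phi> i) = t i \<and>
    Dom C \<psi> = t i \<and> Cod C \<psi> = Susp C (w i) \<and>
    \<psi> \<cdot> \<phi> i = Ide C (Susp C (w i)) \<and> \<phi> i \<cdot> \<psi> = Ide C (t i)" by (elim exE)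
  from bchoice[OF \<phi>] obtain \<psi> where \<psi>: "\<forall>i\<in>I. Dom C (\<phi> i) = Susp C (w i) \<and> Cod C (\<phi> i) = t i \<and>
    Dom C (\<psi> i) = t i \<and> Cod C (\<psi> i) = Susp C (w i) \<and>
    \<psi> i \<cdot> \<phi> i = Ide C (Susp C (w i)) \<and> \<phi> i \<cdot> \<psi> i = Ide C (t i)" by (elim exE)
  obtain c0 \<iota>0 where cp0: "is_coproduct C I w c0 \<iota>0"
    using hc I unfolding has_small_coproducts_def by blast
  have cp1: "is_coproduct C I t (Susp C c0) (\<lambda>i. SuspMap C (\<iota>0 i) \<cdot> \<psi> i)"
    by (rule coproduct_change[OF Susp_coproduct[OF cp0], where \<phi> = \<phi>]) (use \<psi> in simp)
  have "\<exists>F \<tau>. finite F \<and> F \<subseteq> I \<and> trunc I t (Susp C c0) (\<lambda>i. SuspMap C (\<iota>0 i) \<cdot> \<psi> i) F \<tau> \<and> \<tau> \<cdot> h = h"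
    if h: "Dom C h = Susp C x" "Cod C h = Susp C c0" for h
  proof -
    obtain h0 where h0: "Dom C h0 = x" "Cod C h0 = c0" "SuspMap C h0 = h" using SuspMap_full[OF h] .
    obtain F \<tau> where F: "finite F" "F \<subseteq> I" "trunc I w c0 \<iota>0 F \<tau>" "\<tau> \<cdot> h0 = h0"
      using compact_factors[OF x I cp0 h0(1,2)] .
    have \<tau>: "Dom C \<tau> = c0" "Cod C \<tau> = c0" using F(3) by (simp_all add: trunc_def)
    have "SuspMap C \<tau> \<cdot> (SuspMap C (\<iota>0 i) \<cdot> \<psi> i) =
        (if i \<in> F then SuspMap C (\<iota>0 i) \<cdot> \<psi> i else Zero C (t i) (Susp C c0))" if i: "i \<in> I" for i
    proof -
      have "SuspMap C \<tau> \<cdot> SuspMap C (\<iota>0 i) =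
         (if i \<in> F then SuspMap C (\<iota>0 i) else Zero C (Susp C (w i)) (Susp C c0))"
        using trunc_Susp[OF cp0 F(3)] i by (simp add: trunc_def)
      from comp_reduce[OF this, of "\<psi> i"] show ?thesis
        using \<psi> i \<tau> coproduct_inj[OF cp0 i] by simp
    qed
    then have "trunc I t (Susp C c0) (\<lambda>i. SuspMap C (\<iota>0 i) \<cdot> \<psi> i) F (SuspMap C \<tau>)"
      using \<tau> by (simp add: trunc_def)
    moreover have "SuspMap C \<tau> \<cdot> h = h" using F(4) h0 \<tau> by (simp flip: h0(3) SuspMap_Comp')
    ultimately show ?thesis using F(1,2) by blast
  qed
  then show "\<exists>c \<iota>. is_coproduct C I t c \<iota> \<and> (\<forall>h. Dom C h = Susp C x \<longrightarrow> Cod C h = c \<longrightarrow>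
      (\<exists>F \<tau>. finite F \<and> F \<subseteq> I \<and> trunc I t c \<iota> F \<tau> \<and> \<tau> \<cdot> h = h))"
    using cp1 by blast
qed

lemma compact_Susp_cancel: assumes x: "is_compact C (Susp C x)" shows "is_compact C x"
proof (rule compactI)
  fix I t c \<iota> assume I: "small C (I :: 'u set)" and cp: "is_coproduct C I t c \<iota>"
  have "\<exists>F \<tau>. finite F \<and> F \<subseteq> I \<and> trunc I t c \<iota> F \<tau> \<and> \<tau> \<cdot> h = h"
    if h: "Dom C h = x" "Cod C h = c" for h
  proof -
    have h': "Dom C (SuspMap C h) = Susp C x" "Cod C (SuspMap C h) = Susp C c" using h by simp_all
    obtain F \<tau>' where F: "finite F" "F \<subseteq> I"
      "trunc I (\<lambda>i. Susp C (t i)) (Susp C c) (\<lambda>i. SuspMap C (\<iota> i)) F \<tau>'" "\<tau>' \<cdot> SuspMap C h = SuspMap C h"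
      using compact_factors[OF x I Susp_coproduct[OF cp] h'] .
    obtain \<tau> where \<tau>: "trunc I t c \<iota> F \<tau>" by (rule trunc_exists[OF cp])
    have d: "Dom C \<tau> = c" "Cod C \<tau> = c" using \<tau> by (simp_all add: trunc_def)
    have "\<tau>' = SuspMap C \<tau>" by (rule trunc_unique[OF Susp_coproduct[OF cp] F(3) trunc_Susp[OF cp \<tau>]])
    then have "SuspMap C (\<tau> \<cdot> h) = SuspMap C h" using F(4) h d by (simp add: SuspMap_Comp')
    then have "\<tau> \<cdot> h = h" by (rule SuspMap_inject) (use h d in simp_all)
    then show ?thesis using F(1,2) \<tau> by blast
  qed
  then show "\<exists>c \<iota>. is_coproduct C I t c \<iota> \<and> (\<forall>h. Dom C h = x \<longrightarrow> Cod C h = c \<longrightarrow>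
      (\<exists>F \<tau>. finite F \<and> F \<subseteq> I \<and> trunc I t c \<iota> F \<tau> \<and> \<tau> \<cdot> h = h))"
    using cp by blast
qed

text \<open>The composite \<open>k \<cdot> g\<close> is fixed by a truncation \<open>\<tau>\<close>.
  The error of \<open>\<tau> \<cdot> k\<close> kills \<open>g\<close>, so it factors through the
  compact \<open>Susp C x\<close> and is fixed by a second truncation. Truncating to the union of
  both index sets fixes \<open>k\<close>.\<close>

lemma compact_cone:
  assumes hc: "has_small_coproducts C" and t: "tri x y z f g h"
    and x: "is_compact C x" and y: "is_compact C y"
  shows "is_compact C z"
proof (rule compactI)
  fix I t' c \<iota> assume I: "small C (I :: 'u set)" and cp: "is_coproduct C I t' c \<iota>"
  note D = triD[OF t]
  have "\<exists>F \<tau>. finite F \<and> F \<subseteq> I \<and> trunc I t' c \<iota> F \<tau> \<and> \<tau> \<cdot> k = k"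
    if k: "Dom C k = z" "Cod C k = c" for k
  proof -
    have kg: "Dom C (k \<cdot> g) = y" "Cod C (k \<cdot> g) = c" using k D by simp_all
    obtain F \<tau> where F: "finite F" "F \<subseteq> I" "trunc I t' c \<iota> F \<tau>" "\<tau> \<cdot> (k \<cdot> g) = k \<cdot> g"
      using compact_factors[OF y I cp kg] .
    have \<tau>: "Dom C \<tau> = c" "Cod C \<tau> = c" using F(3) by (simp_all add: trunc_def)
    let ?d = "k \<^bold>+ Neg C (\<tau> \<cdot> k)"
    have d: "Dom C ?d = z" "Cod C ?d = c" using k \<tau> by simp_all
    have "?d \<cdot> g = Zero C y (Cod C ?d)"
      using k \<tau> D F(4) by (simp add: Add_Comp' Neg_Comp Add_Neg)
    from tri_weak_cokernel[OF tri_rotate[OF t] d(1) this] obtain k' where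
      k': "Dom C k' = Susp C x" "Cod C k' = Cod C ?d" "k' \<cdot> h = ?d" .
    have k'c: "Cod C k' = c" using k'(2) d(2) by simp
    obtain F' \<tau>' where F': "finite F'" "F' \<subseteq> I" "trunc I t' c \<iota> F' \<tau>'" "\<tau>' \<cdot> k' = k'"
      using compact_factors[OF compact_Susp[OF hc x] I cp k'(1) k'c] .
    have \<tau>': "Dom C \<tau>' = c" "Cod C \<tau>' = c" using F'(3) by (simp_all add: trunc_def)
    obtain \<tau>2 where \<tau>2: "trunc I t' c \<iota> (F \<union> F') \<tau>2" by (rule trunc_exists[OF cp])
    have d2: "Dom C \<tau>2 = c" "Cod C \<tau>2 = c" using \<tau>2 by (simp_all add: trunc_def)
    have e1: "\<tau>2 \<cdot> \<tau> = \<tau>" by (rule trunc_trunc[OF cp F(3) \<tau>2]) simp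
    have e2: "\<tau>2 \<cdot> \<tau>' = \<tau>'" by (rule trunc_trunc[OF cp F'(3) \<tau>2]) simp
    have "\<tau>2 \<cdot> k' = \<tau>2 \<cdot> (\<tau>' \<cdot> k')" using F'(4) by simp
    also have "\<dots> = k'" using comp_reduce[OF e2, of k'] F'(4) \<tau>' d2 k'c by simp
    finally have "\<tau>2 \<cdot> k' = k'" .
    then have "\<tau>2 \<cdot> ?d = ?d"
      using comp_reduce[of \<tau>2 k' k' h] d2 k'(1) k'c D unfolding k'(3) by simp
    moreover have "\<tau>2 \<cdot> ?d = \<tau>2 \<cdot> k \<^bold>+ Neg C (\<tau> \<cdot> k)"
      using d2 \<tau> k by (simp add: Comp_Add' Comp_Neg comp_reduce[OF e1])
    ultimately have eq: "\<tau>2 \<cdot> k \<^bold>+ Neg C (\<tau> \<cdot> k) = ?d" by simp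
    have "\<tau> \<cdot> k \<^bold>+ (\<tau>2 \<cdot> k \<^bold>+ Neg C (\<tau> \<cdot> k)) = \<tau>2 \<cdot> k"
      by (rule retract_compl_sum) (use k \<tau> d2 in simp_all)
    moreover have "\<tau> \<cdot> k \<^bold>+ ?d = k" by (rule retract_compl_sum) (use k \<tau> in simp_all)
    ultimately have "\<tau>2 \<cdot> k = k" using eq by simp
    then show ?thesis using F(1,2) F'(1,2) \<tau>2 by (intro exI[of _ "F \<union> F'"] exI[of _ \<tau>2]) simp
  qed
  then show "\<exists>c \<iota>. is_coproduct C I t' c \<iota> \<and> (\<forall>h. Dom C h = z \<longrightarrow> Cod C h = c \<longrightarrow>
      (\<exists>F \<tau>. finite F \<and> F \<subseteq> I \<and> trunc I t' c \<iota> F \<tau> \<and> \<tau> \<cdot> h = h))"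
    using cp by blast
qed

lemma compacts_triangulated:
  assumes "has_small_coproducts C" shows "triangulated_subcategory C (compacts C)"
  unfolding compacts_def
  by (rule triangulated_subcategoryI)
     (use assms compact_zero compact_isomorphic compact_Susp compact_Susp_cancel compact_cone in blast)+

end

section \<open>Tensor products and rigid objects\<close>

context tt_category
begin

lemma TensorMap_Hom [simp]:
  "Dom T (f \<boxtimes>\<^sub>m g) = Dom T f \<boxtimes> Dom T g" "Cod T (f \<boxtimes>\<^sub>m g) = Cod T f \<boxtimes> Cod T g"
  using TensorMap_in_Hom[of f "Dom T f" "Cod T f" g "Dom T g" "Cod T g"] by simp_all

lemma TensorMap_Comp':
  "Cod T f = Dom T f' \<Longrightarrow> Cod T g = Dom T g' \<Longrightarrow> (f' \<boxtimes>\<^sub>m g') \<cdot> (f \<boxtimes>\<^sub>m g) = (f' \<cdot> f) \<boxtimes>\<^sub>m (g' \<cdot> g)"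
  using TensorMap_Comp[of f "Dom T f" "Dom T f'" f' "Cod T f'" g "Dom T g" "Dom T g'" g' "Cod T g'"]
  by simp

lemma TensorMap_Ide' [simp]: "Ide T x \<boxtimes>\<^sub>m Ide T y = Ide T (x \<boxtimes> y)"
  by (rule TensorMap_Ide)

lemma Assoc_Hom [simp]: "Dom T (Assoc T x y z) = (x \<boxtimes> y) \<boxtimes> z" "Cod T (Assoc T x y z) = x \<boxtimes> y \<boxtimes> z"
  using Assoc_iso[of x y z] by (auto simp: iso_arrow_def inverse_arrows_def)

lemma LUnit_Hom [simp]: "Dom T (LUnit T x) = Unit T \<boxtimes> x" "Cod T (LUnit T x) = x"
  using LUnit_iso[of x] by (auto simp: iso_arrow_def inverse_arrows_def)

lemma RUnit_Hom [simp]: "Dom T (RUnit T x) = x \<boxtimes> Unit T" "Cod T (RUnit T x) = x"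
  using RUnit_iso[of x] by (auto simp: iso_arrow_def inverse_arrows_def)

lemma TSusp_Hom [simp]: "Dom T (TSusp T x y) = Susp T x \<boxtimes> y" "Cod T (TSusp T x y) = Susp T (x \<boxtimes> y)"
  using TSusp_iso[of x y] by (auto simp: iso_arrow_def inverse_arrows_def)

lemma Ev_Hom [simp]: "Dom T (Ev T y z) = IHom T y z \<boxtimes> y" "Cod T (Ev T y z) = z"
  using Ev_in_Hom[of y z] by simp_all

lemma iso_TensorMap:
  assumes "iso_arrow T x x' f" "iso_arrow T y y' g"
  shows "iso_arrow T (x \<boxtimes> y) (x' \<boxtimes> y') (f \<boxtimes>\<^sub>m g)"
proof -
  obtain f' where f: "Dom T f = x" "Cod T f = x'" "Dom T f' = x'" "Cod T f' = x"
    "f' \<cdot> f = Ide T x" "f \<cdot> f' = Ide T x'" using assms(1) by (rule iso_arrowE)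
  obtain g' where g: "Dom T g = y" "Cod T g = y'" "Dom T g' = y'" "Cod T g' = y"
    "g' \<cdot> g = Ide T y" "g \<cdot> g' = Ide T y'" using assms(2) by (rule iso_arrowE)
  show ?thesis
    by (rule iso_arrowI[where g = "f' \<boxtimes>\<^sub>m g'"]) (use f g in \<open>simp_all add: TensorMap_Comp'\<close>)
qed

lemma isomorphic_tensor:
  "isomorphic T x x' \<Longrightarrow> isomorphic T y y' \<Longrightarrow> isomorphic T (x \<boxtimes> y) (x' \<boxtimes> y')"
  unfolding isomorphic_def using iso_TensorMap by blast

lemma isomorphic_Assoc: "isomorphic T ((x \<boxtimes> y) \<boxtimes> z) (x \<boxtimes> y \<boxtimes> z)"
  unfolding isomorphic_def using Assoc_iso by blast

lemma isomorphic_LUnit: "isomorphic T (Unit T \<boxtimes> x) x"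
  unfolding isomorphic_def using LUnit_iso by blast

lemma isomorphic_TSusp: "isomorphic T (Susp T x \<boxtimes> y) (Susp T (x \<boxtimes> y))"
  unfolding isomorphic_def using TSusp_iso by blast

lemma isomorphic_Braid: "isomorphic T (x \<boxtimes> y) (y \<boxtimes> x)"
  unfolding isomorphic_def
  by (rule exI[of _ "Braid T x y"], rule iso_arrowI[where g = "Braid T y x"])
     (use Braid_in_Hom Braid_symmetric in simp_all)

lemma tensor_tri:
  "tri x y z f g h \<Longrightarrow>
    tri (x \<boxtimes> w) (y \<boxtimes> w) (z \<boxtimes> w) (f \<boxtimes>\<^sub>m Ide T w) (g \<boxtimes>\<^sub>m Ide T w) (TSusp T x w \<cdot> (h \<boxtimes>\<^sub>m Ide T w))"
  using tensor_exact[of f g h x y w] by (simp add: tri_def)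

text \<open>Tensoring with \<open>w\<close> is left adjoint to \<open>IHom T w\<close>; maps are
  constructed and compared after currying.\<close>

lemma tensor_coproduct:
  assumes cp: "is_coproduct T I t c \<iota>"
  shows "is_coproduct T I (\<lambda>i. t i \<boxtimes> w) (c \<boxtimes> w) (\<lambda>i. \<iota> i \<boxtimes>\<^sub>m Ide T w)"
proof (rule coproductI)
  fix i assume "i \<in> I"
  then show "Dom T (\<iota> i \<boxtimes>\<^sub>m Ide T w) = t i \<boxtimes> w \<and> Cod T (\<iota> i \<boxtimes>\<^sub>m Ide T w) = c \<boxtimes> w"
    using coproduct_inj[OF cp] by simp
next
  fix z g assume g: "\<And>i. i \<in> I \<Longrightarrow> Dom T (g i) = t i \<boxtimes> w \<and> Cod T (g i) = z"
  have "\<forall>i\<in>I. \<exists>k. Dom T k = t i \<and> Cod T k = IHom T w z \<and> Ev T w z \<cdot> (k \<boxtimes>\<^sub>m Ide T w) = g i"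
  proof
    fix i assume i: "i \<in> I"
    then have "g i \<in> Hom T (t i \<boxtimes> w) z" using g by simp
    from ex1_implies_ex[OF Ev_universal[OF this]]
    show "\<exists>k. Dom T k = t i \<and> Cod T k = IHom T w z \<and> Ev T w z \<cdot> (k \<boxtimes>\<^sub>m Ide T w) = g i" by simp
  qed
  from bchoice[OF this] obtain k where
    k: "\<forall>i\<in>I. Dom T (k i) = t i \<and> Cod T (k i) = IHom T w z \<and> Ev T w z \<cdot> (k i \<boxtimes>\<^sub>m Ide T w) = g i"
    by (elim exE)
  then have "\<And>i. i \<in> I \<Longrightarrow> Dom T (k i) = t i \<and> Cod T (k i) = IHom T w z" by simp
  from coproduct_map[OF cp this] obtain h where
    h: "Dom T h = c" "Cod T h = IHom T w z" "\<And>i. i \<in> I \<Longrightarrow> h \<cdot> \<iota> i = k i" by blast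
  have "(Ev T w z \<cdot> (h \<boxtimes>\<^sub>m Ide T w)) \<cdot> (\<iota> i \<boxtimes>\<^sub>m Ide T w) = g i" if i: "i \<in> I" for i
    using h(1,2) coproduct_inj[OF cp i] h(3)[OF i] k i by (simp add: TensorMap_Comp')
  then show "\<exists>h. Dom T h = c \<boxtimes> w \<and> Cod T h = z \<and> (\<forall>i\<in>I. h \<cdot> (\<iota> i \<boxtimes>\<^sub>m Ide T w) = g i)"
    using h(1,2) by (intro exI[of _ "Ev T w z \<cdot> (h \<boxtimes>\<^sub>m Ide T w)"]) simp
next
  fix h h' assume h: "Dom T h = c \<boxtimes> w" "Dom T h' = c \<boxtimes> w" "Cod T h = Cod T h'"
    "\<And>i. i \<in> I \<Longrightarrow> h \<cdot> (\<iota> i \<boxtimes>\<^sub>m Ide T w) = h' \<cdot> (\<iota> i \<boxtimes>\<^sub>m Ide T w)"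
  let ?z = "Cod T h'"
  have curry: "\<exists>k. Dom T k = c \<and> Cod T k = IHom T w ?z \<and> Ev T w ?z \<cdot> (k \<boxtimes>\<^sub>m Ide T w) = h0"
    if "Dom T h0 = c \<boxtimes> w" "Cod T h0 = ?z" for h0
  proof -
    have "h0 \<in> Hom T (c \<boxtimes> w) ?z" using that by simp
    from ex1_implies_ex[OF Ev_universal[OF this]] show ?thesis by simp
  qed
  obtain k where k: "Dom T k = c" "Cod T k = IHom T w ?z" "Ev T w ?z \<cdot> (k \<boxtimes>\<^sub>m Ide T w) = h"
    using curry[OF h(1,3)] by blast
  obtain k' where k': "Dom T k' = c" "Cod T k' = IHom T w ?z" "Ev T w ?z \<cdot> (k' \<boxtimes>\<^sub>m Ide T w) = h'"
    using curry[OF h(2)] by blast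
  have "k = k'"
  proof (rule coproduct_eqI[OF cp])
    fix i assume i: "i \<in> I"
    note d = coproduct_inj[OF cp i]
    have "h \<cdot> (\<iota> i \<boxtimes>\<^sub>m Ide T w) \<in> Hom T (t i \<boxtimes> w) ?z" using h(1,3) d by simp
    from Ev_universal[OF this] show "k \<cdot> \<iota> i = k' \<cdot> \<iota> i"
    proof (rule ex1_eq)
      have "Ev T w ?z \<cdot> ((k \<cdot> \<iota> i) \<boxtimes>\<^sub>m Ide T w) = (Ev T w ?z \<cdot> (k \<boxtimes>\<^sub>m Ide T w)) \<cdot> (\<iota> i \<boxtimes>\<^sub>m Ide T w)"
        using k(1,2) d by (simp add: TensorMap_Comp')
      then show "k \<cdot> \<iota> i \<in> Hom T (t i) (IHom T w ?z) \<and>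
          Ev T w ?z \<cdot> ((k \<cdot> \<iota> i) \<boxtimes>\<^sub>m Ide T w) = h \<cdot> (\<iota> i \<boxtimes>\<^sub>m Ide T w)"
        unfolding k(3) using k(1,2) d by simp
      have "Ev T w ?z \<cdot> ((k' \<cdot> \<iota> i) \<boxtimes>\<^sub>m Ide T w) = (Ev T w ?z \<cdot> (k' \<boxtimes>\<^sub>m Ide T w)) \<cdot> (\<iota> i \<boxtimes>\<^sub>m Ide T w)"
        using k'(1,2) d by (simp add: TensorMap_Comp')
      then show "k' \<cdot> \<iota> i \<in> Hom T (t i) (IHom T w ?z) \<and>
          Ev T w ?z \<cdot> ((k' \<cdot> \<iota> i) \<boxtimes>\<^sub>m Ide T w) = h \<cdot> (\<iota> i \<boxtimes>\<^sub>m Ide T w)"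
        unfolding k'(3) h(4)[OF i] using k'(1,2) d by simp
    qed
  qed (use k k' in simp_all)
  then show "h = h'" using k(3) k'(3) by simp
qed

text \<open>A zero object is an empty coproduct, and tensoring preserves coproducts.\<close>

lemma is_zero_tensor: assumes "is_zero T x" shows "is_zero T (x \<boxtimes> w)"
proof -
  have "is_coproduct T {} t x \<iota>" for t \<iota>
  proof (rule coproductI)
    show "\<exists>h. Dom T h = x \<and> Cod T h = z \<and> (\<forall>i\<in>{}. h \<cdot> \<iota> i = g i)" for z g
      by (rule exI[of _ "Zero T x z"]) simp
    show "h = h'" if "Dom T h = x" "Dom T h' = x" "Cod T h = Cod T h'" for h h'
      using is_zero_from[OF assms that(1)] is_zero_from[OF assms that(2)] that(3) by simp
  qed simp
  from coproduct_is_zero[OF tensor_coproduct[OF this]] show ?thesis by simp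
qed

lemma is_zero_tensor_commute: "is_zero T (x \<boxtimes> y) \<longleftrightarrow> is_zero T (y \<boxtimes> x)"
  using is_zero_isomorphic isomorphic_Braid by blast

text \<open>A zero map factors through a zero object, which stays zero after tensoring.\<close>

lemma Zero_tensor: "Zero T x y \<boxtimes>\<^sub>m Ide T w = Zero T (x \<boxtimes> w) (y \<boxtimes> w)"
proof -
  obtain z where z: "is_zero T z" using ex_zero by blast
  have "Zero T x y \<boxtimes>\<^sub>m Ide T w = (Zero T z y \<boxtimes>\<^sub>m Ide T w) \<cdot> (Zero T x z \<boxtimes>\<^sub>m Ide T w)"
    by (simp add: TensorMap_Comp')
  also have "Zero T x z \<boxtimes>\<^sub>m Ide T w = Zero T (x \<boxtimes> w) (z \<boxtimes> w)"
    using is_zero_to[OF is_zero_tensor[OF z], of "Zero T x z \<boxtimes>\<^sub>m Ide T w"] by simp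
  finally show ?thesis by simp
qed

text \<open>For \<open>\<otimes>\<close>-closed classes the suspension condition is automatic, because \<open>\<Sigma>x \<cong> x \<otimes> \<Sigma>1\<close>
  and \<open>\<Sigma>1\<close> is invertible.\<close>

lemma Susp_iff_if_tensor_closed:
  assumes iso: "\<And>x y. x \<in> S \<Longrightarrow> isomorphic T x y \<Longrightarrow> y \<in> S"
    and ten: "\<And>x y. x \<in> S \<Longrightarrow> x \<boxtimes> y \<in> S"
  shows "Susp T x \<in> S \<longleftrightarrow> x \<in> S"
proof
  assume x: "x \<in> S"
  have "isomorphic T (Susp T (Unit T) \<boxtimes> x) (Susp T x)"
    using isomorphic_trans[OF isomorphic_TSusp Susp_isomorphic[OF isomorphic_LUnit]] .
  then have "isomorphic T (x \<boxtimes> Susp T (Unit T)) (Susp T x)"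
    using isomorphic_trans[OF isomorphic_Braid] by blast
  then show "Susp T x \<in> S" using iso ten[OF x] by blast
next
  assume x: "Susp T x \<in> S"
  obtain w where w: "isomorphic T (Susp T w) (Unit T)" using Susp_surj by blast
  have "isomorphic T (Susp T x \<boxtimes> w) (Susp T (w \<boxtimes> x))"
    using isomorphic_trans[OF isomorphic_TSusp Susp_isomorphic[OF isomorphic_Braid]] .
  also have "isomorphic T \<dots> (Susp T w \<boxtimes> x)" by (rule isomorphic_sym[OF isomorphic_TSusp])
  also have "isomorphic T \<dots> (Unit T \<boxtimes> x)" by (rule isomorphic_tensor[OF w isomorphic_refl])
  also have "isomorphic T \<dots> x" by (rule isomorphic_LUnit)
  finally show "x \<in> S" using iso ten[OF x] by blast
qed

lemma localizing_idealI:
  assumes zero: "\<And>x. is_zero T x \<Longrightarrow> x \<in> S"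
    and iso: "\<And>x y. x \<in> S \<Longrightarrow> isomorphic T x y \<Longrightarrow> y \<in> S"
    and cone: "\<And>x y z f g h. tri x y z f g h \<Longrightarrow> x \<in> S \<Longrightarrow> y \<in> S \<Longrightarrow> z \<in> S"
    and cop: "\<And>(I :: 'u set) t c \<iota>. small T I \<Longrightarrow> is_coproduct T I t c \<iota> \<Longrightarrow> (\<And>i. i \<in> I \<Longrightarrow> t i \<in> S) \<Longrightarrow> c \<in> S"
    and ten: "\<And>x y. x \<in> S \<Longrightarrow> x \<boxtimes> y \<in> S"
  shows "localizing_ideal T S"
  unfolding localizing_ideal_def localizing_subcategory_def
proof (intro conjI)
  show "triangulated_subcategory T S"
  proof (rule triangulated_subcategoryI)
    show "Susp T x \<in> S \<longleftrightarrow> x \<in> S" for x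
      by (rule Susp_iff_if_tensor_closed) (fact iso, fact ten)
  qed (fact zero, fact iso, fact cone)
  show "\<forall>(I :: 'u set) t c \<iota>. small T I \<and> is_coproduct T I t c \<iota> \<and> (\<forall>i\<in>I. t i \<in> S) \<longrightarrow> c \<in> S"
    using cop by blast
  show "\<forall>x\<in>S. \<forall>y. x \<boxtimes> y \<in> S" using ten by blast
qed

section \<open>Localizing ideals\<close>

lemma ideal_localizing: "localizing_ideal T L \<Longrightarrow> localizing_subcategory T L"
  by (simp add: localizing_ideal_def)

lemma ideal_triangulated: "localizing_ideal T L \<Longrightarrow> triangulated_subcategory T L"
  by (rule localizing_triangulated[OF ideal_localizing])

lemma ideal_tensor: "localizing_ideal T L \<Longrightarrow> x \<in> L \<Longrightarrow> x \<boxtimes> y \<in> L"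
  by (simp add: localizing_ideal_def)

lemma ideal_isomorphic: "localizing_ideal T L \<Longrightarrow> x \<in> L \<Longrightarrow> isomorphic T x y \<Longrightarrow> y \<in> L"
  by (rule tsub_isomorphic[OF ideal_triangulated])

lemma ideal_tensor_left: "localizing_ideal T L \<Longrightarrow> x \<in> L \<Longrightarrow> y \<boxtimes> x \<in> L"
  using ideal_isomorphic[OF _ ideal_tensor isomorphic_Braid] by blast

lemma localizing_ideal_Inter:
  assumes "\<And>S. S \<in> F \<Longrightarrow> localizing_ideal T S" shows "localizing_ideal T (\<Inter>F)"
  unfolding localizing_ideal_def
proof (intro conjI ballI allI)
  show "localizing_subcategory T (\<Inter>F)"
    by (rule localizing_Inter) (rule ideal_localizing, rule assms)
  show "x \<boxtimes> y \<in> \<Inter>F" if "x \<in> \<Inter>F" for x y using ideal_tensor[OF assms] that by blast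
qed

lemma localizing_ideal_Loc_tensor: "localizing_ideal T (Loc_tensor T E)"
  unfolding Loc_tensor_def by (rule localizing_ideal_Inter) blast

lemma Loc_tensor_superset: "E \<subseteq> Loc_tensor T E"
  unfolding Loc_tensor_def by blast

lemma Loc_tensor_minimal: "localizing_ideal T L \<Longrightarrow> E \<subseteq> L \<Longrightarrow> Loc_tensor T E \<subseteq> L"
  unfolding Loc_tensor_def by blast

lemma localizing_zero_ideal: "localizing_ideal T {x. is_zero T x}"
  unfolding localizing_ideal_def using localizing_zero_objects is_zero_tensor by blast

text \<open>Tensoring with \<open>w\<close> is exact and preserves coproducts. Extending a property
  from generators in one tensor factor runs through this.\<close>

lemma localizing_tensor_preimage:
  assumes "localizing_subcategory T L" shows "localizing_subcategory T {x. x \<boxtimes> w \<in> L}"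
  unfolding localizing_subcategory_def
proof (intro conjI allI impI)
  note tr = localizing_triangulated[OF assms]
  show "triangulated_subcategory T {x. x \<boxtimes> w \<in> L}"
  proof (rule triangulated_subcategoryI)
    show "x \<in> {x. x \<boxtimes> w \<in> L}" if "is_zero T x" for x
      using tsub_zero[OF tr is_zero_tensor[OF that]] by simp
    show "y \<in> {x. x \<boxtimes> w \<in> L}" if "x \<in> {x. x \<boxtimes> w \<in> L}" "isomorphic T x y" for x y
      using tsub_isomorphic[OF tr _ isomorphic_tensor[OF that(2) isomorphic_refl]] that(1) by simp
    show "Susp T x \<in> {x. x \<boxtimes> w \<in> L} \<longleftrightarrow> x \<in> {x. x \<boxtimes> w \<in> L}" for x
      using tsub_isomorphic[OF tr _ isomorphic_TSusp, of x w] tsub_Susp[OF tr, of "x \<boxtimes> w"]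
        tsub_isomorphic[OF tr _ isomorphic_sym[OF isomorphic_TSusp], of x w] by blast
    show "z \<in> {x. x \<boxtimes> w \<in> L}" if "tri x y z f g h" "x \<in> {x. x \<boxtimes> w \<in> L}" "y \<in> {x. x \<boxtimes> w \<in> L}" for x y z f g h
      using tsub_third[OF tr tensor_tri[OF that(1)]] that(2,3) by blast
  qed
  show "c \<in> {x. x \<boxtimes> w \<in> L}"
    if "small T I \<and> is_coproduct T I t c \<iota> \<and> (\<forall>i\<in>I. t i \<in> {x. x \<boxtimes> w \<in> L})" for I t c \<iota>
    using localizing_coproduct[OF assms _ tensor_coproduct, of I t c \<iota> w] that by blast
qed

text \<open>The symmetry moves an extra tensor factor past \<open>t\<close>. Vanishing of a tensor
  product thus becomes membership in a localizing ideal, to which the classification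
  applies.\<close>

lemma annihilator_ideal: "localizing_ideal T {u. is_zero T (u \<boxtimes> t)}"
  unfolding localizing_ideal_def
proof (intro conjI ballI allI)
  show "localizing_subcategory T {u. is_zero T (u \<boxtimes> t)}"
    using localizing_tensor_preimage[OF localizing_zero_objects, of t] by simp
  fix x y assume x: "x \<in> {u. is_zero T (u \<boxtimes> t)}"
  have "isomorphic T ((x \<boxtimes> t) \<boxtimes> y) (x \<boxtimes> t \<boxtimes> y)" by (rule isomorphic_Assoc)
  also have "isomorphic T \<dots> (x \<boxtimes> y \<boxtimes> t)"
    by (rule isomorphic_tensor[OF isomorphic_refl isomorphic_Braid])
  also have "isomorphic T \<dots> ((x \<boxtimes> y) \<boxtimes> t)" by (rule isomorphic_sym[OF isomorphic_Assoc])
  finally have "isomorphic T ((x \<boxtimes> t) \<boxtimes> y) ((x \<boxtimes> y) \<boxtimes> t)" .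
  then show "x \<boxtimes> y \<in> {u. is_zero T (u \<boxtimes> t)}"
    using is_zero_isomorphic[OF is_zero_tensor] x by blast
qed

section \<open>Duality for rigid objects\<close>

definition rigid_ev :: "'o \<Rightarrow> 'o \<Rightarrow> 'm \<Rightarrow> 'o \<Rightarrow> 'm" where
  "rigid_ev e y \<epsilon> u = RUnit T u \<cdot> (Ide T u \<boxtimes>\<^sub>m \<epsilon>) \<cdot> Assoc T u y e"

lemma rigid_ev_Hom:
  assumes "Dom T \<epsilon> = y \<boxtimes> e" "Cod T \<epsilon> = Unit T"
  shows "Dom T (rigid_ev e y \<epsilon> u) = (u \<boxtimes> y) \<boxtimes> e" "Cod T (rigid_ev e y \<epsilon> u) = u"
  using assms by (simp_all add: rigid_ev_def)

text \<open>When \<open>y\<close> is dual to \<open>e\<close>, \<open>rigid_ev\<close> is the counit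
  of the adjunction between tensoring with \<open>e\<close> and with \<open>y\<close>; its
  naturality in \<open>u\<close> makes transposition work.\<close>

lemma rigid_ev_natural:
  assumes \<epsilon>: "Dom T \<epsilon> = y \<boxtimes> e" "Cod T \<epsilon> = Unit T" and m: "Dom T m = u" "Cod T m = u'"
  shows "m \<cdot> rigid_ev e y \<epsilon> u = rigid_ev e y \<epsilon> u' \<cdot> ((m \<boxtimes>\<^sub>m Ide T y) \<boxtimes>\<^sub>m Ide T e)"
proof -
  have R: "RUnit T u' \<cdot> (m \<boxtimes>\<^sub>m Ide T (Unit T)) = m \<cdot> RUnit T u"
    using RUnit_natural[of m u u'] m by simp
  have A: "Assoc T u' y e \<cdot> ((m \<boxtimes>\<^sub>m Ide T y) \<boxtimes>\<^sub>m Ide T e) = (m \<boxtimes>\<^sub>m Ide T (y \<boxtimes> e)) \<cdot> Assoc T u y e"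
    using Assoc_natural[of m u u' "Ide T y" y y "Ide T e" e e] m by simp
  have "m \<cdot> rigid_ev e y \<epsilon> u = (m \<cdot> RUnit T u) \<cdot> ((Ide T u \<boxtimes>\<^sub>m \<epsilon>) \<cdot> Assoc T u y e)"
    using m \<epsilon> by (simp add: rigid_ev_def)
  also have "\<dots> = RUnit T u' \<cdot> (((m \<boxtimes>\<^sub>m Ide T (Unit T)) \<cdot> (Ide T u \<boxtimes>\<^sub>m \<epsilon>)) \<cdot> Assoc T u y e)"
    unfolding R[symmetric] using m \<epsilon> by simp
  also have "(m \<boxtimes>\<^sub>m Ide T (Unit T)) \<cdot> (Ide T u \<boxtimes>\<^sub>m \<epsilon>) = (Ide T u' \<boxtimes>\<^sub>m \<epsilon>) \<cdot> (m \<boxtimes>\<^sub>m Ide T (y \<boxtimes> e))"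
    using m \<epsilon> by (simp add: TensorMap_Comp')
  finally show ?thesis using m \<epsilon> A by (simp add: rigid_ev_def)
qed

text \<open>Every map \<open>s \<otimes> e \<rightarrow> u\<close> is adjoint to a map \<open>s \<rightarrow> u \<otimes> y\<close>, up to an automorphism \<open>\<alpha>\<close> of
  \<open>s \<otimes> e\<close>; by coherence \<open>\<alpha>\<close> is the identity, but invertibility is all that is needed.\<close>

lemma rigid_transpose:
  assumes \<eta>: "Dom T \<eta> = Unit T" "Cod T \<eta> = e \<boxtimes> y" and \<epsilon>: "Dom T \<epsilon> = y \<boxtimes> e" "Cod T \<epsilon> = Unit T"
    and zig: "RUnit T e \<cdot> (Ide T e \<boxtimes>\<^sub>m \<epsilon>) \<cdot> Assoc T e y e \<cdot> (\<eta> \<boxtimes>\<^sub>m Ide T e) = LUnit T e"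
  obtains \<alpha> where "iso_arrow T (s \<boxtimes> e) (s \<boxtimes> e) \<alpha>"
    "\<And>u h. Dom T h = s \<boxtimes> e \<Longrightarrow> Cod T h = u \<Longrightarrow> \<exists>k. Dom T k = s \<and> Cod T k = u \<boxtimes> y \<and>
       h \<cdot> \<alpha> = rigid_ev e y \<epsilon> u \<cdot> (k \<boxtimes>\<^sub>m Ide T e)"
proof -
  let ?a = "inv_arrow T (Assoc T s e y)" and ?r = "inv_arrow T (RUnit T s)"
  note a = inv_arrow[OF Assoc_iso[of s e y]] and r = inv_arrow[OF RUnit_iso[of s]]
  \<comment> \<open>The unit of the adjunction at \<open>s\<close>: coevaluation followed by
    reassociation.\<close>
  define co where "co = ?a \<cdot> (Ide T s \<boxtimes>\<^sub>m \<eta>) \<cdot> ?r"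
  have co: "Dom T co = s" "Cod T co = (s \<boxtimes> e) \<boxtimes> y" using a r \<eta> by (simp_all add: co_def)
  define \<alpha> where "\<alpha> = rigid_ev e y \<epsilon> (s \<boxtimes> e) \<cdot> (co \<boxtimes>\<^sub>m Ide T e)"
  define A1 where "A1 = Assoc T (s \<boxtimes> e) y e"
  define A2 where "A2 = Assoc T s e (y \<boxtimes> e)"
  define A3 where "A3 = Assoc T s (e \<boxtimes> y) e"
  define A4 where "A4 = Assoc T s e (Unit T)"
  define A5 where "A5 = Assoc T s (Unit T) e"
  define A2i where "A2i = inv_arrow T A2"
  define A4i where "A4i = inv_arrow T A4"
  define P where "P = ?a \<boxtimes>\<^sub>m Ide T e"
  define Q where "Q = Assoc T s e y \<boxtimes>\<^sub>m Ide T e"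
  define M where "M = Ide T s \<boxtimes>\<^sub>m Assoc T e y e"
  define E where "E = Ide T (s \<boxtimes> e) \<boxtimes>\<^sub>m \<epsilon>"
  define E' where "E' = Ide T s \<boxtimes>\<^sub>m (Ide T e \<boxtimes>\<^sub>m \<epsilon>)"
  define N where "N = (Ide T s \<boxtimes>\<^sub>m \<eta>) \<boxtimes>\<^sub>m Ide T e"
  define N' where "N' = Ide T s \<boxtimes>\<^sub>m (\<eta> \<boxtimes>\<^sub>m Ide T e)"
  define rr where "rr = ?r \<boxtimes>\<^sub>m Ide T e"
  define B where "B = (Ide T e \<boxtimes>\<^sub>m \<epsilon>) \<cdot> Assoc T e y e \<cdot> (\<eta> \<boxtimes>\<^sub>m Ide T e)"
  have ty: "Dom T A1 = ((s \<boxtimes> e) \<boxtimes> y) \<boxtimes> e" "Cod T A1 = (s \<boxtimes> e) \<boxtimes> y \<boxtimes> e"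
    "Dom T A2 = (s \<boxtimes> e) \<boxtimes> y \<boxtimes> e" "Cod T A2 = s \<boxtimes> e \<boxtimes> y \<boxtimes> e"
    "Dom T A3 = (s \<boxtimes> e \<boxtimes> y) \<boxtimes> e" "Cod T A3 = s \<boxtimes> (e \<boxtimes> y) \<boxtimes> e"
    "Dom T A4 = (s \<boxtimes> e) \<boxtimes> Unit T" "Cod T A4 = s \<boxtimes> e \<boxtimes> Unit T"
    "Dom T A5 = (s \<boxtimes> Unit T) \<boxtimes> e" "Cod T A5 = s \<boxtimes> Unit T \<boxtimes> e"
    "Dom T P = (s \<boxtimes> e \<boxtimes> y) \<boxtimes> e" "Cod T P = ((s \<boxtimes> e) \<boxtimes> y) \<boxtimes> e"
    "Dom T Q = ((s \<boxtimes> e) \<boxtimes> y) \<boxtimes> e" "Cod T Q = (s \<boxtimes> e \<boxtimes> y) \<boxtimes> e"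
    "Dom T M = s \<boxtimes> (e \<boxtimes> y) \<boxtimes> e" "Cod T M = s \<boxtimes> e \<boxtimes> y \<boxtimes> e"
    "Dom T E = (s \<boxtimes> e) \<boxtimes> y \<boxtimes> e" "Cod T E = (s \<boxtimes> e) \<boxtimes> Unit T"
    "Dom T E' = s \<boxtimes> e \<boxtimes> y \<boxtimes> e" "Cod T E' = s \<boxtimes> e \<boxtimes> Unit T"
    "Dom T N = (s \<boxtimes> Unit T) \<boxtimes> e" "Cod T N = (s \<boxtimes> e \<boxtimes> y) \<boxtimes> e"
    "Dom T N' = s \<boxtimes> Unit T \<boxtimes> e" "Cod T N' = s \<boxtimes> (e \<boxtimes> y) \<boxtimes> e"
    "Dom T rr = s \<boxtimes> e" "Cod T rr = (s \<boxtimes> Unit T) \<boxtimes> e"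
    "Dom T B = Unit T \<boxtimes> e" "Cod T B = e \<boxtimes> Unit T"
    using a r \<eta> \<epsilon>
    by (simp_all add: A1_def A2_def A3_def A4_def A5_def P_def Q_def M_def E_def E'_def N_def N'_def rr_def B_def)
  note i2 = inv_arrow[OF Assoc_iso[of s e "y \<boxtimes> e"], folded A2_def, folded A2i_def]
  note i4 = inv_arrow[OF Assoc_iso[of s e "Unit T"], folded A4_def, folded A4i_def]
  have QP: "Q \<cdot> P = Ide T ((s \<boxtimes> e \<boxtimes> y) \<boxtimes> e)"
    unfolding Q_def P_def using a by (simp add: TensorMap_Comp')
  \<comment> \<open>The pentagon and naturality of the associator rewrite \<open>\<alpha>\<close> so
    that its core is the zigzag composite \<open>B\<close> for \<open>e\<close> alone, tensored with
    \<open>Ide T s\<close>.\<close>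
  have pent: "A2 \<cdot> A1 = M \<cdot> (A3 \<cdot> Q)"
    unfolding A1_def A2_def A3_def M_def Q_def by (rule pentagon)
  have "A2 \<cdot> (A1 \<cdot> P) = M \<cdot> A3"
    using comp_reduce[OF pent, of P] ty QP by simp
  then have "A2i \<cdot> (A2 \<cdot> (A1 \<cdot> P)) = A2i \<cdot> (M \<cdot> A3)" by simp
  then have eq1: "A1 \<cdot> P = A2i \<cdot> (M \<cdot> A3)"
    using comp_reduce[OF i2(3), of "A1 \<cdot> P"] ty i2 by simp
  have nat2: "A4 \<cdot> E = E' \<cdot> A2" unfolding A4_def E_def E'_def A2_def
    using Assoc_natural[of "Ide T s" s s "Ide T e" e e \<epsilon> "y \<boxtimes> e" "Unit T"] \<epsilon> by simp
  have "A4i \<cdot> (A4 \<cdot> E) = A4i \<cdot> (E' \<cdot> A2)" using nat2 by simp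
  then have "E = A4i \<cdot> (E' \<cdot> A2)" using comp_reduce[OF i4(3), of E] ty i4 by simp
  then have "E \<cdot> A2i = (A4i \<cdot> (E' \<cdot> A2)) \<cdot> A2i" by simp
  then have eq2: "E \<cdot> A2i = A4i \<cdot> E'" using ty i2 i4 by simp
  have eq3: "A3 \<cdot> N = N' \<cdot> A5" unfolding A3_def N_def N'_def A5_def
    using Assoc_natural[of "Ide T s" s s \<eta> "Unit T" "e \<boxtimes> y" "Ide T e" e e] \<eta> by simp
  have tB: "E' \<cdot> (M \<cdot> N') = Ide T s \<boxtimes>\<^sub>m B"
    unfolding E'_def M_def N'_def B_def using \<eta> \<epsilon> by (simp add: TensorMap_Comp')
  have "co \<boxtimes>\<^sub>m Ide T e = P \<cdot> (N \<cdot> rr)"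
    unfolding co_def P_def N_def rr_def using a r \<eta> by (simp add: TensorMap_Comp')
  then have "\<alpha> = RUnit T (s \<boxtimes> e) \<cdot> (E \<cdot> (A1 \<cdot> (P \<cdot> (N \<cdot> rr))))"
    unfolding \<alpha>_def rigid_ev_def E_def[symmetric] A1_def[symmetric] using ty by simp
  also have "A1 \<cdot> (P \<cdot> (N \<cdot> rr)) = A2i \<cdot> (M \<cdot> (A3 \<cdot> (N \<cdot> rr)))"
    using comp_reduce[OF eq1, of "N \<cdot> rr"] ty i2 by simp
  also have "A3 \<cdot> (N \<cdot> rr) = N' \<cdot> (A5 \<cdot> rr)" using comp_reduce[OF eq3, of rr] ty by simp
  also have "E \<cdot> (A2i \<cdot> (M \<cdot> (N' \<cdot> (A5 \<cdot> rr)))) = A4i \<cdot> (E' \<cdot> (M \<cdot> (N' \<cdot> (A5 \<cdot> rr))))"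
    using comp_reduce[OF eq2, of "M \<cdot> (N' \<cdot> (A5 \<cdot> rr))"] ty i2 i4 by simp
  also have "E' \<cdot> (M \<cdot> (N' \<cdot> (A5 \<cdot> rr))) = (E' \<cdot> (M \<cdot> N')) \<cdot> (A5 \<cdot> rr)" using ty by simp
  finally have \<alpha>eq: "\<alpha> = RUnit T (s \<boxtimes> e) \<cdot> (A4i \<cdot> ((Ide T s \<boxtimes>\<^sub>m B) \<cdot> (A5 \<cdot> rr)))"
    unfolding tB .
  \<comment> \<open>The zigzag identity shows that \<open>B\<close> is a composite of unit
    isomorphisms, so every factor of \<open>\<alpha>\<close> is invertible.\<close>
  note re = inv_arrow[OF RUnit_iso[of e]]
  have "inv_arrow T (RUnit T e) \<cdot> (RUnit T e \<cdot> B) = inv_arrow T (RUnit T e) \<cdot> LUnit T e"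
    using zig by (simp add: B_def)
  then have "B = inv_arrow T (RUnit T e) \<cdot> LUnit T e"
    using comp_reduce[OF re(3), of B] ty re by simp
  then have "iso_arrow T (Unit T \<boxtimes> e) (e \<boxtimes> Unit T) B"
    using iso_Comp[OF LUnit_iso re(5)] by simp
  then have isoB: "iso_arrow T (s \<boxtimes> Unit T \<boxtimes> e) (s \<boxtimes> e \<boxtimes> Unit T) (Ide T s \<boxtimes>\<^sub>m B)"
    by (rule iso_TensorMap[OF iso_Ide])
  have iso_rr: "iso_arrow T (s \<boxtimes> e) ((s \<boxtimes> Unit T) \<boxtimes> e) rr"
    unfolding rr_def by (rule iso_TensorMap[OF r(5) iso_Ide])
  have iso_A5: "iso_arrow T ((s \<boxtimes> Unit T) \<boxtimes> e) (s \<boxtimes> Unit T \<boxtimes> e) A5"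
    unfolding A5_def by (rule Assoc_iso)
  have "iso_arrow T (s \<boxtimes> e) (s \<boxtimes> e) \<alpha>" unfolding \<alpha>eq
    by (rule iso_Comp[OF iso_Comp[OF iso_Comp[OF iso_Comp[OF iso_rr iso_A5] isoB] i4(5)] RUnit_iso])
  moreover have "\<exists>k. Dom T k = s \<and> Cod T k = u \<boxtimes> y \<and> h \<cdot> \<alpha> = rigid_ev e y \<epsilon> u \<cdot> (k \<boxtimes>\<^sub>m Ide T e)"
    if h: "Dom T h = s \<boxtimes> e" "Cod T h = u" for u h
  proof (intro exI conjI)
    note ev = rigid_ev_Hom[OF \<epsilon>]
    show "Dom T ((h \<boxtimes>\<^sub>m Ide T y) \<cdot> co) = s" "Cod T ((h \<boxtimes>\<^sub>m Ide T y) \<cdot> co) = u \<boxtimes> y"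
      using co h by simp_all
    have "h \<cdot> \<alpha> = (h \<cdot> rigid_ev e y \<epsilon> (s \<boxtimes> e)) \<cdot> (co \<boxtimes>\<^sub>m Ide T e)"
      unfolding \<alpha>_def using h co ev by simp
    also have "\<dots> = rigid_ev e y \<epsilon> u \<cdot> (((h \<boxtimes>\<^sub>m Ide T y) \<boxtimes>\<^sub>m Ide T e) \<cdot> (co \<boxtimes>\<^sub>m Ide T e))"
      unfolding rigid_ev_natural[OF \<epsilon> h] using h co ev by simp
    also have "((h \<boxtimes>\<^sub>m Ide T y) \<boxtimes>\<^sub>m Ide T e) \<cdot> (co \<boxtimes>\<^sub>m Ide T e) = ((h \<boxtimes>\<^sub>m Ide T y) \<cdot> co) \<boxtimes>\<^sub>m Ide T e"
      using h co by (simp add: TensorMap_Comp')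
    finally show "h \<cdot> \<alpha> = rigid_ev e y \<epsilon> u \<cdot> (((h \<boxtimes>\<^sub>m Ide T y) \<cdot> co) \<boxtimes>\<^sub>m Ide T e)" .
  qed
  ultimately show ?thesis by (rule that)
qed

text \<open>A map \<open>h\<close> into a coproduct is transposed to a map from the compact
  \<open>s\<close> into the coproduct of the \<open>t i \<boxtimes> y\<close>. A truncation of
  \<open>c\<close> whose tensor with \<open>y\<close> fixes the transpose also fixes
  \<open>h \<cdot> \<alpha>\<close>, and \<open>\<alpha>\<close> cancels.\<close>

lemma compact_tensor_rigid:
  assumes s: "is_compact T s" and e: "is_rigid T e" shows "is_compact T (s \<boxtimes> e)"
proof (rule compactI)
  fix I t c \<iota> assume I: "small T (I :: 'u set)" and cp: "is_coproduct T I t c \<iota>"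
  obtain y \<eta> \<epsilon> where \<eta>: "Dom T \<eta> = Unit T" "Cod T \<eta> = e \<boxtimes> y" and \<epsilon>: "Dom T \<epsilon> = y \<boxtimes> e" "Cod T \<epsilon> = Unit T"
    and zig: "RUnit T e \<cdot> (Ide T e \<boxtimes>\<^sub>m \<epsilon>) \<cdot> Assoc T e y e \<cdot> (\<eta> \<boxtimes>\<^sub>m Ide T e) = LUnit T e"
    using e unfolding is_rigid_def by auto
  obtain \<alpha> where \<alpha>: "iso_arrow T (s \<boxtimes> e) (s \<boxtimes> e) \<alpha>"
    and tr: "\<And>u h. Dom T h = s \<boxtimes> e \<Longrightarrow> Cod T h = u \<Longrightarrow> \<exists>k. Dom T k = s \<and> Cod T k = u \<boxtimes> y \<and>
       h \<cdot> \<alpha> = rigid_ev e y \<epsilon> u \<cdot> (k \<boxtimes>\<^sub>m Ide T e)"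
    using rigid_transpose[OF \<eta> \<epsilon> zig, of s] by blast
  have da: "Dom T \<alpha> = s \<boxtimes> e" "Cod T \<alpha> = s \<boxtimes> e" using \<alpha> by (auto simp: iso_arrow_def inverse_arrows_def)
  note ev = rigid_ev_Hom[OF \<epsilon>]
  have "\<exists>F \<tau>. finite F \<and> F \<subseteq> I \<and> trunc I t c \<iota> F \<tau> \<and> \<tau> \<cdot> h = h"
    if h: "Dom T h = s \<boxtimes> e" "Cod T h = c" for h
  proof -
    obtain k where k: "Dom T k = s" "Cod T k = c \<boxtimes> y" "h \<cdot> \<alpha> = rigid_ev e y \<epsilon> c \<cdot> (k \<boxtimes>\<^sub>m Ide T e)"
      using tr[OF h] by blast
    obtain F \<tau>' where F: "finite F" "F \<subseteq> I"
      "trunc I (\<lambda>i. t i \<boxtimes> y) (c \<boxtimes> y) (\<lambda>i. \<iota> i \<boxtimes>\<^sub>m Ide T y) F \<tau>'" "\<tau>' \<cdot> k = k"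
      using compact_factors[OF s I tensor_coproduct[OF cp] k(1,2)] .
    obtain \<tau> where \<tau>: "trunc I t c \<iota> F \<tau>" by (rule trunc_exists[OF cp])
    have d: "Dom T \<tau> = c" "Cod T \<tau> = c" using \<tau> by (simp_all add: trunc_def)
    have "trunc I (\<lambda>i. t i \<boxtimes> y) (c \<boxtimes> y) (\<lambda>i. \<iota> i \<boxtimes>\<^sub>m Ide T y) F (\<tau> \<boxtimes>\<^sub>m Ide T y)"
      using \<tau> coproduct_inj[OF cp] by (simp add: trunc_def TensorMap_Comp' Zero_tensor)
    then have "\<tau>' = \<tau> \<boxtimes>\<^sub>m Ide T y" by (rule trunc_unique[OF tensor_coproduct[OF cp] F(3)])
    then have k\<tau>: "(\<tau> \<boxtimes>\<^sub>m Ide T y) \<cdot> k = k" using F(4) by simp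
    have "(\<tau> \<cdot> h) \<cdot> \<alpha> = (\<tau> \<cdot> rigid_ev e y \<epsilon> c) \<cdot> (k \<boxtimes>\<^sub>m Ide T e)"
      using k h da d ev by simp
    also have "\<dots> = rigid_ev e y \<epsilon> c \<cdot> (((\<tau> \<boxtimes>\<^sub>m Ide T y) \<boxtimes>\<^sub>m Ide T e) \<cdot> (k \<boxtimes>\<^sub>m Ide T e))"
      unfolding rigid_ev_natural[OF \<epsilon> d] using k(1,2) d ev by simp
    also have "((\<tau> \<boxtimes>\<^sub>m Ide T y) \<boxtimes>\<^sub>m Ide T e) \<cdot> (k \<boxtimes>\<^sub>m Ide T e) = k \<boxtimes>\<^sub>m Ide T e"
      using k(1,2) d k\<tau> by (simp add: TensorMap_Comp')
    also note k(3)[symmetric]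
    finally have \<tau>h: "(\<tau> \<cdot> h) \<cdot> \<alpha> = h \<cdot> \<alpha>" .
    have "\<tau> \<cdot> h = h" by (rule iso_arrow_epi[OF \<alpha> _ h(1) \<tau>h]) (use h d in simp)
    then show ?thesis using F(1,2) \<tau> by blast
  qed
  then show "\<exists>c \<iota>. is_coproduct T I t c \<iota> \<and> (\<forall>h. Dom T h = s \<boxtimes> e \<longrightarrow> Cod T h = c \<longrightarrow>
      (\<exists>F \<tau>. finite F \<and> F \<subseteq> I \<and> trunc I t c \<iota> F \<tau> \<and> \<tau> \<cdot> h = h))"
    using cp by blast
qed

text \<open>The second zigzag makes \<open>y\<close> a retract of
  \<open>y \<boxtimes> e \<boxtimes> y\<close>, so vanishing of \<open>u \<boxtimes> e\<close>
  forces vanishing of \<open>u \<boxtimes> y\<close>, which is the target of the transpose of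
  \<open>h\<close>.\<close>

lemma rigid_orthogonal:
  assumes e: "is_rigid T e" and z: "is_zero T (u \<boxtimes> e)" and h: "Dom T h = s \<boxtimes> e" "Cod T h = u"
  shows "h = Zero T (s \<boxtimes> e) u"
proof -
  obtain y \<eta> \<epsilon> where \<eta>: "Dom T \<eta> = Unit T" "Cod T \<eta> = e \<boxtimes> y" and \<epsilon>: "Dom T \<epsilon> = y \<boxtimes> e" "Cod T \<epsilon> = Unit T"
    and zig: "RUnit T e \<cdot> (Ide T e \<boxtimes>\<^sub>m \<epsilon>) \<cdot> Assoc T e y e \<cdot> (\<eta> \<boxtimes>\<^sub>m Ide T e) = LUnit T e"
    and zag: "LUnit T y \<cdot> (\<epsilon> \<boxtimes>\<^sub>m Ide T y) \<cdot> inv_arrow T (Assoc T y e y) \<cdot> (Ide T y \<boxtimes>\<^sub>m \<eta>) = RUnit T y"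
    using e unfolding is_rigid_def by auto
  obtain \<alpha> where \<alpha>: "iso_arrow T (s \<boxtimes> e) (s \<boxtimes> e) \<alpha>"
    and tr: "\<And>u h. Dom T h = s \<boxtimes> e \<Longrightarrow> Cod T h = u \<Longrightarrow> \<exists>k. Dom T k = s \<and> Cod T k = u \<boxtimes> y \<and>
       h \<cdot> \<alpha> = rigid_ev e y \<epsilon> u \<cdot> (k \<boxtimes>\<^sub>m Ide T e)"
    using rigid_transpose[OF \<eta> \<epsilon> zig, of s] by blast
  have da: "Dom T \<alpha> = s \<boxtimes> e" "Cod T \<alpha> = s \<boxtimes> e" using \<alpha> by (auto simp: iso_arrow_def inverse_arrows_def)
  note ev = rigid_ev_Hom[OF \<epsilon>]
  note r = inv_arrow[OF RUnit_iso[of y]] and a = inv_arrow[OF Assoc_iso[of y e y]]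
  define i where "i = (Ide T y \<boxtimes>\<^sub>m \<eta>) \<cdot> inv_arrow T (RUnit T y)"
  define q where "q = LUnit T y \<cdot> (\<epsilon> \<boxtimes>\<^sub>m Ide T y) \<cdot> inv_arrow T (Assoc T y e y)"
  have iq: "Dom T i = y" "Cod T i = y \<boxtimes> e \<boxtimes> y" "Dom T q = y \<boxtimes> e \<boxtimes> y" "Cod T q = y"
    using r a \<eta> \<epsilon> by (simp_all add: i_def q_def)
  have "q \<cdot> i = (LUnit T y \<cdot> (\<epsilon> \<boxtimes>\<^sub>m Ide T y) \<cdot> inv_arrow T (Assoc T y e y) \<cdot> (Ide T y \<boxtimes>\<^sub>m \<eta>)) \<cdot> inv_arrow T (RUnit T y)"
    using r a \<eta> \<epsilon> by (simp add: i_def q_def)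
  then have qi: "q \<cdot> i = Ide T y" unfolding zag using r by simp
  note ann = annihilator_ideal[of u]
  have "e \<in> {v. is_zero T (v \<boxtimes> u)}" using z is_zero_tensor_commute by blast
  then have "y \<boxtimes> e \<boxtimes> y \<in> {v. is_zero T (v \<boxtimes> u)}"
    using ideal_tensor_left[OF ann ideal_tensor[OF ann]] by blast
  then have "is_zero T ((y \<boxtimes> e \<boxtimes> y) \<boxtimes> u)" by simp
  then have "is_zero T (y \<boxtimes> u)"
    by (rule is_zero_retract[where i = "i \<boxtimes>\<^sub>m Ide T u" and r = "q \<boxtimes>\<^sub>m Ide T u"])
       (use iq qi in \<open>simp_all add: TensorMap_Comp'\<close>)
  then have zy: "is_zero T (u \<boxtimes> y)" using is_zero_tensor_commute by blast
  obtain k where k: "Dom T k = s" "Cod T k = u \<boxtimes> y" "h \<cdot> \<alpha> = rigid_ev e y \<epsilon> u \<cdot> (k \<boxtimes>\<^sub>m Ide T e)"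
    using tr[OF h] by blast
  have "k = Zero T s (u \<boxtimes> y)" using is_zero_to[OF zy k(2)] k(1) by simp
  then have "h \<cdot> \<alpha> = Zero T (s \<boxtimes> e) u \<cdot> \<alpha>" using k(3) ev da by (simp add: Zero_tensor)
  then show ?thesis by (rule iso_arrow_epi[OF \<alpha> h(1) Zero_Hom(1)])
qed

end

section \<open>Compact generation\<close>

context triangulated_category
begin

section \<open>Approximation by homotopy colimits\<close>

lemma Hom_eq_ZeroI:
  assumes "\<And>\<alpha>. Dom C \<alpha> = x \<Longrightarrow> Cod C \<alpha> = y \<Longrightarrow> \<alpha> = Zero C x y"
  shows "Hom C x y = {Zero C x y}"
proof (intro equalityI subsetI)
  fix \<alpha> assume "\<alpha> \<in> Hom C x y"
  then show "\<alpha> \<in> {Zero C x y}" using assms[of \<alpha>] by simp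
qed simp

text \<open>\<open>k\<close> is the map induced on the coproduct of the domains of \<open>A\<close>,
  which exists by smallness. Lifts are the coproduct injections, and a map killing all of
  \<open>A\<close> kills \<open>k\<close>.\<close>

lemma small_cover:
  assumes hc: "has_small_coproducts C" and L: "localizing_subcategory C L"
    and A: "small C A" "\<And>\<alpha>. \<alpha> \<in> A \<Longrightarrow> Cod C \<alpha> = t \<and> Dom C \<alpha> \<in> L"
  obtains c k where "c \<in> L" "Dom C k = c" "Cod C k = t"
    "\<And>\<alpha>. \<alpha> \<in> A \<Longrightarrow> \<exists>\<beta>. Dom C \<beta> = Dom C \<alpha> \<and> Cod C \<beta> = c \<and> k \<cdot> \<beta> = \<alpha>"
    "\<And>h. Dom C h = t \<Longrightarrow> (\<And>\<alpha>. \<alpha> \<in> A \<Longrightarrow> h \<cdot> \<alpha> = Zero C (Dom C \<alpha>) (Cod C h)) \<Longrightarrow>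
        h \<cdot> k = Zero C c (Cod C h)"
proof -
  obtain e :: "'m \<Rightarrow> 'u" and c \<iota> where e: "inj_on e A" "small C (e ` A)"
    and cp: "is_coproduct C (e ` A) (\<lambda>i. Dom C (the_inv_into A e i)) c \<iota>"
    using small_family_coproduct[OF hc A(1), of "Dom C"] by blast
  let ?d = "the_inv_into A e"
  have d: "?d (e \<alpha>) = \<alpha>" if "\<alpha> \<in> A" for \<alpha> using the_inv_into_f_f[OF e(1) that] .
  note inj = coproduct_inj[OF cp]
  have "\<And>i. i \<in> e ` A \<Longrightarrow> Dom C (?d i) = Dom C (?d i) \<and> Cod C (?d i) = t" using d A(2) by auto
  from coproduct_map[OF cp this] obtain k where
    k: "Dom C k = c" "Cod C k = t" "\<And>i. i \<in> e ` A \<Longrightarrow> k \<cdot> \<iota> i = ?d i" by blast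
  show ?thesis
  proof (rule that[OF _ k(1,2)])
    show "c \<in> L" by (rule localizing_coproduct[OF L e(2) cp]) (use d A(2) in auto)
    show "\<exists>\<beta>. Dom C \<beta> = Dom C \<alpha> \<and> Cod C \<beta> = c \<and> k \<cdot> \<beta> = \<alpha>" if "\<alpha> \<in> A" for \<alpha>
      using k(3)[of "e \<alpha>"] inj[of "e \<alpha>"] d[OF that] that by (intro exI[of _ "\<iota> (e \<alpha>)"]) simp
    fix h assume h: "Dom C h = t" "\<And>\<alpha>. \<alpha> \<in> A \<Longrightarrow> h \<cdot> \<alpha> = Zero C (Dom C \<alpha>) (Cod C h)"
    show "h \<cdot> k = Zero C c (Cod C h)"
    proof (rule coproduct_eqI[OF cp])
      fix i assume i: "i \<in> e ` A"
      then obtain \<alpha> where \<alpha>: "\<alpha> \<in> A" "i = e \<alpha>" by blast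
      have "(h \<cdot> k) \<cdot> \<iota> i = h \<cdot> \<alpha>" using h(1) k inj[OF i] i \<alpha> d by simp
      then show "(h \<cdot> k) \<cdot> \<iota> i = Zero C c (Cod C h) \<cdot> \<iota> i"
        using h(2)[OF \<alpha>(1)] inj[OF i] \<alpha> d by simp
    qed (use h(1) k in simp_all)
  qed
qed

text \<open>Coning off a cover of all maps from \<open>G\<close> that \<open>\<pi>\<close> kills
  makes them vanish at the next stage, and \<open>\<pi>\<close> extends to the cone because it kills
  the cover.\<close>

lemma telescope_step:
  assumes hc: "has_small_coproducts C" and L: "localizing_subcategory C L"
    and G: "small C G" "G \<subseteq> L" and e: "e \<in> L" "Dom C \<pi> = e" "Cod C \<pi> = s"
  obtains e' \<pi>' j where "e' \<in> L" "Dom C \<pi>' = e'" "Cod C \<pi>' = s" "Dom C j = e" "Cod C j = e'" "\<pi>' \<cdot> j = \<pi>"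
    "\<And>\<alpha>. Dom C \<alpha> \<in> G \<Longrightarrow> Cod C \<alpha> = e \<Longrightarrow> \<pi> \<cdot> \<alpha> = Zero C (Dom C \<alpha>) s \<Longrightarrow> j \<cdot> \<alpha> = Zero C (Dom C \<alpha>) e'"
proof -
  let ?A = "{\<alpha>. Dom C \<alpha> \<in> G \<and> Cod C \<alpha> = e \<and> \<pi> \<cdot> \<alpha> = Zero C (Dom C \<alpha>) s}"
  have "small C (\<Union>g\<in>G. Hom C g e)" by (rule small_UN[OF G(1) locally_small])
  then have A: "small C ?A" by (rule small_subset[rotated]) auto
  have "\<And>\<alpha>. \<alpha> \<in> ?A \<Longrightarrow> Cod C \<alpha> = e \<and> Dom C \<alpha> \<in> L" using G(2) by auto
  from small_cover[OF hc L A this] obtain c k where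
    c: "c \<in> L" and k: "Dom C k = c" "Cod C k = e"
    and lift: "\<And>\<alpha>. \<alpha> \<in> ?A \<Longrightarrow> \<exists>\<beta>. Dom C \<beta> = Dom C \<alpha> \<and> Cod C \<beta> = c \<and> k \<cdot> \<beta> = \<alpha>"
    and van: "\<And>h. Dom C h = e \<Longrightarrow> (\<And>\<alpha>. \<alpha> \<in> ?A \<Longrightarrow> h \<cdot> \<alpha> = Zero C (Dom C \<alpha>) (Cod C h)) \<Longrightarrow>
        h \<cdot> k = Zero C c (Cod C h)" by blast
  have \<pi>k: "\<pi> \<cdot> k = Zero C c (Cod C \<pi>)" by (rule van) (use e in simp_all)
  obtain e' j w where t: "tri c e e' k j w" using tri_exists[OF k] .
  note d = triD[OF t]
  obtain \<pi>' where \<pi>': "Dom C \<pi>' = e'" "Cod C \<pi>' = Cod C \<pi>" "\<pi>' \<cdot> j = \<pi>"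
    using tri_weak_cokernel[OF t e(2) \<pi>k] .
  show ?thesis
  proof (rule that[OF _ \<pi>'(1) _ d(4,5) \<pi>'(3)])
    show "e' \<in> L" by (rule tsub_third[OF localizing_triangulated[OF L] t c e(1)])
    show "Cod C \<pi>' = s" using \<pi>' e by simp
    fix \<alpha> assume \<alpha>: "Dom C \<alpha> \<in> G" "Cod C \<alpha> = e" "\<pi> \<cdot> \<alpha> = Zero C (Dom C \<alpha>) s"
    then obtain \<beta> where \<beta>: "Dom C \<beta> = Dom C \<alpha>" "Cod C \<beta> = c" "k \<cdot> \<beta> = \<alpha>" using lift by blast
    have "j \<cdot> (k \<cdot> \<beta>) = Zero C (Dom C \<alpha>) e'"
      using comp_reduce[OF tri_comp_Zero[OF t], of \<beta>] \<beta> d by simp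
    then show "j \<cdot> \<alpha> = Zero C (Dom C \<alpha>) e'" using \<beta>(3) by simp
  qed
qed

lemma telescope_sequence:
  assumes hc: "has_small_coproducts C" and L: "localizing_subcategory C L"
    and G: "small C G" "G \<subseteq> L"
  obtains E \<pi> j where "\<And>n. E n \<in> L" "\<And>n. Dom C (\<pi> n) = E n" "\<And>n. Cod C (\<pi> n) = s"
    "\<And>n. Dom C (j n) = E n" "\<And>n. Cod C (j n) = E (Suc n)" "\<And>n. \<pi> (Suc n) \<cdot> j n = \<pi> n"
    "\<And>n \<alpha>. Dom C \<alpha> \<in> G \<Longrightarrow> Cod C \<alpha> = E n \<Longrightarrow> \<pi> n \<cdot> \<alpha> = Zero C (Dom C \<alpha>) s \<Longrightarrow>
       j n \<cdot> \<alpha> = Zero C (Dom C \<alpha>) (E (Suc n))"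
    "\<And>\<alpha>. Dom C \<alpha> \<in> G \<Longrightarrow> Cod C \<alpha> = s \<Longrightarrow> \<exists>\<beta>. Dom C \<beta> = Dom C \<alpha> \<and> Cod C \<beta> = E 0 \<and> \<pi> 0 \<cdot> \<beta> = \<alpha>"
proof -
  define lifts where "lifts \<pi> \<longleftrightarrow> (\<forall>\<alpha>. Dom C \<alpha> \<in> G \<longrightarrow> Cod C \<alpha> = s \<longrightarrow>
    (\<exists>\<beta>. Dom C \<beta> = Dom C \<alpha> \<and> Cod C \<beta> = Dom C \<pi> \<and> \<pi> \<cdot> \<beta> = \<alpha>))" for \<pi>
  \<comment> \<open>Lifting is demanded at stage 0 only; the transition maps carry lifts to every
    later stage.\<close>
  define P where "P n \<pi> \<longleftrightarrow> Dom C \<pi> \<in> L \<and> Cod C \<pi> = s \<and> (n = 0 \<longrightarrow> lifts \<pi>)" for n :: nat and \<pi>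
  define step where "step \<pi> \<pi>' j \<longleftrightarrow> Dom C j = Dom C \<pi> \<and> Cod C j = Dom C \<pi>' \<and> \<pi>' \<cdot> j = \<pi> \<and>
    (\<forall>\<alpha>. Dom C \<alpha> \<in> G \<longrightarrow> Cod C \<alpha> = Dom C \<pi> \<longrightarrow> \<pi> \<cdot> \<alpha> = Zero C (Dom C \<alpha>) s \<longrightarrow>
       j \<cdot> \<alpha> = Zero C (Dom C \<alpha>) (Dom C \<pi>'))" for \<pi> \<pi>' j
  have "\<exists>\<pi>. \<forall>n. P n (\<pi> n) \<and> (\<exists>j. step (\<pi> n) (\<pi> (Suc n)) j)"
  proof (rule dependent_nat_choice)
    let ?A = "{\<alpha>. Dom C \<alpha> \<in> G \<and> Cod C \<alpha> = s}"
    have "small C (\<Union>g\<in>G. Hom C g s)" by (rule small_UN[OF G(1) locally_small])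
    then have A: "small C ?A" by (rule small_subset[rotated]) auto
    have Ad: "\<And>\<alpha>. \<alpha> \<in> ?A \<Longrightarrow> Cod C \<alpha> = s \<and> Dom C \<alpha> \<in> L" using G(2) by auto
    obtain c k where
      c: "c \<in> L" and k: "Dom C k = c" "Cod C k = s"
      and lift: "\<And>\<alpha>. \<alpha> \<in> ?A \<Longrightarrow> \<exists>\<beta>. Dom C \<beta> = Dom C \<alpha> \<and> Cod C \<beta> = c \<and> k \<cdot> \<beta> = \<alpha>"
      by (rule small_cover[OF hc L A], erule Ad, rule that)
    have "P 0 k" using c k lift by (simp add: P_def lifts_def)
    then show "\<exists>\<pi>. P 0 \<pi>" by blast
  next
    fix \<pi> and n :: nat assume "P n \<pi>"
    then have \<pi>: "Dom C \<pi> \<in> L" "Cod C \<pi> = s" by (simp_all add: P_def)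
    obtain e' \<pi>' j where s: "e' \<in> L" "Dom C \<pi>' = e'" "Cod C \<pi>' = s" "Dom C j = Dom C \<pi>" "Cod C j = e'" "\<pi>' \<cdot> j = \<pi>"
      "\<And>\<alpha>. Dom C \<alpha> \<in> G \<Longrightarrow> Cod C \<alpha> = Dom C \<pi> \<Longrightarrow> \<pi> \<cdot> \<alpha> = Zero C (Dom C \<alpha>) s \<Longrightarrow> j \<cdot> \<alpha> = Zero C (Dom C \<alpha>) e'"
      by (rule telescope_step[OF hc L G \<pi>(1) refl \<pi>(2)]) (rule that)
    have "P (Suc n) \<pi>'" using s by (simp add: P_def)
    moreover have "step \<pi> \<pi>' j" unfolding step_def using s by simp
    ultimately show "\<exists>\<pi>'. P (Suc n) \<pi>' \<and> (\<exists>j. step \<pi> \<pi>' j)" by blast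
  qed
  then obtain \<pi> where all: "\<forall>n. P n (\<pi> n) \<and> (\<exists>j. step (\<pi> n) (\<pi> (Suc n)) j)" by (elim exE)
  then have \<pi>: "\<And>n. P n (\<pi> n)" "\<And>n. \<exists>j. step (\<pi> n) (\<pi> (Suc n)) j" by simp_all
  have "\<exists>j. \<forall>n. step (\<pi> n) (\<pi> (Suc n)) (j n)" by (rule choice) (use \<pi>(2) in blast)
  then obtain j where j: "\<And>n. step (\<pi> n) (\<pi> (Suc n)) (j n)" by blast
  show ?thesis
    by (rule that[of "\<lambda>n. Dom C (\<pi> n)" \<pi> j])
       (use \<pi>(1) \<pi>(1)[of 0] j in \<open>simp_all add: P_def step_def lifts_def\<close>)
qed

text \<open>The homotopy colimit of the sequence maps to \<open>s\<close>. This map is surjective on maps out of \<open>G\<close>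
  already at stage \<open>0\<close>, and injective because a map killed in \<open>s\<close> is killed one stage later.\<close>

lemma telescope:
  assumes hc: "has_small_coproducts C" and L: "localizing_subcategory C L"
    and G: "small C G" "G \<subseteq> L" "\<And>g. g \<in> G \<Longrightarrow> is_compact C g"
      "\<And>g. g \<in> G \<Longrightarrow> \<exists>g'\<in>G. isomorphic C (Susp C g') g"
    and detect: "\<And>z. (\<And>\<phi>. Dom C \<phi> \<in> G \<Longrightarrow> Cod C \<phi> = z \<Longrightarrow> \<phi> = Zero C (Dom C \<phi>) z) \<Longrightarrow> is_zero C z"
  shows "s \<in> L"
proof -
  obtain E \<pi> j where E: "\<And>n. E n \<in> L" and \<pi>: "\<And>n. Dom C (\<pi> n) = E n" "\<And>n. Cod C (\<pi> n) = s"
    and j: "\<And>n. Dom C (j n) = E n" "\<And>n. Cod C (j n) = E (Suc n)" and \<pi>j: "\<And>n. \<pi> (Suc n) \<cdot> j n = \<pi> n"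
    and kill: "\<And>n \<alpha>. Dom C \<alpha> \<in> G \<Longrightarrow> Cod C \<alpha> = E n \<Longrightarrow> \<pi> n \<cdot> \<alpha> = Zero C (Dom C \<alpha>) s \<Longrightarrow>
       j n \<cdot> \<alpha> = Zero C (Dom C \<alpha>) (E (Suc n))"
    and lift: "\<And>\<alpha>. Dom C \<alpha> \<in> G \<Longrightarrow> Cod C \<alpha> = s \<Longrightarrow> \<exists>\<beta>. Dom C \<beta> = Dom C \<alpha> \<and> Cod C \<beta> = E 0 \<and> \<pi> 0 \<cdot> \<beta> = \<alpha>"
    by (rule telescope_sequence[OF hc L G(1,2), of s]) (rule that)
  obtain e :: "nat \<Rightarrow> 'u" and c \<iota> where e: "inj e" "small C (range e)"
    and cp: "is_coproduct C (range e) (\<lambda>i. E (the_inv_into UNIV e i)) c \<iota>"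
    using small_family_coproduct[OF hc small_nat, of E] by blast
  let ?d = "the_inv_into UNIV e"
  have d: "?d (e n) = n" for n using the_inv_into_f_f[OF e(1)] by simp
  define \<nu> where "\<nu> n = \<iota> (e n)" for n
  have \<nu>: "Dom C (\<nu> n) = E n" "Cod C (\<nu> n) = c" for n
    using coproduct_inj[OF cp, of "e n"] d by (simp_all add: \<nu>_def)
  have eqI: "h = h'" if "Dom C h = c" "Dom C h' = c" "Cod C h = Cod C h'" "\<And>n. h \<cdot> \<nu> n = h' \<cdot> \<nu> n" for h h'
    by (rule coproduct_eqI[OF cp that(1-3)]) (use that(4) in \<open>auto simp: \<nu>_def\<close>)
  have map: "\<exists>h. Dom C h = c \<and> Cod C h = z \<and> (\<forall>n. h \<cdot> \<nu> n = g n)"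
    if g: "\<And>n. Dom C (g n) = E n \<and> Cod C (g n) = z" for g z
  proof -
    have "\<And>i. i \<in> range e \<Longrightarrow> Dom C (g (?d i)) = E (?d i) \<and> Cod C (g (?d i)) = z" using g by blast
    from coproduct_map[OF cp this] obtain h where
      "Dom C h = c" "Cod C h = z" "\<And>i. i \<in> range e \<Longrightarrow> h \<cdot> \<iota> i = g (?d i)" by blast
    then show ?thesis using d by (intro exI[of _ h]) (simp add: \<nu>_def)
  qed
  have "\<And>n. Dom C (\<nu> (Suc n) \<cdot> j n) = E n \<and> Cod C (\<nu> (Suc n) \<cdot> j n) = c" using j \<nu> by simp
  from map[OF this] obtain \<sigma> where \<sigma>: "Dom C \<sigma> = c" "Cod C \<sigma> = c" "\<And>n. \<sigma> \<cdot> \<nu> n = \<nu> (Suc n) \<cdot> j n" by blast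
  have "\<And>n. Dom C (\<pi> n) = E n \<and> Cod C (\<pi> n) = s" using \<pi> by simp
  from map[OF this] obtain \<Psi> where \<Psi>: "Dom C \<Psi> = c" "Cod C \<Psi> = s" "\<And>n. \<Psi> \<cdot> \<nu> n = \<pi> n" by blast
  \<comment> \<open>Identity minus shift; its cone \<open>H\<close> is the homotopy colimit of the
    sequence.\<close>
  let ?\<Delta> = "Ide C c \<^bold>+ Neg C \<sigma>"
  have \<Delta>: "Dom C ?\<Delta> = c" "Cod C ?\<Delta> = c" using \<sigma> by simp_all
  obtain H \<kappa> \<omega> where t: "tri c c H ?\<Delta> \<kappa> \<omega>" using tri_exists[OF \<Delta>] .
  note D = triD[OF t]
  have "\<kappa> \<^bold>+ Neg C (\<kappa> \<cdot> \<sigma>) = Zero C c H"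
    using tri_comp_Zero[OF t] D \<sigma> by (simp add: Comp_Add' Comp_Neg)
  then have \<kappa>\<sigma>: "\<kappa> = \<kappa> \<cdot> \<sigma>" by (rule diff_eq_Zero[rotated 2]) (use D \<sigma> in simp_all)
  have \<kappa>\<nu>: "\<kappa> \<cdot> \<nu> n = \<kappa> \<cdot> (\<nu> (Suc n) \<cdot> j n)" for n
  proof -
    have "\<kappa> \<cdot> \<nu> n = (\<kappa> \<cdot> \<sigma>) \<cdot> \<nu> n" using \<kappa>\<sigma> by simp
    then show ?thesis using D \<sigma> \<nu> by simp
  qed
  have "\<Psi> = \<Psi> \<cdot> \<sigma>"
  proof (rule eqI)
    fix n
    have "(\<Psi> \<cdot> \<sigma>) \<cdot> \<nu> n = (\<Psi> \<cdot> \<nu> (Suc n)) \<cdot> j n" using \<Psi>(1,2) \<sigma> \<nu> j by simp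
    then show "\<Psi> \<cdot> \<nu> n = (\<Psi> \<cdot> \<sigma>) \<cdot> \<nu> n" using \<Psi>(3) \<pi>j by simp
  qed (use \<Psi> \<sigma> in simp_all)
  then have "\<Psi> \<cdot> ?\<Delta> = Zero C c (Cod C \<Psi>)"
    using \<Psi>(1,2) \<sigma> by (simp add: Comp_Add' Comp_Neg Add_Neg)
  from tri_weak_cokernel[OF t \<Psi>(1) this] obtain p where p: "Dom C p = H" "Cod C p = Cod C \<Psi>" "p \<cdot> \<kappa> = \<Psi>" .
  have ps: "Cod C p = s" using p \<Psi> by simp
  have p\<kappa>\<nu>: "p \<cdot> (\<kappa> \<cdot> \<nu> n) = \<pi> n" for n
    using comp_reduce[OF p(3), of "\<nu> n"] p \<Psi>(3) D \<nu> by simp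
  obtain q where q: "projections (range e) (\<lambda>i. E (?d i)) c \<iota> q" by (rule projections_exist[OF cp])
  define r where "r n = q (e n)" for n
  have r: "Dom C (r m) = c" "Cod C (r m) = E m"
    "r m \<cdot> \<nu> n = (if n = m then Ide C (E m) else Zero C (E n) (E m))" for m n
    using q d e(1) by (auto simp: projections_def r_def \<nu>_def inj_def)
  \<comment> \<open>A map fixed by the shift has zero component at stage 0, which the shift does not
    reach, and then inductively at every stage. For a map from a compact object, vanishing of all
    components means vanishing.\<close>
  have fixed: "\<zeta> = Zero C g c"
    if g: "is_compact C g" and \<zeta>: "Dom C \<zeta> = g" "Cod C \<zeta> = c" "?\<Delta> \<cdot> \<zeta> = Zero C g c" for g \<zeta>
  proof -
    have "\<zeta> \<^bold>+ Neg C (\<sigma> \<cdot> \<zeta>) = Zero C g c"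
      using \<zeta> \<sigma> by (simp add: Add_Comp' Neg_Comp)
    then have \<zeta>\<sigma>: "\<zeta> = \<sigma> \<cdot> \<zeta>" by (rule diff_eq_Zero[rotated 2]) (use \<zeta> \<sigma> in simp_all)
    have r0: "r 0 \<cdot> \<sigma> = Zero C c (E 0)"
    proof (rule eqI)
      fix n
      have "(r 0 \<cdot> \<sigma>) \<cdot> \<nu> n = (r 0 \<cdot> \<nu> (Suc n)) \<cdot> j n" using r(1,2) \<sigma> \<nu> j by simp
      then show "(r 0 \<cdot> \<sigma>) \<cdot> \<nu> n = Zero C c (E 0) \<cdot> \<nu> n" using r(3) j \<nu> by simp
    qed (use r \<sigma> in simp_all)
    have rS: "r (Suc m) \<cdot> \<sigma> = j m \<cdot> r m" for m
    proof (rule eqI)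
      fix n
      have "(r (Suc m) \<cdot> \<sigma>) \<cdot> \<nu> n = (r (Suc m) \<cdot> \<nu> (Suc n)) \<cdot> j n" using r(1,2) \<sigma> \<nu> j by simp
      also have "\<dots> = j m \<cdot> (r m \<cdot> \<nu> n)" using r(3) j by simp
      finally show "(r (Suc m) \<cdot> \<sigma>) \<cdot> \<nu> n = (j m \<cdot> r m) \<cdot> \<nu> n" using r(1,2) \<nu> j by simp
    qed (use r \<sigma> j in simp_all)
    have "r m \<cdot> \<zeta> = Zero C g (E m)" for m
    proof (induction m)
      case 0
      have "r 0 \<cdot> \<zeta> = r 0 \<cdot> (\<sigma> \<cdot> \<zeta>)" using \<zeta>\<sigma> by simp
      then show ?case using comp_reduce[OF r0, of \<zeta>] r(1,2) \<sigma> \<zeta>(1,2) by simp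
    next
      case (Suc m)
      have "r (Suc m) \<cdot> \<zeta> = r (Suc m) \<cdot> (\<sigma> \<cdot> \<zeta>)" using \<zeta>\<sigma> by simp
      also have "\<dots> = j m \<cdot> (r m \<cdot> \<zeta>)" using comp_reduce[OF rS, where h = \<zeta>] r(1,2) \<sigma> \<zeta>(1,2) j by simp
      finally show ?case using Suc j by simp
    qed
    then show ?thesis
      by (intro compact_eq_ZeroI[OF g e(2) cp \<zeta>(1,2) q]) (use d in \<open>auto simp: r_def\<close>)
  qed
  have stage: "\<exists>\<gamma>'. Dom C \<gamma>' = g \<and> Cod C \<gamma>' = E (n + m) \<and> \<kappa> \<cdot> (\<nu> n \<cdot> \<gamma>) = \<kappa> \<cdot> (\<nu> (n + m) \<cdot> \<gamma>')"
    if \<gamma>: "Dom C \<gamma> = g" "Cod C \<gamma> = E n" for g n m \<gamma>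
  proof (induction m)
    case 0 show ?case using \<gamma> by (intro exI[of _ \<gamma>]) simp
  next
    case (Suc m)
    then obtain \<gamma>' where \<gamma>': "Dom C \<gamma>' = g" "Cod C \<gamma>' = E (n + m)"
      "\<kappa> \<cdot> (\<nu> n \<cdot> \<gamma>) = \<kappa> \<cdot> (\<nu> (n + m) \<cdot> \<gamma>')" by blast
    have "\<kappa> \<cdot> (\<nu> (n + m) \<cdot> \<gamma>') = \<kappa> \<cdot> (\<nu> (n + Suc m) \<cdot> (j (n + m) \<cdot> \<gamma>'))"
      using comp_reduce[OF \<kappa>\<nu>[of "n + m"], of \<gamma>'] \<gamma>' D \<nu> j by simp
    then show ?case using \<gamma>' j by (intro exI[of _ "j (n + m) \<cdot> \<gamma>'"]) simp
  qed
  \<comment> \<open>In \<open>H\<close> a component at one stage may be pushed to any later stage,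
    so two components at \<open>n\<close> and \<open>m\<close> are added at the common stage
    \<open>n + m\<close>.\<close>
  have finite_stage: "\<exists>n \<gamma>. Dom C \<gamma> = g \<and> Cod C \<gamma> = E n \<and> \<kappa> \<cdot> \<xi> = \<kappa> \<cdot> (\<nu> n \<cdot> \<gamma>)"
    if g: "is_compact C g" and \<xi>: "Dom C \<xi> = g" "Cod C \<xi> = c" for g \<xi>
  proof (rule compact_induct[OF g e(2) cp \<xi>, where Q = "\<lambda>\<xi>. \<exists>n \<gamma>. Dom C \<gamma> = g \<and> Cod C \<gamma> = E n \<and> \<kappa> \<cdot> \<xi> = \<kappa> \<cdot> (\<nu> n \<cdot> \<gamma>)"])
    show "\<exists>n \<gamma>. Dom C \<gamma> = g \<and> Cod C \<gamma> = E n \<and> \<kappa> \<cdot> Zero C g c = \<kappa> \<cdot> (\<nu> n \<cdot> \<gamma>)"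
      using \<nu> D by (intro exI[of _ 0] exI[of _ "Zero C g (E 0)"]) simp
    fix k i g' assume i: "i \<in> range e" and k: "Dom C k = g" "Cod C k = c"
      and g': "Dom C g' = g" "Cod C g' = E (?d i)"
      and "\<exists>n \<gamma>. Dom C \<gamma> = g \<and> Cod C \<gamma> = E n \<and> \<kappa> \<cdot> k = \<kappa> \<cdot> (\<nu> n \<cdot> \<gamma>)"
    then obtain n \<gamma> where \<gamma>: "Dom C \<gamma> = g" "Cod C \<gamma> = E n" "\<kappa> \<cdot> k = \<kappa> \<cdot> (\<nu> n \<cdot> \<gamma>)" by blast
    obtain m where m: "i = e m" using i by blast
    have g'm: "Cod C g' = E m" using g' m d by simp
    obtain \<gamma>1 where \<gamma>1: "Dom C \<gamma>1 = g" "Cod C \<gamma>1 = E (n + m)" "\<kappa> \<cdot> (\<nu> n \<cdot> \<gamma>) = \<kappa> \<cdot> (\<nu> (n + m) \<cdot> \<gamma>1)"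
      using stage[OF \<gamma>(1,2), of m] by blast
    obtain \<gamma>2 where \<gamma>2: "Dom C \<gamma>2 = g" "Cod C \<gamma>2 = E (m + n)" "\<kappa> \<cdot> (\<nu> m \<cdot> g') = \<kappa> \<cdot> (\<nu> (m + n) \<cdot> \<gamma>2)"
      using stage[OF g'(1) g'm, of n] by blast
    have "\<kappa> \<cdot> (k \<^bold>+ \<iota> i \<cdot> g') = \<kappa> \<cdot> k \<^bold>+ \<kappa> \<cdot> (\<nu> m \<cdot> g')"
      using k g'(1) g'm D \<nu> m by (simp add: Comp_Add' flip: \<nu>_def)
    also have "\<dots> = \<kappa> \<cdot> (\<nu> (n + m) \<cdot> (\<gamma>1 \<^bold>+ \<gamma>2))"
      using \<gamma>(3) \<gamma>1 \<gamma>2 D \<nu> by (simp add: Comp_Add' add.commute)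
    finally show "\<exists>n \<gamma>. Dom C \<gamma> = g \<and> Cod C \<gamma> = E n \<and> \<kappa> \<cdot> (k \<^bold>+ \<iota> i \<cdot> g') = \<kappa> \<cdot> (\<nu> n \<cdot> \<gamma>)"
      using \<gamma>1 \<gamma>2 by (intro exI[of _ "n + m"] exI[of _ "\<gamma>1 \<^bold>+ \<gamma>2"]) (simp add: add.commute)
  qed
  have unshift: "\<exists>g'\<in>G. \<exists>\<theta>. iso_arrow C (Susp C g') g \<theta>" if "g \<in> G" for g
    using G(4)[OF that] by (auto simp: isomorphic_def)
  have inj: "\<psi> = Zero C g H" if g: "g \<in> G" and \<psi>: "Dom C \<psi> = g" "Cod C \<psi> = H" "p \<cdot> \<psi> = Zero C g s" for g \<psi>
  proof -
    \<comment> \<open>The boundary of \<open>\<psi>\<close>, desuspended along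
      \<open>\<theta>\<close>, is fixed by the shift and vanishes. So \<open>\<psi>\<close> comes
      from the coproduct, hence from a single stage, and \<open>kill\<close> makes it zero one stage
      later.\<close>
    obtain g' \<theta> where g': "g' \<in> G" "iso_arrow C (Susp C g') g \<theta>" using unshift[OF g] by blast
    have \<theta>: "Dom C \<theta> = Susp C g'" "Cod C \<theta> = g" using g'(2) by (auto simp: iso_arrow_def inverse_arrows_def)
    have dd: "Dom C (\<omega> \<cdot> (\<psi> \<cdot> \<theta>)) = Susp C g'" "Cod C (\<omega> \<cdot> (\<psi> \<cdot> \<theta>)) = Susp C c" using \<theta> \<psi> D by simp_all
    obtain \<zeta> where \<zeta>: "Dom C \<zeta> = g'" "Cod C \<zeta> = c" "SuspMap C \<zeta> = \<omega> \<cdot> (\<psi> \<cdot> \<theta>)" using SuspMap_full[OF dd] .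
    have "SuspMap C (?\<Delta> \<cdot> \<zeta>) = SuspMap C ?\<Delta> \<cdot> (\<omega> \<cdot> (\<psi> \<cdot> \<theta>))" using \<zeta> \<Delta> by (simp add: SuspMap_Comp')
    also have "\<dots> = Zero C (Susp C g') (Susp C c)"
      using comp_reduce[OF tri_comp_Zero''[OF t], of "\<psi> \<cdot> \<theta>"] D \<psi>(1,2) \<theta> by simp
    also have "\<dots> = SuspMap C (Zero C g' c)" by simp
    finally have "?\<Delta> \<cdot> \<zeta> = Zero C g' c" by (rule SuspMap_inject) (use \<zeta> \<Delta> in simp_all)
    from fixed[OF G(3)[OF g'(1)] \<zeta>(1,2) this] have "\<zeta> = Zero C g' c" .
    then have \<omega>\<psi>\<theta>: "(\<omega> \<cdot> \<psi>) \<cdot> \<theta> = Zero C g (Susp C c) \<cdot> \<theta>" using \<zeta>(3) \<theta> \<psi>(1,2) D by simp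
    have "\<omega> \<cdot> \<psi> = Zero C g (Susp C c)"
      by (rule iso_arrow_epi[OF g'(2) _ _ \<omega>\<psi>\<theta>]) (use \<psi> D in simp_all)
    then have "\<omega> \<cdot> \<psi> = Zero C (Dom C \<psi>) (Susp C c)" using \<psi> by simp
    from tri_weak_kernel[OF tri_rotate[OF t] \<psi>(2) this] obtain \<xi> where
      \<xi>: "Dom C \<xi> = Dom C \<psi>" "Cod C \<xi> = c" "\<kappa> \<cdot> \<xi> = \<psi>" .
    have \<xi>g: "Dom C \<xi> = g" using \<xi> \<psi> by simp
    obtain n \<gamma> where \<gamma>: "Dom C \<gamma> = g" "Cod C \<gamma> = E n" "\<kappa> \<cdot> \<xi> = \<kappa> \<cdot> (\<nu> n \<cdot> \<gamma>)"
      using finite_stage[OF G(3)[OF g] \<xi>g \<xi>(2)] by blast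
    have \<psi>\<gamma>: "\<psi> = \<kappa> \<cdot> (\<nu> n \<cdot> \<gamma>)" using \<gamma> \<xi> by simp
    have "\<pi> n \<cdot> \<gamma> = p \<cdot> \<psi>"
      using comp_reduce[OF p\<kappa>\<nu>[of n], of \<gamma>] \<gamma>(1,2) p(1) D \<nu> \<psi>\<gamma> by simp
    then have "j n \<cdot> \<gamma> = Zero C g (E (Suc n))" using kill[of \<gamma> n] \<gamma> g \<psi>(3) by simp
    moreover have "\<psi> = \<kappa> \<cdot> (\<nu> (Suc n) \<cdot> (j n \<cdot> \<gamma>))"
      using comp_reduce[OF \<kappa>\<nu>[of n], of \<gamma>] \<gamma>(1,2) D \<nu> j \<psi>\<gamma> by simp
    ultimately show ?thesis using \<nu> D by simp
  qed
  note trL = localizing_triangulated[OF L]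
  have cL: "c \<in> L" by (rule localizing_coproduct[OF L e(2) cp]) (rule E)
  have HL: "H \<in> L" by (rule tsub_third[OF trL t cL cL])
  obtain Z b \<delta> where tz: "tri H s Z p b \<delta>" using tri_exists[OF p(1) ps] .
  note DZ = triD[OF tz]
  \<comment> \<open>A map from \<open>G\<close> to the cone of \<open>p\<close> has zero boundary,
    since \<open>p\<close> is injective on such maps. It therefore lifts to \<open>s\<close> and
    from there to stage 0; being in the image of \<open>p\<close>, it dies in the cone.\<close>
  have "is_zero C Z"
  proof (rule detect)
    fix \<phi> assume \<phi>: "Dom C \<phi> \<in> G" "Cod C \<phi> = Z"
    let ?g = "Dom C \<phi>"
    obtain g' \<theta> where g': "g' \<in> G" "iso_arrow C (Susp C g') ?g \<theta>" using unshift[OF \<phi>(1)] by blast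
    have \<theta>: "Dom C \<theta> = Susp C g'" "Cod C \<theta> = ?g" using g'(2) by (auto simp: iso_arrow_def inverse_arrows_def)
    have dd: "Dom C (\<delta> \<cdot> (\<phi> \<cdot> \<theta>)) = Susp C g'" "Cod C (\<delta> \<cdot> (\<phi> \<cdot> \<theta>)) = Susp C H" using \<theta> \<phi> DZ by simp_all
    obtain \<psi> where \<psi>: "Dom C \<psi> = g'" "Cod C \<psi> = H" "SuspMap C \<psi> = \<delta> \<cdot> (\<phi> \<cdot> \<theta>)" using SuspMap_full[OF dd] .
    have "SuspMap C (p \<cdot> \<psi>) = SuspMap C p \<cdot> (\<delta> \<cdot> (\<phi> \<cdot> \<theta>))" using \<psi> p by (simp add: SuspMap_Comp')
    also have "\<dots> = Zero C (Susp C g') (Susp C s)"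
      using comp_reduce[OF tri_comp_Zero''[OF tz], of "\<phi> \<cdot> \<theta>"] DZ \<phi> \<theta> by simp
    also have "\<dots> = SuspMap C (Zero C g' s)" by simp
    finally have "p \<cdot> \<psi> = Zero C g' s" by (rule SuspMap_inject) (use \<psi> p ps in simp_all)
    from inj[OF g'(1) \<psi>(1,2) this] have "\<psi> = Zero C g' H" .
    then have \<delta>\<phi>\<theta>: "(\<delta> \<cdot> \<phi>) \<cdot> \<theta> = Zero C ?g (Susp C H) \<cdot> \<theta>" using \<psi>(3) \<theta> \<phi> DZ by simp
    have "\<delta> \<cdot> \<phi> = Zero C ?g (Susp C H)"
      by (rule iso_arrow_epi[OF g'(2) _ _ \<delta>\<phi>\<theta>]) (use \<phi> DZ in simp_all)
    from tri_weak_kernel[OF tri_rotate[OF tz] \<phi>(2) this] obtain \<rho> where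
      \<rho>: "Dom C \<rho> = ?g" "Cod C \<rho> = s" "b \<cdot> \<rho> = \<phi>" .
    have "Dom C \<rho> \<in> G" using \<rho> \<phi> by simp
    from lift[OF this \<rho>(2)] obtain \<beta> where \<beta>: "Dom C \<beta> = Dom C \<rho>" "Cod C \<beta> = E 0" "\<pi> 0 \<cdot> \<beta> = \<rho>" by blast
    have \<beta>g: "Dom C \<beta> = ?g" using \<beta>(1) \<rho>(1) by simp
    have "p \<cdot> (\<kappa> \<cdot> (\<nu> 0 \<cdot> \<beta>)) = \<rho>"
      using comp_reduce[OF p\<kappa>\<nu>[of 0], of \<beta>] \<beta>(2,3) p(1) D \<nu> by simp
    moreover have "b \<cdot> (p \<cdot> (\<kappa> \<cdot> (\<nu> 0 \<cdot> \<beta>))) = Zero C ?g Z"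
      using comp_reduce[OF tri_comp_Zero[OF tz], of "\<kappa> \<cdot> (\<nu> 0 \<cdot> \<beta>)"] \<beta>g \<beta>(2) D \<nu> DZ by simp
    ultimately have "b \<cdot> \<rho> = Zero C ?g Z" by simp
    then show "\<phi> = Zero C ?g Z" using \<rho> by simp
  qed
  from tsub_zero[OF trL this] show ?thesis by (rule tsub_second[OF trL tz HL])
qed

text \<open>Compact generation provides a vanishing test. The homotopy colimit argument converts it
  into generation once the generators are closed under desuspension.\<close>

theorem Loc_compacts:
  assumes "compactly_generated C" shows "Loc C (compacts C) = UNIV"
proof -
  have hc: "has_small_coproducts C" using assms by (simp add: compactly_generated_def)
  obtain G where G: "G \<subseteq> compacts C" "small C G"
    "\<And>t. (\<forall>g\<in>G. \<forall>n. Hom C ((Susp C ^^ n) g) t = {Zero C ((Susp C ^^ n) g) t} \<and>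
                       Hom C g ((Susp C ^^ n) t) = {Zero C g ((Susp C ^^ n) t)}) \<Longrightarrow> is_zero C t"
    using assms unfolding compactly_generated_def by blast
  have "\<exists>D. \<forall>x. isomorphic C (Susp C (D x)) x" by (rule choice) (use Susp_surj in blast)
  then obtain D where D: "\<And>x. isomorphic C (Susp C (D x)) x" by blast
  note ct = compacts_triangulated[OF hc]
  \<comment> \<open>All suspensions and chosen desuspensions of the generators: every member is, up
    to isomorphism, the suspension of another member.\<close>
  let ?G = "(\<Union>n. (Susp C ^^ n) ` G) \<union> (\<Union>n. (D ^^ n) ` G)"
  have DG: "x \<in> compacts C \<Longrightarrow> D x \<in> compacts C" for x
    using tsub_isomorphic[OF ct _ isomorphic_sym[OF D]] tsub_Susp[OF ct] by blast
  have S1: "(Susp C ^^ n) g \<in> compacts C" if "g \<in> G" for g n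
    using G(1) that tsub_Susp[OF ct] by (induction n) auto
  have S2: "(D ^^ n) g \<in> compacts C" if "g \<in> G" for g n
    using G(1) that DG by (induction n) auto
  have Gc: "?G \<subseteq> compacts C" using S1 S2 by blast
  \<comment> \<open>The vanishing test puts negative suspensions on the second argument; this moves
    them back to maps out of iterated desuspensions.\<close>
  have vanish: "\<alpha> = Zero C x ((Susp C ^^ n) t)"
    if "\<And>\<beta>. Dom C \<beta> = (D ^^ n) x \<Longrightarrow> Cod C \<beta> = t \<Longrightarrow> \<beta> = Zero C ((D ^^ n) x) t"
      "Dom C \<alpha> = x" "Cod C \<alpha> = (Susp C ^^ n) t" for n x t \<alpha>
    using that
  proof (induction n arbitrary: x \<alpha>)
    case 0
    then show ?case by simp
  next
    case (Suc n)
    have IH: "\<alpha>' = Zero C (D x) ((Susp C ^^ n) t)" if "Dom C \<alpha>' = D x" "Cod C \<alpha>' = (Susp C ^^ n) t" for \<alpha>'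
    proof (rule Suc.IH[OF _ that])
      fix \<beta> assume "Dom C \<beta> = (D ^^ n) (D x)" "Cod C \<beta> = t"
      then show "\<beta> = Zero C ((D ^^ n) (D x)) t" using Suc.prems(1)[of \<beta>] by (simp add: funpow_swap1)
    qed
    obtain f g where f: "Dom C f = Susp C (D x)" "Cod C f = x" "Dom C g = x" "Cod C g = Susp C (D x)"
      "g \<cdot> f = Ide C (Susp C (D x))" "f \<cdot> g = Ide C x" using D by (rule isomorphicE)
    have dd: "Dom C (\<alpha> \<cdot> f) = Susp C (D x)" "Cod C (\<alpha> \<cdot> f) = Susp C ((Susp C ^^ n) t)"
      using Suc.prems f by simp_all
    obtain \<alpha>' where \<alpha>': "Dom C \<alpha>' = D x" "Cod C \<alpha>' = (Susp C ^^ n) t" "SuspMap C \<alpha>' = \<alpha> \<cdot> f"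
      using SuspMap_full[OF dd] .
    have af: "\<alpha> \<cdot> f = Zero C (Susp C (D x)) (Susp C ((Susp C ^^ n) t))"
      using IH[OF \<alpha>'(1,2)] \<alpha>'(3) by simp
    have "\<alpha> = (\<alpha> \<cdot> f) \<cdot> g" using f Suc.prems(2) by simp
    then show ?case unfolding af using f by simp
  qed
  have "s \<in> Loc C (compacts C)" for s
  proof (rule telescope[OF hc localizing_Loc, of ?G])
    show "small C ?G"
      by (intro small_Un small_UN[OF small_nat] small_image G(2))
    show "?G \<subseteq> Loc C (compacts C)" using Gc Loc_superset by blast
    show "is_compact C g" if "g \<in> ?G" for g using Gc that by (auto simp: compacts_def)
    show "\<exists>g'\<in>?G. isomorphic C (Susp C g') g" if "g \<in> ?G" for g
    proof -
      from that consider n g0 where "g = (Susp C ^^ n) g0" "g0 \<in> G" | n g0 where "g = (D ^^ n) g0" "g0 \<in> G"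
        by blast
      then show ?thesis
      proof cases
        case (1 n g0)
        show ?thesis
        proof (cases n)
          case 0
          have "(D ^^ 1) g0 \<in> ?G" using 1(2) by blast
          then show ?thesis using D 1(1) 0 by (intro bexI[of _ "(D ^^ 1) g0"]) simp_all
        next
          case (Suc m)
          have "(Susp C ^^ m) g0 \<in> ?G" using 1(2) by blast
          then show ?thesis using 1(1) Suc isomorphic_refl by (intro bexI[of _ "(Susp C ^^ m) g0"]) simp_all
        qed
      next
        case (2 n g0)
        have "(D ^^ Suc n) g0 \<in> ?G" using 2(2) by blast
        then show ?thesis using 2(1) D by (intro bexI[of _ "(D ^^ Suc n) g0"]) simp_all
      qed
    qed
    fix z assume z: "\<And>\<phi>. Dom C \<phi> \<in> ?G \<Longrightarrow> Cod C \<phi> = z \<Longrightarrow> \<phi> = Zero C (Dom C \<phi>) z"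
    show "is_zero C z"
    proof (rule G(3), intro ballI allI conjI)
      fix g n assume g: "g \<in> G"
      have Sg: "(Susp C ^^ n) g \<in> ?G" using g by blast
      show "Hom C ((Susp C ^^ n) g) z = {Zero C ((Susp C ^^ n) g) z}"
      proof (rule Hom_eq_ZeroI)
        fix \<alpha> assume \<alpha>: "Dom C \<alpha> = (Susp C ^^ n) g" "Cod C \<alpha> = z"
        then have "Dom C \<alpha> \<in> ?G" using Sg by (simp only:)
        from z[OF this \<alpha>(2)] show "\<alpha> = Zero C ((Susp C ^^ n) g) z" using \<alpha>(1) by (simp only:)
      qed
      have Dg: "(D ^^ n) g \<in> ?G" using g by blast
      have "\<alpha> = Zero C g ((Susp C ^^ n) z)" if "Dom C \<alpha> = g" "Cod C \<alpha> = (Susp C ^^ n) z" for \<alpha>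
      proof (rule vanish[OF _ that])
        fix \<beta> assume \<beta>: "Dom C \<beta> = (D ^^ n) g" "Cod C \<beta> = z"
        then have "Dom C \<beta> \<in> ?G" using Dg by (simp only:)
        from z[OF this \<beta>(2)] show "\<beta> = Zero C ((D ^^ n) g) z" using \<beta>(1) by (simp only:)
      qed
      then show "Hom C g ((Susp C ^^ n) z) = {Zero C g ((Susp C ^^ n) z)}"
        by (rule Hom_eq_ZeroI)
    qed
  qed
  then show ?thesis by blast
qed

section \<open>Compact objects in localizing subcategories\<close>

text \<open>Exactness of the twice rotated triangle factors \<open>SuspMap C k\<close> through
  \<open>SuspMap C f\<close>; desuspending gives the extension, with the sign from rotation.\<close>

lemma tri_extend:
  assumes t: "tri x y z f g h" and k: "Dom C k = x" "SuspMap C k \<cdot> h = Zero C z (Susp C (Cod C k))"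
  obtains m where "Dom C m = y" "Cod C m = Cod C k" "m \<cdot> f = k"
proof -
  note d = triD[OF t]
  have k': "Dom C (SuspMap C k) = Susp C x" "SuspMap C k \<cdot> h = Zero C z (Cod C (SuspMap C k))"
    using k by simp_all
  obtain l where l: "Dom C l = Susp C y" "Cod C l = Cod C (SuspMap C k)"
    "l \<cdot> Neg C (SuspMap C f) = SuspMap C k"
    using tri_weak_cokernel[OF tri_rotate[OF tri_rotate[OF t]] k'] .
  have lc: "Cod C l = Susp C (Cod C k)" using l(2) by simp
  obtain m where m: "Dom C m = y" "Cod C m = Cod C k" "SuspMap C m = l" using SuspMap_full[OF l(1) lc] .
  have "SuspMap C (Neg C m \<cdot> f) = SuspMap C k"
    using l(1,3) m d by (simp add: SuspMap_Comp' SuspMap_Neg Neg_Comp Comp_Neg)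
  then have "Neg C m \<cdot> f = k" by (rule SuspMap_inject) (use m d k in simp_all)
  then show ?thesis using m by (intro that[of "Neg C m"]) simp_all
qed

definition factors_through :: "'o set \<Rightarrow> 'm \<Rightarrow> bool" where
  "factors_through P \<phi> \<longleftrightarrow> (\<exists>\<alpha> \<beta>. Dom C \<alpha> = Dom C \<phi> \<and> Cod C \<alpha> = Dom C \<beta> \<and> Cod C \<beta> = Cod C \<phi> \<and>
     \<beta> \<cdot> \<alpha> = \<phi> \<and> Cod C \<alpha> \<in> P)"

lemma factors_throughI:
  "Dom C \<alpha> = Dom C \<phi> \<Longrightarrow> Cod C \<alpha> = b \<Longrightarrow> Dom C \<beta> = b \<Longrightarrow> Cod C \<beta> = Cod C \<phi> \<Longrightarrow> \<beta> \<cdot> \<alpha> = \<phi> \<Longrightarrow> b \<in> P \<Longrightarrow>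
    factors_through P \<phi>"
  unfolding factors_through_def by (intro exI[of _ \<alpha>] exI[of _ \<beta>]) simp

lemma factors_throughE:
  assumes "factors_through P \<phi>"
  obtains \<alpha> \<beta> b where "Dom C \<alpha> = Dom C \<phi>" "Cod C \<alpha> = b" "Dom C \<beta> = b" "Cod C \<beta> = Cod C \<phi>"
    "\<beta> \<cdot> \<alpha> = \<phi>" "b \<in> P"
  using assms unfolding factors_through_def by (elim exE conjE) simp

lemma factors_through_Comp:
  assumes "factors_through P \<phi>" "Dom C f = Cod C \<phi>" "Cod C g = Dom C \<phi>"
  shows "factors_through P (f \<cdot> (\<phi> \<cdot> g))"
proof -
  obtain \<alpha> \<beta> b where *: "Dom C \<alpha> = Dom C \<phi>" "Cod C \<alpha> = b" "Dom C \<beta> = b" "Cod C \<beta> = Cod C \<phi>"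
    "\<beta> \<cdot> \<alpha> = \<phi>" "b \<in> P" using assms(1) by (rule factors_throughE)
  show ?thesis
    by (rule factors_throughI[of "\<alpha> \<cdot> g" _ b "f \<cdot> \<beta>"])
       (use * assms(2,3) comp_reduce[OF *(5), of g] in simp_all)
qed

text \<open>The two factorisations are combined through the biproduct of their middle
  objects.\<close>

lemma factors_through_Add:
  assumes P: "triangulated_subcategory C P" and f: "factors_through P f" "factors_through P g"
    and d: "Dom C f = Dom C g" "Cod C f = Cod C g"
  shows "factors_through P (f \<^bold>+ g)"
proof -
  obtain \<alpha> \<beta> b where f1: "Dom C \<alpha> = Dom C f" "Cod C \<alpha> = b" "Dom C \<beta> = b" "Cod C \<beta> = Cod C f"
    "\<beta> \<cdot> \<alpha> = f" "b \<in> P" using f(1) by (rule factors_throughE)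
  obtain \<alpha>' \<beta>' b' where g1: "Dom C \<alpha>' = Dom C g" "Cod C \<alpha>' = b'" "Dom C \<beta>' = b'" "Cod C \<beta>' = Cod C g"
    "\<beta>' \<cdot> \<alpha>' = g" "b' \<in> P" using f(2) by (rule factors_throughE)
  obtain s where s: "is_biproduct C s b b'" using ex_biproduct by blast
  then obtain i j p q where b: "Dom C i = b" "Cod C i = s" "Dom C j = b'" "Cod C j = s"
      "Dom C p = s" "Cod C p = b" "Dom C q = s" "Cod C q = b'"
      "p \<cdot> i = Ide C b" "q \<cdot> j = Ide C b'" "p \<cdot> j = Zero C b' b" "q \<cdot> i = Zero C b b'"
    unfolding is_biproduct_def by auto
  have 1: "(\<beta> \<cdot> p \<^bold>+ \<beta>' \<cdot> q) \<cdot> (i \<cdot> \<alpha>) = f"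
    using b f1 g1 d comp_reduce[OF b(9), of \<alpha>] comp_reduce[OF b(12), of \<alpha>]
    by (simp add: Add_Comp')
  have 2: "(\<beta> \<cdot> p \<^bold>+ \<beta>' \<cdot> q) \<cdot> (j \<cdot> \<alpha>') = g"
    using b f1 g1 d comp_reduce[OF b(10), of \<alpha>'] comp_reduce[OF b(11), of \<alpha>']
    by (simp add: Add_Comp')
  show ?thesis
  proof (rule factors_throughI[of "i \<cdot> \<alpha> \<^bold>+ j \<cdot> \<alpha>'" _ s "\<beta> \<cdot> p \<^bold>+ \<beta>' \<cdot> q"])
    have "(\<beta> \<cdot> p \<^bold>+ \<beta>' \<cdot> q) \<cdot> (i \<cdot> \<alpha> \<^bold>+ j \<cdot> \<alpha>') =
       (\<beta> \<cdot> p \<^bold>+ \<beta>' \<cdot> q) \<cdot> (i \<cdot> \<alpha>) \<^bold>+ (\<beta> \<cdot> p \<^bold>+ \<beta>' \<cdot> q) \<cdot> (j \<cdot> \<alpha>')"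
      using b f1(1-4) g1(1-4) d by (intro Comp_Add') simp_all
    then show "(\<beta> \<cdot> p \<^bold>+ \<beta>' \<cdot> q) \<cdot> (i \<cdot> \<alpha> \<^bold>+ j \<cdot> \<alpha>') = f \<^bold>+ g" unfolding 1 2 .
    show "s \<in> P" by (rule tsub_biproduct[OF P s f1(6) g1(6)])
  qed (use b f1(1-4) g1(1-4) d in simp_all)
qed

definition compactly_approximated :: "'o set \<Rightarrow> 'o set" where
  "compactly_approximated P = {t. \<forall>\<phi>. is_compact C (Dom C \<phi>) \<longrightarrow> Cod C \<phi> = t \<longrightarrow> factors_through P \<phi>}"

text \<open>\<open>h \<cdot> k\<close> lands in \<open>Susp C x\<close>, hence the form of the
  hypothesis. Its factorisation through \<open>b\<close> leaves the restriction of \<open>k\<close>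
  to the fibre \<open>c'\<close>, which lifts to \<open>y\<close> and factors through
  \<open>b'\<close>. Both factorisations are then glued to one through a single object of
  \<open>P\<close>.\<close>

lemma compactly_approximated_cone:
  assumes hc: "has_small_coproducts C" and P: "triangulated_subcategory C P" "P \<subseteq> compacts C"
    and t: "tri x y z f g h"
    and x: "Susp C x \<in> compactly_approximated P" and y: "y \<in> compactly_approximated P"
  shows "z \<in> compactly_approximated P"
  unfolding compactly_approximated_def
proof (intro CollectI allI impI)
  fix k assume k: "is_compact C (Dom C k)" "Cod C k = z"
  let ?c = "Dom C k"
  note d = triD[OF t]
  note ct = compacts_triangulated[OF hc]
  have "factors_through P (h \<cdot> k)" using x k d unfolding compactly_approximated_def by simp
  then obtain \<alpha> \<beta> b where \<alpha>: "Dom C \<alpha> = ?c" "Cod C \<alpha> = b" "Dom C \<beta> = b" "Cod C \<beta> = Susp C x"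
    "\<beta> \<cdot> \<alpha> = h \<cdot> k" "b \<in> P" by (rule factors_throughE) (use k d in simp)
  obtain c' i w where t1: "tri c' ?c b i \<alpha> w" using tri_fibre[OF \<alpha>(1,2)] .
  note d1 = triD[OF t1]
  have "c' \<in> compacts C" by (rule tsub_first[OF ct t1]) (use k \<alpha>(6) P(2) in \<open>auto simp: compacts_def\<close>)
  then have c': "is_compact C c'" by (simp add: compacts_def)
  have "h \<cdot> (k \<cdot> i) = (h \<cdot> k) \<cdot> i" using d k d1 by simp
  also have "\<dots> = \<beta> \<cdot> (\<alpha> \<cdot> i)" unfolding \<alpha>(5)[symmetric] using \<alpha>(1-4) d1 by simp
  also have "\<dots> = Zero C c' (Susp C x)" using tri_comp_Zero[OF t1] \<alpha> by simp
  finally have "h \<cdot> (k \<cdot> i) = Zero C (Dom C (k \<cdot> i)) (Susp C x)" using d1 by simp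
  moreover have "Cod C (k \<cdot> i) = z" using d1 k by simp
  ultimately obtain l where l: "Dom C l = Dom C (k \<cdot> i)" "Cod C l = y" "g \<cdot> l = k \<cdot> i"
    using tri_weak_kernel[OF tri_rotate[OF t], of "k \<cdot> i"] by blast
  have lc: "Dom C l = c'" using l(1) d1 k by simp
  have "is_compact C (Dom C l)" using lc c' by simp
  then have "factors_through P l" using y l(2) unfolding compactly_approximated_def by blast
  then obtain j q0 b' where j: "Dom C j = c'" "Cod C j = b'" "Dom C q0 = b'" "Cod C q0 = y"
    "q0 \<cdot> j = l" "b' \<in> P" by (rule factors_throughE) (use lc l(2) in simp)
  obtain v f0 f2 where tv: "tri v c' ?c f0 i f2" using tri_fibre[of i c' ?c] d1 by blast
  note dv = triD[OF tv]
  \<comment> \<open>\<open>v\<close> is a desuspension of \<open>b\<close> up to isomorphism; the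
    octahedron on an identity composed with \<open>i\<close> compares the two cones without naming
    the isomorphism.\<close>
  have vP: "v \<in> P"
  proof -
    obtain o' where o': "is_zero C o'" using ex_zero by blast
    have ti: "tri c' ?c (Susp C v) (i \<cdot> Ide C c') f2 (Neg C (SuspMap C f0))"
      using tri_rotate[OF tv] d1 by simp
    obtain u u' w' where tu: "tri o' (Susp C v) b u u' w'"
      by (rule tri_octahedral[OF tri_Ide[OF o'] t1 ti]) (rule that)
    have "Susp C v \<in> P" by (rule tsub_second[OF P(1) tu tsub_zero[OF P(1) o'] \<alpha>(6)])
    then show ?thesis using tsub_Susp[OF P(1)] by blast
  qed
  obtain wc g1 g2 where tj: "tri c' b' wc j g1 g2" using tri_exists[OF j(1,2)] .
  note dj = triD[OF tj]
  have jf: "Dom C (j \<cdot> f0) = v" "Cod C (j \<cdot> f0) = b'" using j dv by simp_all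
  \<comment> \<open>\<open>d0\<close> is the homotopy pushout of \<open>i\<close> and
    \<open>j\<close>, and the cone of a map between members of \<open>P\<close>. Since
    \<open>k \<cdot> i\<close> factors through \<open>j\<close>, the map \<open>k\<close> extends
    along \<open>u\<close> from \<open>?c\<close> to \<open>d0\<close>.\<close>
  obtain d0 h1 h2 where td: "tri v b' d0 (j \<cdot> f0) h1 h2" using tri_exists[OF jf] .
  note dd = triD[OF td]
  have dP: "d0 \<in> P" by (rule tsub_third[OF P(1) td vP j(6)])
  obtain u u' where u: "tri ?c d0 wc u u' (SuspMap C i \<cdot> g2)" "u \<cdot> i = h1 \<cdot> j"
    by (rule tri_octahedral[OF tv tj td]) (rule that)
  note du = triD[OF u(1)]
  have kz: "SuspMap C k \<cdot> (SuspMap C i \<cdot> g2) = Zero C wc (Susp C (Cod C k))"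
  proof -
    have ki: "k \<cdot> i = (g \<cdot> q0) \<cdot> j" using l(3) j(1-5) d by simp
    have "SuspMap C k \<cdot> (SuspMap C i \<cdot> g2) = SuspMap C (k \<cdot> i) \<cdot> g2"
      using k d1 dj by (simp add: SuspMap_Comp')
    also have "\<dots> = SuspMap C (g \<cdot> q0) \<cdot> (SuspMap C j \<cdot> g2)"
      unfolding ki using j(1-4) d dj by (simp add: SuspMap_Comp')
    also have "\<dots> = Zero C wc (Susp C z)" unfolding tri_comp_Zero''[OF tj] using j d by simp
    finally show ?thesis using k by simp
  qed
  obtain m where m: "Dom C m = d0" "Cod C m = Cod C k" "m \<cdot> u = k" using tri_extend[OF u(1) refl kz] .
  show "factors_through P k" by (rule factors_throughI[OF _ _ m(1,2,3) dP]) (use du in simp_all)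
qed

lemma compactly_approximated_localizing:
  assumes hc: "has_small_coproducts C" and P: "triangulated_subcategory C P" "P \<subseteq> compacts C"
  shows "localizing_subcategory C (compactly_approximated P)"
proof -
  let ?N = "compactly_approximated P"
  note ct = compacts_triangulated[OF hc]
  have N: "factors_through P \<phi>" if "t \<in> ?N" "is_compact C (Dom C \<phi>)" "Cod C \<phi> = t" for t \<phi>
    using that unfolding compactly_approximated_def by blast
  have NI: "t \<in> ?N" if "\<And>\<phi>. is_compact C (Dom C \<phi>) \<Longrightarrow> Cod C \<phi> = t \<Longrightarrow> factors_through P \<phi>" for t
    using that unfolding compactly_approximated_def by blast
  have zero: "factors_through P (Zero C x y)" for x y
  proof -
    obtain z where z: "is_zero C z" using ex_zero by blast
    show ?thesis
      by (rule factors_throughI[of "Zero C x z" _ z "Zero C z y"]) (use tsub_zero[OF P(1) z] in simp_all)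
  qed
  have iso: "y \<in> ?N" if x: "x \<in> ?N" and xy: "isomorphic C x y" for x y
  proof (rule NI)
    fix \<phi> assume \<phi>: "is_compact C (Dom C \<phi>)" "Cod C \<phi> = y"
    obtain f g where f: "Dom C f = x" "Cod C f = y" "Dom C g = y" "Cod C g = x"
      "g \<cdot> f = Ide C x" "f \<cdot> g = Ide C y" using xy by (rule isomorphicE)
    have "factors_through P (g \<cdot> \<phi>)" by (rule N[OF x]) (use f \<phi> in simp_all)
    then have "factors_through P (f \<cdot> ((g \<cdot> \<phi>) \<cdot> Ide C (Dom C \<phi>)))"
      by (rule factors_through_Comp) (use f \<phi> in simp_all)
    then show "factors_through P \<phi>" using f \<phi> comp_reduce[OF f(6), of \<phi>] by simp
  qed
  have susp: "Susp C t \<in> ?N" if t: "t \<in> ?N" for t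
  proof (rule NI)
    fix \<phi> assume \<phi>: "is_compact C (Dom C \<phi>)" "Cod C \<phi> = Susp C t"
    let ?c = "Dom C \<phi>"
    obtain c0 f g where f: "Dom C f = Susp C c0" "Cod C f = ?c" "Dom C g = ?c" "Cod C g = Susp C c0"
      "g \<cdot> f = Ide C (Susp C c0)" "f \<cdot> g = Ide C ?c" by (rule desuspension)
    have "is_compact C (Susp C c0)" by (rule compact_retract[OF \<phi>(1) f(1-3,5)])
    then have c0: "is_compact C c0" by (rule compact_Susp_cancel)
    have df: "Dom C (\<phi> \<cdot> f) = Susp C c0" "Cod C (\<phi> \<cdot> f) = Susp C t" using f \<phi> by simp_all
    obtain \<phi>0 where \<phi>0: "Dom C \<phi>0 = c0" "Cod C \<phi>0 = t" "SuspMap C \<phi>0 = \<phi> \<cdot> f" using SuspMap_full[OF df] .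
    have "factors_through P \<phi>0" by (rule N[OF t]) (use \<phi>0 c0 in simp_all)
    then obtain \<alpha> \<beta> b where a: "Dom C \<alpha> = c0" "Cod C \<alpha> = b" "Dom C \<beta> = b" "Cod C \<beta> = t" "\<beta> \<cdot> \<alpha> = \<phi>0" "b \<in> P"
      by (rule factors_throughE) (use \<phi>0 in simp)
    have "SuspMap C \<beta> \<cdot> SuspMap C \<alpha> = \<phi> \<cdot> f" using a \<phi>0(3) by (simp flip: SuspMap_Comp')
    from comp_reduce[OF this, of g] have "SuspMap C \<beta> \<cdot> (SuspMap C \<alpha> \<cdot> g) = \<phi>" using a(1-4) f \<phi> by simp
    then show "factors_through P \<phi>"
      by (intro factors_throughI[of "SuspMap C \<alpha> \<cdot> g" _ "Susp C b" "SuspMap C \<beta>"])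
         (use a(1-4,6) f \<phi> tsub_Susp[OF P(1)] in simp_all)
  qed
  have desusp: "t \<in> ?N" if t: "Susp C t \<in> ?N" for t
  proof (rule NI)
    fix \<phi> assume \<phi>: "is_compact C (Dom C \<phi>)" "Cod C \<phi> = t"
    have "factors_through P (SuspMap C \<phi>)"
      by (rule N[OF t]) (use \<phi> compact_Susp[OF hc] in simp_all)
    then obtain \<alpha> \<beta> b where a: "Dom C \<alpha> = Susp C (Dom C \<phi>)" "Cod C \<alpha> = b" "Dom C \<beta> = b" "Cod C \<beta> = Susp C t"
      "\<beta> \<cdot> \<alpha> = SuspMap C \<phi>" "b \<in> P"
      by (rule factors_throughE) (use \<phi> in simp)
    obtain b0 f g where f: "Dom C f = Susp C b0" "Cod C f = b" "Dom C g = b" "Cod C g = Susp C b0"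
      "g \<cdot> f = Ide C (Susp C b0)" "f \<cdot> g = Ide C b" by (rule desuspension)
    have "isomorphic C b (Susp C b0)"
      unfolding isomorphic_def using iso_arrowI[OF f(3,4,1,2,6,5)] by blast
    then have b0: "b0 \<in> P" using tsub_isomorphic[OF P(1) a(6)] tsub_Susp[OF P(1)] by blast
    have da: "Dom C (g \<cdot> \<alpha>) = Susp C (Dom C \<phi>)" "Cod C (g \<cdot> \<alpha>) = Susp C b0" using f a by simp_all
    obtain \<alpha>0 where \<alpha>0: "Dom C \<alpha>0 = Dom C \<phi>" "Cod C \<alpha>0 = b0" "SuspMap C \<alpha>0 = g \<cdot> \<alpha>" using SuspMap_full[OF da] .
    have db: "Dom C (\<beta> \<cdot> f) = Susp C b0" "Cod C (\<beta> \<cdot> f) = Susp C t" using f a by simp_all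
    obtain \<beta>0 where \<beta>0: "Dom C \<beta>0 = b0" "Cod C \<beta>0 = t" "SuspMap C \<beta>0 = \<beta> \<cdot> f" using SuspMap_full[OF db] .
    have "SuspMap C (\<beta>0 \<cdot> \<alpha>0) = (\<beta> \<cdot> f) \<cdot> (g \<cdot> \<alpha>)" using \<alpha>0 \<beta>0 by (simp add: SuspMap_Comp')
    also have "\<dots> = SuspMap C \<phi>" using f a comp_reduce[OF f(6), of \<alpha>] by simp
    finally have "\<beta>0 \<cdot> \<alpha>0 = \<phi>" by (rule SuspMap_inject) (use \<alpha>0 \<beta>0 \<phi> in simp_all)
    then show "factors_through P \<phi>"
      by (intro factors_throughI[OF \<alpha>0(1,2) \<beta>0(1)]) (use \<beta>0 \<phi> b0 in simp_all)
  qed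
  have cop: "c \<in> ?N" if I: "small C (I :: 'u set)" and cp: "is_coproduct C I t c \<iota>"
    and t: "\<And>i. i \<in> I \<Longrightarrow> t i \<in> ?N" for I t c \<iota>
  proof (rule NI)
    fix \<phi> assume \<phi>: "is_compact C (Dom C \<phi>)" "Cod C \<phi> = c"
    \<comment> \<open>Compactness makes \<open>\<phi>\<close> a finite sum of maps through single
      summands, and sums of maps factoring through \<open>P\<close> again factor through
      \<open>P\<close>.\<close>
    show "factors_through P \<phi>"
    proof (rule compact_induct[OF \<phi>(1) I cp refl \<phi>(2)])
      show "factors_through P (Zero C (Dom C \<phi>) c)" by (rule zero)
      fix k i g assume i: "i \<in> I" and k: "Dom C k = Dom C \<phi>" "Cod C k = c"
        and g: "Dom C g = Dom C \<phi>" "Cod C g = t i" and fk: "factors_through P k"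
      have "factors_through P g" by (rule N[OF t[OF i]]) (use g \<phi> in simp_all)
      then have "factors_through P (\<iota> i \<cdot> (g \<cdot> Ide C (Dom C \<phi>)))"
        by (rule factors_through_Comp) (use g coproduct_inj[OF cp i] in simp_all)
      then have "factors_through P (\<iota> i \<cdot> g)" using g by simp
      then show "factors_through P (k \<^bold>+ \<iota> i \<cdot> g)"
        by (rule factors_through_Add[OF P(1) fk]) (use k g coproduct_inj[OF cp i] in simp_all)
    qed
  qed
  show ?thesis unfolding localizing_subcategory_def
  proof (intro conjI)
    show "triangulated_subcategory C ?N"
    proof (rule triangulated_subcategoryI)
      show "x \<in> ?N" if "is_zero C x" for x
      proof (rule NI)
        fix \<phi> assume "Cod C \<phi> = x"
        then have "\<phi> = Zero C (Dom C \<phi>) x" using is_zero_to[OF that] by simp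
        then show "factors_through P \<phi>" using zero by metis
      qed
      show "Susp C x \<in> ?N \<longleftrightarrow> x \<in> ?N" for x using susp desusp by blast
      show "z \<in> ?N" if "tri x y z f g h" "x \<in> ?N" "y \<in> ?N" for x y z f g h
        by (rule compactly_approximated_cone[OF hc P that(1) susp[OF that(2)] that(3)])
    qed (fact iso)
    show "\<forall>(I :: 'u set) t c \<iota>. small C I \<and> is_coproduct C I t c \<iota> \<and> (\<forall>i\<in>I. t i \<in> ?N) \<longrightarrow> c \<in> ?N"
      using cop by blast
  qed
qed

text \<open>Applied to the identity of \<open>a\<close>, the factorisation makes \<open>a\<close> a
  retract of a member of \<open>P\<close>; in a triangulated category a retract is a biproduct
  summand.\<close>

lemma compact_in_Loc:
  assumes hc: "has_small_coproducts C" and P: "triangulated_subcategory C P" "P \<subseteq> compacts C"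
    and thick: "\<And>s x y. s \<in> P \<Longrightarrow> is_biproduct C s x y \<Longrightarrow> x \<in> P"
    and a: "is_compact C a" "a \<in> Loc C P"
  shows "a \<in> P"
proof -
  have "P \<subseteq> compactly_approximated P"
  proof
    fix b assume b: "b \<in> P"
    have "factors_through P \<phi>" if "Cod C \<phi> = b" for \<phi>
      by (rule factors_throughI[of \<phi> _ b "Ide C b"]) (use b that in simp_all)
    then show "b \<in> compactly_approximated P" unfolding compactly_approximated_def by blast
  qed
  then have "a \<in> compactly_approximated P"
    using Loc_minimal[OF compactly_approximated_localizing[OF hc P]] a(2) by blast
  then have "factors_through P (Ide C a)" unfolding compactly_approximated_def using a(1) by simp
  then obtain \<alpha> \<beta> b where *: "Dom C \<alpha> = a" "Cod C \<alpha> = b" "Dom C \<beta> = b" "Cod C \<beta> = a" "\<beta> \<cdot> \<alpha> = Ide C a" "b \<in> P"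
    by (rule factors_throughE) simp
  then obtain d g h where "is_biproduct C b a d" using split_mono_biproduct[OF *(1-3,5,4)] by blast
  then show ?thesis using thick[OF *(6)] by blast
qed

end

section \<open>Ideals generated by compact objects\<close>

context rigidly_compactly_generated_tt_category
begin

lemma has_coproducts: "has_small_coproducts T"
  using compactly_generated by (simp add: compactly_generated_def)

lemma compacts_tensor: "x \<in> compacts T \<Longrightarrow> y \<in> compacts T \<Longrightarrow> x \<boxtimes> y \<in> compacts T"
  using compact_tensor_rigid compact_iff_rigid by (simp add: compacts_def)

text \<open>Generation is used twice: first \<open>x\<close> runs through \<open>Loc T P\<close>
  with a compact second factor; then \<open>x\<close> is fixed and the other factor runs from the
  compacts to all objects by \<open>Loc_compacts\<close>.\<close>

lemma Loc_ideal:
  assumes "\<And>x c. x \<in> P \<Longrightarrow> c \<in> compacts T \<Longrightarrow> x \<boxtimes> c \<in> Loc T P"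
  shows "localizing_ideal T (Loc T P)"
  unfolding localizing_ideal_def
proof (intro conjI ballI allI)
  show L: "localizing_subcategory T (Loc T P)" by (rule localizing_Loc)
  have 1: "x \<boxtimes> c \<in> Loc T P" if "x \<in> Loc T P" "c \<in> compacts T" for x c
    using Loc_minimal[OF localizing_tensor_preimage[OF L], of P c] assms[OF _ that(2)] that(1) by blast
  fix x y assume x: "x \<in> Loc T P"
  have "compacts T \<subseteq> {s. s \<boxtimes> x \<in> Loc T P}"
    using tsub_isomorphic[OF localizing_triangulated[OF L] 1[OF x] isomorphic_Braid] by blast
  then have "y \<boxtimes> x \<in> Loc T P"
    using Loc_minimal[OF localizing_tensor_preimage[OF L], of "compacts T" x]
      Loc_compacts[OF compactly_generated] by blast
  then show "x \<boxtimes> y \<in> Loc T P"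
    using tsub_isomorphic[OF localizing_triangulated[OF L] _ isomorphic_Braid] by blast
qed

text \<open>The classification concerns \<open>Loc_tensor\<close>, whereas the factorisation
  argument and the idempotent triangles concern \<open>Loc\<close>; this is the bridge.\<close>

lemma Loc_tensor_eq_Loc:
  assumes "\<And>x c. x \<in> P \<Longrightarrow> c \<in> compacts T \<Longrightarrow> x \<boxtimes> c \<in> P"
  shows "Loc_tensor T P = Loc T P"
proof
  have "localizing_ideal T (Loc T P)" by (rule Loc_ideal) (use assms Loc_superset in blast)
  then show "Loc_tensor T P \<subseteq> Loc T P" by (rule Loc_tensor_minimal) (rule Loc_superset)
  show "Loc T P \<subseteq> Loc_tensor T P"
    by (rule Loc_minimal[OF ideal_localizing[OF localizing_ideal_Loc_tensor] Loc_tensor_superset])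
qed

lemma thick_ideal_tensor: "thick_ideal T P \<Longrightarrow> x \<in> P \<Longrightarrow> c \<in> compacts T \<Longrightarrow> x \<boxtimes> c \<in> P"
  by (simp add: thick_ideal_def)

lemma compact_in_Loc_tensor:
  assumes P: "thick_ideal T P" and a: "a \<in> compacts T" "a \<in> Loc_tensor T P"
  shows "a \<in> P"
proof (rule compact_in_Loc[OF has_coproducts])
  show "triangulated_subcategory T P" "P \<subseteq> compacts T" using P by (simp_all add: thick_ideal_def)
  show "x \<in> P" if "s \<in> P" "is_biproduct T s x y" for s x y
    using P that unfolding thick_ideal_def by blast
  show "is_compact T a" using a by (simp add: compacts_def)
  show "a \<in> Loc T P" using a(2) Loc_tensor_eq_Loc[OF thick_ideal_tensor[OF P]] by blast
qed

end

section \<open>Spectral spaces\<close>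

text \<open>Intersecting with \<open>topspace X\<close> makes the empty family yield the whole
  space, which is quasi-compact.\<close>

lemma spectral_finite_Inter:
  assumes X: "spectral_space X" and F: "finite F" "\<And>U. U \<in> F \<Longrightarrow> openin X U \<and> compactin X U"
  shows "openin X (topspace X \<inter> \<Inter>F) \<and> compactin X (topspace X \<inter> \<Inter>F)"
  using F
proof (induction F rule: finite_induct)
  case empty
  then show ?case using X by (simp add: spectral_space_def compact_space_def)
next
  case (insert U F)
  have "\<forall>U V. openin X U \<and> compactin X U \<and> openin X V \<and> compactin X V \<longrightarrow> compactin X (U \<inter> V)"
    using X by (simp add: spectral_space_def)
  then have "compactin X (U \<inter> (topspace X \<inter> \<Inter>F))" using insert by blast
  moreover have "openin X (U \<inter> (topspace X \<inter> \<Inter>F))" using insert by blast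
  moreover have "topspace X \<inter> \<Inter>(insert U F) = U \<inter> (topspace X \<inter> \<Inter>F)" by blast
  ultimately show ?case by simp
qed

text \<open>A minimal closed subset of \<open>Z\<close> meeting all finite intersections of members of \<open>\<U>\<close> is
  irreducible, and its generic point lies in every member.\<close>

lemma spectral_closed_meets_Inter:
  assumes X: "spectral_space X" and Z: "closedin X Z"
    and \<U>: "\<And>U. U \<in> \<U> \<Longrightarrow> openin X U \<and> compactin X U"
    and fip: "\<And>F. finite F \<Longrightarrow> F \<subseteq> \<U> \<Longrightarrow> Z \<inter> \<Inter>F \<noteq> {}"
  obtains x where "x \<in> Z" "\<And>U. U \<in> \<U> \<Longrightarrow> x \<in> U"
proof -
  \<comment> \<open>Complements of the closed subsets of \<open>Z\<close> meeting every finite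
    intersection from \<open>\<U>\<close>; passing to complements turns the minimal closed set into
    a maximal element for Zorn's lemma.\<close>
  define \<A> where "\<A> = {W. openin X W \<and> topspace X - Z \<subseteq> W \<and> (\<forall>F. finite F \<longrightarrow> F \<subseteq> \<U> \<longrightarrow> \<not> topspace X \<inter> \<Inter>F \<subseteq> W)}"
  have Zt: "Z \<subseteq> topspace X" using closedin_subset[OF Z] .
  have qc: "compactin X (topspace X \<inter> \<Inter>F)" if "finite F" "F \<subseteq> \<U>" for F
    using spectral_finite_Inter[OF X that(1)] \<U> that(2) by blast
  have "topspace X - Z \<in> \<A>"
  proof -
    have "\<not> topspace X \<inter> \<Inter>F \<subseteq> topspace X - Z" if "finite F" "F \<subseteq> \<U>" for F
      using fip[OF that] Zt by blast
    then show ?thesis using Z by (simp add: \<A>_def closedin_def)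
  qed
  moreover have "\<Union>\<C> \<in> \<A>" if \<C>: "\<C> \<noteq> {}" "subset.chain \<A> \<C>" for \<C>
  proof -
    have CA: "\<C> \<subseteq> \<A>" using \<C>(2) by (simp add: subset.chain_def)
    \<comment> \<open>Finite intersections are quasi-compact, so a cover by the chain has a finite
      subcover, whose union is a member of the chain.\<close>
    have "\<not> topspace X \<inter> \<Inter>F \<subseteq> \<Union>\<C>" if F: "finite F" "F \<subseteq> \<U>" for F
    proof
      assume "topspace X \<inter> \<Inter>F \<subseteq> \<Union>\<C>"
      moreover have "\<And>U. U \<in> \<C> \<Longrightarrow> openin X U" using CA unfolding \<A>_def by blast
      ultimately obtain \<F> where \<F>: "finite \<F>" "\<F> \<subseteq> \<C>" "topspace X \<inter> \<Inter>F \<subseteq> \<Union>\<F>"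
        using compactinD[OF qc[OF F], of \<C>] by blast
      show False
      proof (cases "\<F> = {}")
        case True
        obtain W where "W \<in> \<A>" using \<C>(1) CA by blast
        then have "\<not> topspace X \<inter> \<Inter>F \<subseteq> W" using F unfolding \<A>_def by blast
        then show False using \<F>(3) True by blast
      next
        case False
        have "subset.chain \<A> \<F>" using \<C>(2) \<F>(2) unfolding subset.chain_def by blast
        then have "\<Union>\<F> \<in> \<A>" using Union_in_chain[OF \<F>(1) False] \<F>(2) CA by blast
        then show False using \<F>(3) F by (simp add: \<A>_def)
      qed
    qed
    moreover have "openin X (\<Union>\<C>)" by (rule openin_Union) (use CA in \<open>unfold \<A>_def, blast\<close>)
    moreover have "topspace X - Z \<subseteq> \<Union>\<C>" using CA \<C>(1) unfolding \<A>_def by blast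
    ultimately show ?thesis by (simp add: \<A>_def)
  qed
  ultimately obtain W where W: "W \<in> \<A>" and max: "\<And>V. V \<in> \<A> \<Longrightarrow> W \<subseteq> V \<Longrightarrow> V = W"
    using subset_Zorn_nonempty[of \<A>] by blast
  have W1: "openin X W" "topspace X - Z \<subseteq> W" "\<And>F. finite F \<Longrightarrow> F \<subseteq> \<U> \<Longrightarrow> \<not> topspace X \<inter> \<Inter>F \<subseteq> W"
    using W by (auto simp: \<A>_def)
  let ?C = "topspace X - W"
  \<comment> \<open>Maximality: enlarging \<open>W\<close> by the complement of \<open>A\<close>
    must violate the condition for some finite \<open>F\<close>.\<close>
  have covered: "\<exists>F. finite F \<and> F \<subseteq> \<U> \<and> topspace X \<inter> \<Inter>F \<subseteq> W \<union> (topspace X - A)"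
    if "closedin X A" "\<not> ?C \<subseteq> A" for A
  proof (rule ccontr)
    assume *: "\<not> ?thesis"
    have "openin X (W \<union> (topspace X - A))" using W1(1) that(1) by blast
    then have "W \<union> (topspace X - A) \<in> \<A>" using * W1(2) by (auto simp: \<A>_def)
    then have "W \<union> (topspace X - A) = W" by (rule max) blast
    then show False using that(2) by blast
  qed
  have irr: "irreducible_closed X ?C" unfolding irreducible_closed_def
  proof (intro conjI allI impI)
    show "closedin X ?C" using W1(1) by blast
    show "?C \<noteq> {}" using W1(3)[of "{}"] by auto
    fix A B assume AB: "closedin X A \<and> closedin X B \<and> ?C \<subseteq> A \<union> B"
    show "?C \<subseteq> A \<or> ?C \<subseteq> B"
    proof (rule ccontr)
      assume n: "\<not> (?C \<subseteq> A \<or> ?C \<subseteq> B)"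
      obtain F1 where F1: "finite F1" "F1 \<subseteq> \<U>" "topspace X \<inter> \<Inter>F1 \<subseteq> W \<union> (topspace X - A)"
        using covered[of A] AB n by blast
      obtain F2 where F2: "finite F2" "F2 \<subseteq> \<U>" "topspace X \<inter> \<Inter>F2 \<subseteq> W \<union> (topspace X - B)"
        using covered[of B] AB n by blast
      have "topspace X \<inter> \<Inter>(F1 \<union> F2) \<subseteq> W" using F1(3) F2(3) AB by blast
      then show False using W1(3)[of "F1 \<union> F2"] F1 F2 by simp
    qed
  qed
  have "\<forall>Z. irreducible_closed X Z \<longrightarrow> (\<exists>x\<in>topspace X. X closure_of {x} = Z)"
    using X by (simp add: spectral_space_def)
  from this[rule_format, OF irr] obtain x where x: "x \<in> topspace X" "X closure_of {x} = ?C" by (rule bexE)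
  have xC: "x \<in> ?C" using x closure_of_subset[of "{x}" X] by auto
  show ?thesis
  proof (rule that)
    show "x \<in> Z" using xC W1(2) by blast
    fix U assume U: "U \<in> \<U>"
    \<comment> \<open>The irreducible set meets \<open>U\<close> in a point \<open>y\<close> of the
      closure of \<open>x\<close>; an open set containing \<open>y\<close> contains
      \<open>x\<close>.\<close>
    obtain y where y: "y \<in> topspace X" "y \<in> U" "y \<notin> W" using W1(3)[of "{U}"] U by auto
    then have "y \<in> X closure_of {x}" using x by simp
    then show "x \<in> U" using y \<U>[OF U] by (auto simp: in_closure_of)
  qed
qed

text \<open>An instance of quasi-compactness of the constructible topology. The members of
  \<open>\<K>\<close> merge into one closed set, which still meets finite intersections from
  \<open>\<U>\<close> because those are quasi-compact.\<close>

lemma spectral_fip: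
  assumes X: "spectral_space X" and K: "\<And>K. K \<in> \<K> \<Longrightarrow> closedin X K"
    and \<U>: "\<And>U. U \<in> \<U> \<Longrightarrow> openin X U \<and> compactin X U"
    and fip: "\<And>G F. finite G \<Longrightarrow> G \<subseteq> \<K> \<Longrightarrow> finite F \<Longrightarrow> F \<subseteq> \<U> \<Longrightarrow> topspace X \<inter> \<Inter>F \<inter> \<Inter>G \<noteq> {}"
  obtains x where "x \<in> topspace X" "\<And>K. K \<in> \<K> \<Longrightarrow> x \<in> K" "\<And>U. U \<in> \<U> \<Longrightarrow> x \<in> U"
proof -
  have "closedin X (\<Inter>(insert (topspace X) \<K>))" using K by (intro closedin_Inter) auto
  moreover have "\<Inter>(insert (topspace X) \<K>) \<inter> \<Inter>F \<noteq> {}" if F: "finite F" "F \<subseteq> \<U>" for F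
  proof -
    have "compactin X (topspace X \<inter> \<Inter>F)" using spectral_finite_Inter[OF X F(1)] \<U> F(2) by blast
    then have *: "\<forall>\<G>. (\<forall>C\<in>\<G>. closedin X C) \<and> (\<forall>\<F>. finite \<F> \<and> \<F> \<subseteq> \<G> \<longrightarrow> topspace X \<inter> \<Inter>F \<inter> \<Inter>\<F> \<noteq> {})
        \<longrightarrow> topspace X \<inter> \<Inter>F \<inter> \<Inter>\<G> \<noteq> {}"
      unfolding compactin_fip by blast
    have "topspace X \<inter> \<Inter>F \<inter> \<Inter>\<K> \<noteq> {}"
      using *[rule_format, of \<K>] K fip[OF _ _ F] by blast
    then show ?thesis by auto
  qed
  ultimately obtain x where x: "x \<in> \<Inter>(insert (topspace X) \<K>)" "\<And>U. U \<in> \<U> \<Longrightarrow> x \<in> U"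
    using spectral_closed_meets_Inter[OF X _ \<U>] by blast
  then show ?thesis by (intro that[of x]) auto
qed

section \<open>Thomason subsets under homeomorphisms\<close>

lemma thomason_homeomorphic_image:
  assumes h: "homeomorphic_map X Y h" and S: "thomason X S" shows "thomason Y (h ` S)"
proof -
  obtain \<C> where \<C>: "\<And>Z. Z \<in> \<C> \<Longrightarrow> closedin X Z \<and> compactin X (topspace X - Z)" "S = \<Union>\<C>"
    using S unfolding thomason_def by blast
  have "closedin Y (h ` Z) \<and> compactin Y (topspace Y - h ` Z)" if Z: "Z \<in> \<C>" for Z
  proof
    have Zt: "Z \<subseteq> topspace X" using \<C>(1)[OF Z] closedin_subset by blast
    show "closedin Y (h ` Z)" using homeomorphic_map_closedness[OF h Zt] \<C>(1)[OF Z] by blast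
    have "topspace Y - h ` Z = h ` (topspace X - Z)"
      unfolding homeomorphic_imp_surjective_map[OF h, symmetric]
      by (rule inj_on_image_set_diff[OF homeomorphic_imp_injective_map[OF h] _ Zt, symmetric]) blast
    then show "compactin Y (topspace Y - h ` Z)"
      using homeomorphic_map_compactness[OF h, of "topspace X - Z"] \<C>(1)[OF Z] by simp
  qed
  then show ?thesis unfolding thomason_def using \<C>(2) by (intro exI[of _ "(\<lambda>Z. h ` Z) ` \<C>"]) auto
qed

lemma thomason_homeomorphic_vimage:
  assumes h: "homeomorphic_map X Y h" and S: "thomason Y S" shows "thomason X {x \<in> topspace X. h x \<in> S}"
proof -
  obtain g where hg: "homeomorphic_maps X Y h g" using h unfolding homeomorphic_map_maps by blast
  then have g: "homeomorphic_map Y X g" and gh: "\<forall>x\<in>topspace X. g (h x) = x"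
    and hg': "\<forall>y\<in>topspace Y. h (g y) = y"
    unfolding homeomorphic_maps_map by simp_all
  have St: "S \<subseteq> topspace Y"
  proof -
    obtain \<C> where "\<forall>Z\<in>\<C>. closedin Y Z \<and> compactin Y (topspace Y - Z)" "S = \<Union>\<C>"
      using S unfolding thomason_def by (elim exE conjE)
    then show ?thesis using closedin_subset by blast
  qed
  have "g ` S = {x \<in> topspace X. h x \<in> S}"
  proof (intro equalityI subsetI)
    fix x assume "x \<in> g ` S"
    then obtain y where y: "y \<in> S" "x = g y" by blast
    have "g y \<in> topspace X" using y St homeomorphic_imp_surjective_map[OF g] by blast
    then show "x \<in> {x \<in> topspace X. h x \<in> S}" using y St hg' by auto
  next
    fix x assume x: "x \<in> {x \<in> topspace X. h x \<in> S}"
    then have "x = g (h x)" using gh by simp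
    then show "x \<in> g ` S" using x by blast
  qed
  then show ?thesis using thomason_homeomorphic_image[OF g S] by simp
qed

section \<open>Extensions of localizing ideals\<close>

context triangulated_category
begin

text \<open>The extension product of Beilinson, Bernstein and Deligne.\<close>

definition star :: "'o set \<Rightarrow> 'o set \<Rightarrow> 'o set" where
  "star A B = {t. \<exists>a b f g h. tri a t b f g h \<and> a \<in> A \<and> b \<in> B}"

lemma starI: "tri a t b f g h \<Longrightarrow> a \<in> A \<Longrightarrow> b \<in> B \<Longrightarrow> t \<in> star A B"
  unfolding star_def by blast

lemma starE:
  assumes "t \<in> star A B" obtains a b f g h where "tri a t b f g h" "a \<in> A" "b \<in> B"
  using assms unfolding star_def by blast

lemma star_mono: "A \<subseteq> A' \<Longrightarrow> B \<subseteq> B' \<Longrightarrow> star A B \<subseteq> star A' B'"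
  unfolding star_def by blast

lemma star_self: "triangulated_subcategory C A \<Longrightarrow> star A A \<subseteq> A"
  using tsub_second by (auto elim!: starE)

text \<open>The octahedron on the composite from \<open>a\<close> through \<open>s\<close> to
  \<open>t\<close>.\<close>

lemma star_assoc: "star (star A B) D \<subseteq> star A (star B D)"
proof
  fix t assume "t \<in> star (star A B) D"
  then obtain s c p p' p'' where 1: "tri s t c p p' p''" "s \<in> star A B" "c \<in> D" by (rule starE)
  from 1(2) obtain a b f f' f'' where 2: "tri a s b f f' f''" "a \<in> A" "b \<in> B" by (rule starE)
  have "Dom C (p \<cdot> f) = a" "Cod C (p \<cdot> f) = t" using triD[OF 1(1)] triD[OF 2(1)] by simp_all
  then obtain y h1 h2 where 3: "tri a t y (p \<cdot> f) h1 h2" by (rule tri_exists)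
  obtain u v w where 4: "tri b y c u v w"
    by (rule tri_octahedral[OF 2(1) 1(1) 3]) (rule that)
  show "t \<in> star A (star B D)" by (rule starI[OF 3 2(2) starI[OF 4 2(3) 1(3)]])
qed

text \<open>The octahedron on \<open>t\<close>, \<open>u\<close>, \<open>c\<close> has the suspended
  first terms as cones, so the reverse regrouping comes out one suspension later. It is cancelled
  where the target class is stable under desuspension.\<close>

lemma star_assoc':
  assumes A: "\<And>x. x \<in> A \<Longrightarrow> Susp C x \<in> A" and B: "\<And>x. x \<in> B \<Longrightarrow> Susp C x \<in> B"
    and D: "\<And>x. x \<in> D \<Longrightarrow> Susp C x \<in> D" and t: "t \<in> star A (star B D)"
  shows "Susp C t \<in> star (star A B) D"
proof -
  obtain a u f p q where 1: "tri a t u f p q" "a \<in> A" "u \<in> star B D" using t by (rule starE)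
  from 1(3) obtain b c g r s where 2: "tri b u c g r s" "b \<in> B" "c \<in> D" by (rule starE)
  have "Dom C (r \<cdot> p) = t" "Cod C (r \<cdot> p) = c" using triD[OF 1(1)] triD[OF 2(1)] by simp_all
  then obtain y h1 h2 where 3: "tri t c y (r \<cdot> p) h1 h2" by (rule tri_exists)
  obtain k l w where 4: "tri (Susp C a) y (Susp C b) k l w"
    by (rule tri_octahedral[OF tri_rotate[OF 1(1)] tri_rotate[OF 2(1)] 3]) (rule that)
  have "y \<in> star A B" by (rule starI[OF 4 A[OF 1(2)] B[OF 2(2)]])
  then show ?thesis by (rule starI[OF tri_rotate[OF tri_rotate[OF 3]] _ D[OF 2(3)]])
qed

text \<open>The connecting map runs from \<open>a\<close> to a suspension of \<open>b\<close> and
  vanishes by orthogonality. The cone of the resulting section of \<open>g\<close> is again in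
  \<open>B\<close>, which presents \<open>t\<close> with the \<open>A\<close> part first.\<close>

lemma star_swap:
  assumes B: "triangulated_subcategory C B"
    and orth: "\<And>h. Dom C h \<in> A \<Longrightarrow> Cod C h \<in> B \<Longrightarrow> h = Zero C (Dom C h) (Cod C h)"
  shows "star B A \<subseteq> star A B"
proof
  fix t assume "t \<in> star B A"
  then obtain b a f g h where 1: "tri b t a f g h" "b \<in> B" "a \<in> A" by (rule starE)
  note d = triD[OF 1(1)]
  have bS: "Susp C b \<in> B" using tsub_Susp[OF B] 1(2) by blast
  have h: "h = Zero C a (Susp C b)" using orth[of h] d 1(3) bS by simp
  obtain m where m: "Dom C m = a" "Cod C m = t" "g \<cdot> m = Ide C a"
    using tri_split_section[OF 1(1)[unfolded h]] .
  obtain c k l where 2: "tri a t c m k l" using tri_exists[OF m(1,2)] .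
  obtain z where z: "is_zero C z" using ex_zero by blast
  have 3: "tri a a z (g \<cdot> m) (Zero C a z) (Zero C z (Susp C a))" using tri_Ide[OF z] m(3) by simp
  obtain u v w where 4: "tri c z (Susp C b) u v w"
    by (rule tri_octahedral[OF 2 tri_rotate[OF 1(1)] 3]) (rule that)
  have "c \<in> B" by (rule tsub_first[OF B 4 tsub_zero[OF B z] bS])
  then show "t \<in> star A B" by (rule starI[OF 2 1(3)])
qed

end

context tt_category
begin

lemma star_isomorphic:
  assumes "t \<in> star A B" "isomorphic T t t'" shows "t' \<in> star A B"
proof -
  obtain a b f g h where 1: "tri a t b f g h" "a \<in> A" "b \<in> B" using assms(1) by (rule starE)
  note d = triD[OF 1(1)]
  obtain m n where m: "Dom T m = t" "Cod T m = t'" "Dom T n = t'" "Cod T n = t"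
    "n \<cdot> m = Ide T t" "m \<cdot> n = Ide T t'" using assms(2) by (rule isomorphicE)
  have "tri a t' b (m \<cdot> f) (g \<cdot> n) h"
    by (rule tri_iso[OF 1(1) iso_Ide iso_arrowI[OF m] iso_Ide]) (use d m in simp_all)
  then show ?thesis by (rule starI[OF _ 1(2,3)])
qed

text \<open>Associativity of \<open>star\<close> reduces closure under cones to \<open>star B A \<subseteq> star A B\<close>, which is where
  the vanishing of maps from \<open>A\<close> to \<open>B\<close> enters.\<close>

lemma star_localizing_ideal:
  assumes hc: "has_small_coproducts T"
    and A: "localizing_ideal T A" and B: "localizing_ideal T B"
    and orth: "\<And>h. Dom T h \<in> A \<Longrightarrow> Cod T h \<in> B \<Longrightarrow> h = Zero T (Dom T h) (Cod T h)"
  shows "localizing_ideal T (star A B)"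
proof -
  let ?D = "star A B"
  note tA = ideal_triangulated[OF A] and tB = ideal_triangulated[OF B]
  have SA: "x \<in> A \<Longrightarrow> Susp T x \<in> A" and SB: "x \<in> B \<Longrightarrow> Susp T x \<in> B" for x
    using tsub_Susp[OF tA] tsub_Susp[OF tB] by blast+
  have ten: "t \<boxtimes> y \<in> ?D" if t: "t \<in> ?D" for t y
  proof -
    obtain a b f g h where 1: "tri a t b f g h" "a \<in> A" "b \<in> B" using t by (rule starE)
    show ?thesis
      by (rule starI[OF tensor_tri[OF 1(1)] ideal_tensor[OF A 1(2)] ideal_tensor[OF B 1(3)]])
  qed
  have S: "Susp T t \<in> ?D \<longleftrightarrow> t \<in> ?D" for t
    by (rule Susp_iff_if_tensor_closed) (fact star_isomorphic, fact ten)
  have SD: "x \<in> ?D \<Longrightarrow> Susp T x \<in> ?D" for x using S by blast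
  \<comment> \<open>Regrouping puts \<open>star B A\<close> in front, where the swap applies; the
    two factors \<open>B\<close> then merge.\<close>
  have BD: "star B ?D \<subseteq> ?D"
  proof
    fix u assume "u \<in> star B ?D"
    then have "Susp T u \<in> star (star B A) B" using star_assoc'[of B A B u] SA SB by blast
    then have "Susp T u \<in> star ?D B" using star_mono[OF star_swap[OF tB orth] subset_refl] by blast
    then have "Susp T u \<in> star A (star B B)" using star_assoc by blast
    then have "Susp T u \<in> ?D" using star_mono[OF subset_refl star_self[OF tB]] by blast
    then show "u \<in> ?D" using S by blast
  qed
  \<comment> \<open>The middle factor \<open>B\<close> is absorbed into \<open>?D\<close> by
    \<open>BD\<close>, and the two factors \<open>A\<close> merge after regrouping.\<close>
  have DD: "star ?D ?D \<subseteq> ?D"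
  proof
    fix u assume "u \<in> star ?D ?D"
    then have "u \<in> star A (star B ?D)" using star_assoc by blast
    then have "u \<in> star A ?D" using star_mono[OF subset_refl BD] by blast
    then have "Susp T u \<in> star (star A A) B" using star_assoc'[of A A B u] SA SB by blast
    then have "Susp T u \<in> ?D" using star_mono[OF star_self[OF tA] subset_refl] by blast
    then show "u \<in> ?D" using S by blast
  qed
  show ?thesis
  proof (rule localizing_idealI)
    fix x assume x: "is_zero T x"
    show "x \<in> ?D" by (rule starI[OF tri_Ide[OF x] tsub_zero[OF tA x] tsub_zero[OF tB x]])
  next
    fix x y z f g h assume "tri x y z f g h" "x \<in> ?D" "y \<in> ?D"
    \<comment> \<open>Rotation places the cone \<open>z\<close> between \<open>y\<close> and
      \<open>Susp T x\<close>.\<close>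
    then have "z \<in> star ?D ?D" using starI[OF tri_rotate _ SD] by blast
    then show "z \<in> ?D" using DD by blast
  next
    fix I :: "'u set" and t c \<iota>
    assume I: "small T I" and cp: "is_coproduct T I t c \<iota>" and t: "\<And>i. i \<in> I \<Longrightarrow> t i \<in> ?D"
    have "\<forall>i\<in>I. \<exists>p. case p of (a, b, f, g, h) \<Rightarrow> tri a (t i) b f g h \<and> a \<in> A \<and> b \<in> B"
      using t by (auto simp: star_def)
    from bchoice[OF this] obtain p where
      p: "\<forall>i\<in>I. case p i of (a, b, f, g, h) \<Rightarrow> tri a (t i) b f g h \<and> a \<in> A \<and> b \<in> B" by (elim exE)
    define a where "a i = fst (p i)" for i
    define b where "b i = fst (snd (p i))" for i
    define f where "f i = fst (snd (snd (p i)))" for i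
    define g where "g i = fst (snd (snd (snd (p i))))" for i
    define h where "h i = snd (snd (snd (snd (p i))))" for i
    have tr: "tri (a i) (t i) (b i) (f i) (g i) (h i)" "a i \<in> A" "b i \<in> B" if "i \<in> I" for i
      using bspec[OF p that] by (simp_all add: a_def b_def f_def g_def h_def case_prod_beta)
    obtain ca \<alpha> where ca: "is_coproduct T I a ca \<alpha>" using hc I unfolding has_small_coproducts_def by blast
    obtain cb \<beta> where cb: "is_coproduct T I b cb \<beta>" using hc I unfolding has_small_coproducts_def by blast
    obtain F G H where 1: "tri ca c cb F G H" by (rule coproduct_tri[OF ca cp cb tr(1)])
    have "ca \<in> A" by (rule localizing_coproduct[OF ideal_localizing[OF A] I ca tr(2)])
    moreover have "cb \<in> B" by (rule localizing_coproduct[OF ideal_localizing[OF B] I cb tr(3)])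
    ultimately show "c \<in> ?D" by (rule starI[OF 1])
  qed (fact star_isomorphic, fact ten)
qed

text \<open>The quantifier over \<open>s\<close> builds closure under tensor products into the left
  orthogonal of \<open>B\<close>, so that checking generators places a whole
  \<open>Loc_tensor\<close> in it.\<close>

lemma left_orthogonal_ideal:
  "localizing_ideal T {t. \<forall>s h. Dom T h = t \<boxtimes> s \<longrightarrow> Cod T h \<in> B \<longrightarrow> h = Zero T (t \<boxtimes> s) (Cod T h)}"
  (is "localizing_ideal T ?K")
proof -
  have K: "h = Zero T (t \<boxtimes> s) (Cod T h)" if "t \<in> ?K" "Dom T h = t \<boxtimes> s" "Cod T h \<in> B" for t s h
    using that by blast
  have KI: "t \<in> ?K" if "\<And>s h. Dom T h = t \<boxtimes> s \<Longrightarrow> Cod T h \<in> B \<Longrightarrow> h = Zero T (t \<boxtimes> s) (Cod T h)" for t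
    using that by blast
  have transport: "h = Zero T y (Cod T h)"
    if xy: "isomorphic T x y" and hd: "Dom T h = y"
      and van: "\<And>h'. Dom T h' = x \<Longrightarrow> Cod T h' = Cod T h \<Longrightarrow> h' = Zero T x (Cod T h')" for x y h
  proof -
    obtain m where m: "iso_arrow T x y m" using xy by (auto simp: isomorphic_def)
    then have d: "Dom T m = x" "Cod T m = y" by (auto simp: iso_arrow_def inverse_arrows_def)
    have "h \<cdot> m = Zero T x (Cod T (h \<cdot> m))" by (rule van) (use d hd in simp_all)
    then have "h \<cdot> m = Zero T y (Cod T h) \<cdot> m" using d hd by simp
    then show ?thesis by (rule iso_arrow_epi[OF m hd Zero_Hom(1)])
  qed
  have iso: "y \<in> ?K" if x: "x \<in> ?K" and xy: "isomorphic T x y" for x y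
  proof (rule KI)
    fix s h assume h: "Dom T h = y \<boxtimes> s" "Cod T h \<in> B"
    show "h = Zero T (y \<boxtimes> s) (Cod T h)"
    proof (rule transport[OF isomorphic_tensor[OF xy isomorphic_refl] h(1)])
      fix h' assume "Dom T h' = x \<boxtimes> s" "Cod T h' = Cod T h"
      then show "h' = Zero T (x \<boxtimes> s) (Cod T h')" using K[OF x, of h' s] h(2) by simp
    qed
  qed
  have ten: "x \<boxtimes> y \<in> ?K" if x: "x \<in> ?K" for x y
  proof (rule KI)
    fix s h assume h: "Dom T h = (x \<boxtimes> y) \<boxtimes> s" "Cod T h \<in> B"
    show "h = Zero T ((x \<boxtimes> y) \<boxtimes> s) (Cod T h)"
    proof (rule transport[OF isomorphic_sym[OF isomorphic_Assoc] h(1)])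
      fix h' assume "Dom T h' = x \<boxtimes> y \<boxtimes> s" "Cod T h' = Cod T h"
      then show "h' = Zero T (x \<boxtimes> y \<boxtimes> s) (Cod T h')" using K[OF x, of h' "y \<boxtimes> s"] h(2) by simp
    qed
  qed
  have S: "Susp T x \<in> ?K \<longleftrightarrow> x \<in> ?K" for x
    by (rule Susp_iff_if_tensor_closed) (fact iso, fact ten)
  show ?thesis
  proof (rule localizing_idealI)
    fix x assume x: "is_zero T x"
    show "x \<in> ?K"
    proof (rule KI)
      fix s h assume "Dom T h = x \<boxtimes> s"
      then show "h = Zero T (x \<boxtimes> s) (Cod T h)" by (rule is_zero_from[OF is_zero_tensor[OF x]])
    qed
  next
    fix x y z f g h assume t: "tri x y z f g h" and x: "x \<in> ?K" and y: "y \<in> ?K"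
    show "z \<in> ?K"
    proof (rule KI)
      fix s k assume k: "Dom T k = z \<boxtimes> s" "Cod T k \<in> B"
      note ts = tensor_tri[OF t, of s]
      note d = triD[OF ts] and d0 = triD[OF t]
      have "k \<cdot> (g \<boxtimes>\<^sub>m Ide T s) = Zero T (y \<boxtimes> s) (Cod T (k \<cdot> (g \<boxtimes>\<^sub>m Ide T s)))"
        by (rule K[OF y]) (use k d0 in simp_all)
      then have "k \<cdot> (g \<boxtimes>\<^sub>m Ide T s) = Zero T (y \<boxtimes> s) (Cod T k)" using k d0 by simp
      then obtain l where l: "Dom T l = Susp T (x \<boxtimes> s)" "Cod T l = Cod T k"
        "l \<cdot> (TSusp T x s \<cdot> (h \<boxtimes>\<^sub>m Ide T s)) = k"
        by (rule tri_weak_cokernel[OF tri_rotate[OF ts] k(1)])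
      \<comment> \<open>\<open>k\<close> factors through the suspension of
        \<open>x \<boxtimes> s\<close>, which \<open>TSusp\<close> identifies with
        \<open>Susp T x \<boxtimes> s\<close>.\<close>
      have "Susp T x \<in> ?K" using S x by blast
      from K[OF this, of "l \<cdot> TSusp T x s" s] have "l \<cdot> TSusp T x s = Zero T (Susp T x \<boxtimes> s) (Cod T k)"
        using l(1,2) k(2) by simp
      from comp_reduce[OF this, of "h \<boxtimes>\<^sub>m Ide T s"] show "k = Zero T (z \<boxtimes> s) (Cod T k)"
        using l d0 by simp
    qed
  next
    fix I :: "'u set" and t c \<iota>
    assume I: "small T I" and cp: "is_coproduct T I t c \<iota>" and t: "\<And>i. i \<in> I \<Longrightarrow> t i \<in> ?K"
    show "c \<in> ?K"
    proof (rule KI)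
      fix s h assume h: "Dom T h = c \<boxtimes> s" "Cod T h \<in> B"
      show "h = Zero T (c \<boxtimes> s) (Cod T h)"
      proof (rule coproduct_eqI[OF tensor_coproduct[OF cp, of s] h(1)])
        fix i assume i: "i \<in> I"
        note d = coproduct_inj[OF cp i]
        have "h \<cdot> (\<iota> i \<boxtimes>\<^sub>m Ide T s) = Zero T (t i \<boxtimes> s) (Cod T (h \<cdot> (\<iota> i \<boxtimes>\<^sub>m Ide T s)))"
          by (rule K[OF t[OF i]]) (use h d in simp_all)
        then show "h \<cdot> (\<iota> i \<boxtimes>\<^sub>m Ide T s) = Zero T (c \<boxtimes> s) (Cod T h) \<cdot> (\<iota> i \<boxtimes>\<^sub>m Ide T s)" using h d by simp
      qed simp_all
    qed
  qed (fact iso, fact ten)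
qed

text \<open>Duality puts each rigid generator in the left orthogonal class; the case of
  \<open>s\<close> equal to the unit then covers maps out of the object itself.\<close>

lemma rigid_left_orthogonal:
  assumes E: "\<And>e. e \<in> E \<Longrightarrow> is_rigid T e" and z: "\<And>e u. e \<in> E \<Longrightarrow> u \<in> B \<Longrightarrow> is_zero T (u \<boxtimes> e)"
    and h: "Dom T h \<in> Loc_tensor T E" "Cod T h \<in> B"
  shows "h = Zero T (Dom T h) (Cod T h)"
proof -
  let ?K = "{t. \<forall>s h. Dom T h = t \<boxtimes> s \<longrightarrow> Cod T h \<in> B \<longrightarrow> h = Zero T (t \<boxtimes> s) (Cod T h)}"
  have "e \<in> ?K" if e: "e \<in> E" for e
  proof (intro CollectI allI impI)
    fix s h assume h: "Dom T h = e \<boxtimes> s" "Cod T h \<in> B"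
    have b: "Dom T (Braid T s e) = s \<boxtimes> e" "Cod T (Braid T s e) = e \<boxtimes> s"
      using Braid_in_Hom[of s e] by simp_all
    have bi: "iso_arrow T (s \<boxtimes> e) (e \<boxtimes> s) (Braid T s e)"
      by (rule iso_arrowI[where g = "Braid T e s"]) (use Braid_in_Hom Braid_symmetric in simp_all)
    have "h \<cdot> Braid T s e = Zero T (s \<boxtimes> e) (Cod T h)"
      by (rule rigid_orthogonal[OF E[OF e] z[OF e h(2)]]) (use h b in simp_all)
    then have "h \<cdot> Braid T s e = Zero T (e \<boxtimes> s) (Cod T h) \<cdot> Braid T s e" using b by simp
    then show "h = Zero T (e \<boxtimes> s) (Cod T h)" by (rule iso_arrow_epi[OF bi h(1) Zero_Hom(1)])
  qed
  then have "Loc_tensor T E \<subseteq> ?K" by (intro Loc_tensor_minimal[OF left_orthogonal_ideal]) blast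
  then have K: "\<And>s k. Dom T k = Dom T h \<boxtimes> s \<Longrightarrow> Cod T k \<in> B \<Longrightarrow> k = Zero T (Dom T h \<boxtimes> s) (Cod T k)"
    using h(1) by blast
  have "h \<cdot> RUnit T (Dom T h) = Zero T (Dom T h \<boxtimes> Unit T) (Cod T (h \<cdot> RUnit T (Dom T h)))"
    by (rule K) (use h in simp_all)
  then have "h \<cdot> RUnit T (Dom T h) = Zero T (Dom T h) (Cod T h) \<cdot> RUnit T (Dom T h)" by simp
  then show ?thesis by (rule iso_arrow_epi[OF RUnit_iso refl Zero_Hom(1)])
qed

end

section \<open>Stratification\<close>

locale stratified_tt_category = rigidly_compactly_generated_tt_category T
  for T :: "('o, 'm, 'u, 'z) tt_data_scheme" (structure) +
  fixes X :: "'x topology" and \<sigma> :: "'o \<Rightarrow> 'x set"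
  assumes spectral: "spectral_space X"
    and noetherian: "weakly_noetherian X"
    and support_function: "support_function T X \<sigma>"
    and stratifies: "bij_betw (\<lambda>L. \<Union>t\<in>L. \<sigma> t) {L. localizing_ideal T L} (Pow (topspace X))"
    and compactly_generated_ideals:
      "(\<lambda>L. \<Union>t\<in>L. \<sigma> t) ` {L. localizing_ideal T L \<and> compactly_generated_ideal T L} = {Y. thomason X Y}"
begin

section \<open>Elementary rules for the support function\<close>

lemma support_properties:
  shows "\<forall>t. \<sigma> t \<subseteq> topspace X" "\<forall>t. is_zero T t \<longrightarrow> \<sigma> t = {}" "\<sigma> (Unit T) = topspace X"
    "\<forall>t. \<sigma> (Susp T t) = \<sigma> t"
    "\<forall>f g h a b c. (f, g, h) \<in> Triangles T \<and> f \<in> Hom T a b \<and> g \<in> Hom T b c \<longrightarrow> \<sigma> c \<subseteq> \<sigma> a \<union> \<sigma> b"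
    "\<forall>(I :: 'u set) t c \<iota>. small T I \<and> is_coproduct T I t c \<iota> \<longrightarrow> \<sigma> c = (\<Union>i\<in>I. \<sigma> (t i))"
    "\<forall>t1 t2. \<sigma> (t1 \<boxtimes> t2) \<subseteq> \<sigma> t1 \<inter> \<sigma> t2"
  using support_function unfolding support_function_def by - (elim conjE, assumption)+

lemma \<sigma>_topspace: "\<sigma> t \<subseteq> topspace X"
  using support_properties(1) by blast

lemma \<sigma>_zero: "is_zero T t \<Longrightarrow> \<sigma> t = {}"
  using support_properties(2) by blast

lemma \<sigma>_tri: "tri a b c f g h \<Longrightarrow> \<sigma> c \<subseteq> \<sigma> a \<union> \<sigma> b"
  using support_properties(5)[rule_format, of f g h a b c] by (simp add: tri_def)

lemma \<sigma>_coproduct: "small T I \<Longrightarrow> is_coproduct T I t c \<iota> \<Longrightarrow> \<sigma> c = (\<Union>i\<in>I. \<sigma> (t i))"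
  using support_properties(6) by blast

lemma \<sigma>_tensor: "\<sigma> (s \<boxtimes> t) \<subseteq> \<sigma> s \<inter> \<sigma> t"
  using support_properties(7) by blast

text \<open>An isomorphism and a zero object form a triangle, so invariance follows from
  subadditivity on triangles.\<close>

lemma \<sigma>_isomorphic_subset: assumes "isomorphic T x y" shows "\<sigma> y \<subseteq> \<sigma> x"
proof -
  obtain z where z: "is_zero T z" using ex_zero by blast
  obtain f where f: "iso_arrow T x y f" using assms by (auto simp: isomorphic_def)
  then have d: "Dom T f = x" "Cod T f = y" by (auto simp: iso_arrow_def inverse_arrows_def)
  have "tri z x y (Zero T z x) f (Zero T y (Susp T z))"
    by (rule tri_iso[OF tri_Ide_right[OF z] iso_Ide iso_Ide f]) (use d in simp_all)
  from \<sigma>_tri[OF this] show ?thesis using \<sigma>_zero[OF z] by simp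
qed

lemma \<sigma>_isomorphic: "isomorphic T x y \<Longrightarrow> \<sigma> x = \<sigma> y"
  using \<sigma>_isomorphic_subset isomorphic_sym by blast

section \<open>The classification of localizing ideals in usable form\<close>

definition supported_on :: "'x set \<Rightarrow> 'o set" where
  "supported_on S = {t. \<sigma> t \<subseteq> S}"

lemma supported_on_iff: "t \<in> supported_on S \<longleftrightarrow> \<sigma> t \<subseteq> S"
  by (simp add: supported_on_def)

lemma supported_on_ideal: "localizing_ideal T (supported_on S)"
proof (rule localizing_idealI)
  show "x \<in> supported_on S" if "is_zero T x" for x
    using \<sigma>_zero[OF that] by (simp add: supported_on_iff)
  show "y \<in> supported_on S" if "x \<in> supported_on S" "isomorphic T x y" for x y
    using that \<sigma>_isomorphic[OF that(2)] by (simp add: supported_on_iff)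
  show "z \<in> supported_on S" if "tri x y z f g h" "x \<in> supported_on S" "y \<in> supported_on S" for x y z f g h
    using \<sigma>_tri[OF that(1)] that(2,3) unfolding supported_on_iff by blast
  show "c \<in> supported_on S" if "small T I" "is_coproduct T I t c \<iota>" "\<And>i. i \<in> I \<Longrightarrow> t i \<in> supported_on S"
    for I :: "'u set" and t c \<iota>
    using \<sigma>_coproduct[OF that(1,2)] that(3) unfolding supported_on_iff by blast
  show "x \<boxtimes> y \<in> supported_on S" if "x \<in> supported_on S" for x y
    using that \<sigma>_tensor[of x y] unfolding supported_on_iff by blast
qed

text \<open>Both sides are localizing ideals with the same union of supports, and the classifying
  map is injective.\<close>

lemma ideal_eq_supported_on:
  assumes L: "localizing_ideal T L" shows "L = supported_on (\<Union>t\<in>L. \<sigma> t)"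
proof -
  have "(\<Union>t\<in>supported_on (\<Union>t\<in>L. \<sigma> t). \<sigma> t) = (\<Union>t\<in>L. \<sigma> t)"
    unfolding supported_on_def by blast
  then show ?thesis
    using inj_onD[OF bij_betw_imp_inj_on[OF stratifies], of "supported_on (\<Union>t\<in>L. \<sigma> t)" L]
      supported_on_ideal L by simp
qed

lemma Union_supported_on: assumes "S \<subseteq> topspace X" shows "(\<Union>t\<in>supported_on S. \<sigma> t) = S"
proof -
  have "S \<in> (\<lambda>L. \<Union>t\<in>L. \<sigma> t) ` {L. localizing_ideal T L}"
    using bij_betw_imp_surj_on[OF stratifies] assms by simp
  then obtain L where L: "localizing_ideal T L" "S = (\<Union>t\<in>L. \<sigma> t)" by blast
  show ?thesis using ideal_eq_supported_on[OF L(1)] unfolding L(2)[symmetric] using L(2) by simp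
qed

lemma mem_Loc_tensor_iff: "s \<in> Loc_tensor T E \<longleftrightarrow> \<sigma> s \<subseteq> (\<Union>t\<in>E. \<sigma> t)"
proof
  assume "s \<in> Loc_tensor T E"
  then have "s \<in> supported_on (\<Union>t\<in>E. \<sigma> t)"
    using Loc_tensor_minimal[OF supported_on_ideal, of E "\<Union>t\<in>E. \<sigma> t"] unfolding supported_on_def by blast
  then show "\<sigma> s \<subseteq> (\<Union>t\<in>E. \<sigma> t)" by (simp add: supported_on_iff)
next
  assume s: "\<sigma> s \<subseteq> (\<Union>t\<in>E. \<sigma> t)"
  have "(\<Union>t\<in>E. \<sigma> t) \<subseteq> (\<Union>t\<in>Loc_tensor T E. \<sigma> t)" using Loc_tensor_superset by blast
  then have "s \<in> supported_on (\<Union>t\<in>Loc_tensor T E. \<sigma> t)" using s unfolding supported_on_iff by blast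
  then show "s \<in> Loc_tensor T E"
    using ideal_eq_supported_on[OF localizing_ideal_Loc_tensor] by blast
qed

text \<open>The form in which stratification acts on ideals given by other means, such as
  annihilators.\<close>

lemma ideal_contains:
  assumes "localizing_ideal T L" "t \<in> L" "\<sigma> s \<subseteq> \<sigma> t" shows "s \<in> L"
proof -
  have "s \<in> Loc_tensor T {t}" using assms(3) by (simp add: mem_Loc_tensor_iff)
  then show ?thesis using Loc_tensor_minimal[OF assms(1), of "{t}"] assms(2) by blast
qed

text \<open>Applied to the ideal of zero objects, the containment principle makes supports detect
  zero.\<close>

lemma \<sigma>_empty: "\<sigma> t = {} \<Longrightarrow> is_zero T t"
  using ideal_contains[OF localizing_zero_ideal, of _ t] ex_zero by auto

lemma point_object: assumes "x \<in> topspace X" obtains u where "\<sigma> u = {x}"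
proof -
  have "(\<Union>t\<in>supported_on {x}. \<sigma> t) = {x}" by (rule Union_supported_on) (use assms in simp)
  then obtain u where "u \<in> supported_on {x}" "x \<in> \<sigma> u" by blast
  then have "\<sigma> u = {x}" unfolding supported_on_iff by blast
  then show ?thesis by (rule that)
qed

section \<open>Thomason subsets and decompositions of the unit\<close>

lemma thomason_generators:
  assumes "thomason X Y" obtains E where "E \<subseteq> compacts T" "Y = (\<Union>a\<in>E. \<sigma> a)"
proof -
  have "Y \<in> (\<lambda>L. \<Union>t\<in>L. \<sigma> t) ` {L. localizing_ideal T L \<and> compactly_generated_ideal T L}"
    unfolding compactly_generated_ideals using assms by simp
  then obtain E where E: "E \<subseteq> compacts T" "Y = (\<Union>t\<in>Loc_tensor T E. \<sigma> t)"
    unfolding compactly_generated_ideal_def by blast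
  have "(\<Union>t\<in>Loc_tensor T E. \<sigma> t) = (\<Union>a\<in>E. \<sigma> a)"
    using mem_Loc_tensor_iff[of _ E] Loc_tensor_superset[of E] by blast
  then show ?thesis using that E by simp
qed

lemma thomason_Union_\<sigma>: assumes "E \<subseteq> compacts T" shows "thomason X (\<Union>a\<in>E. \<sigma> a)"
proof -
  have "Loc_tensor T E \<in> {L. localizing_ideal T L \<and> compactly_generated_ideal T L}"
    using localizing_ideal_Loc_tensor assms unfolding compactly_generated_ideal_def by blast
  then have "(\<Union>t\<in>Loc_tensor T E. \<sigma> t) \<in> {Y. thomason X Y}"
    unfolding compactly_generated_ideals[symmetric] by (rule imageI)
  moreover have "(\<Union>t\<in>Loc_tensor T E. \<sigma> t) = (\<Union>a\<in>E. \<sigma> a)"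
    using mem_Loc_tensor_iff[of _ E] Loc_tensor_superset[of E] by blast
  ultimately show ?thesis by simp
qed

lemma thomason_subset: "thomason X Y \<Longrightarrow> Y \<subseteq> topspace X"
  using thomason_generators \<sigma>_topspace by blast

text \<open>A Thomason set is covered by the supports of compact, hence rigid, generators. Their
  products with objects supported off \<open>Y\<close> have empty support and vanish.\<close>

lemma orthogonal:
  assumes Y: "thomason X Y" and h: "Dom T h \<in> supported_on Y" "Cod T h \<in> supported_on (topspace X - Y)"
  shows "h = Zero T (Dom T h) (Cod T h)"
proof -
  obtain E where E: "E \<subseteq> compacts T" "Y = (\<Union>a\<in>E. \<sigma> a)" using thomason_generators[OF Y] .
  show ?thesis
  proof (rule rigid_left_orthogonal[of E "supported_on (topspace X - Y)"])
    show "is_rigid T e" if "e \<in> E" for e using that E(1) compact_iff_rigid by (auto simp: compacts_def)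
    show "is_zero T (u \<boxtimes> e)" if "e \<in> E" "u \<in> supported_on (topspace X - Y)" for e u
    proof (rule \<sigma>_empty)
      show "\<sigma> (u \<boxtimes> e) = {}" using \<sigma>_tensor[of u e] that E(2) unfolding supported_on_iff by blast
    qed
    show "Dom T h \<in> Loc_tensor T E" using h(1) E(2) by (simp add: mem_Loc_tensor_iff supported_on_iff)
  qed (fact h(2))
qed

lemma unit_triangle:
  assumes Y: "thomason X Y"
  obtains e f u v w where "tri e (Unit T) f u v w" "\<sigma> e \<subseteq> Y" "\<sigma> f \<subseteq> topspace X - Y"
proof -
  let ?A = "supported_on Y" and ?B = "supported_on (topspace X - Y)"
  have D: "localizing_ideal T (star ?A ?B)"
    by (rule star_localizing_ideal[OF has_coproducts supported_on_ideal supported_on_ideal])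
       (rule orthogonal[OF Y])
  note tA = ideal_triangulated[OF supported_on_ideal[of Y]]
    and tB = ideal_triangulated[OF supported_on_ideal[of "topspace X - Y"]]
  obtain z where z: "is_zero T z" using ex_zero by blast
  have "?A \<subseteq> star ?A ?B" using starI[OF tri_Ide[OF z] _ tsub_zero[OF tB z]] by blast
  then have "Y \<subseteq> (\<Union>t\<in>star ?A ?B. \<sigma> t)"
    using Union_supported_on[OF thomason_subset[OF Y]] by blast
  moreover have "?B \<subseteq> star ?A ?B" using starI[OF tri_Ide_right[OF z] tsub_zero[OF tA z]] by blast
  then have "topspace X - Y \<subseteq> (\<Union>t\<in>star ?A ?B. \<sigma> t)"
    using Union_supported_on[of "topspace X - Y"] by blast
  ultimately have "\<sigma> (Unit T) \<subseteq> (\<Union>t\<in>star ?A ?B. \<sigma> t)" using support_properties(3) by blast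
  then have "Unit T \<in> star ?A ?B" using ideal_eq_supported_on[OF D] unfolding supported_on_def by blast
  then show ?thesis using that unfolding star_def supported_on_iff by blast
qed

section \<open>Objects detecting a single point\<close>

lemma triangle_kills:
  assumes t: "tri e (Unit T) f u v w" and z: "is_zero T (e \<boxtimes> s)" "is_zero T (f \<boxtimes> s)"
  shows "is_zero T s"
proof -
  have "Unit T \<boxtimes> s \<in> {x. is_zero T x}"
    by (rule tsub_second[OF zero_objects_triangulated tensor_tri[OF t, of s]]) (use z in simp_all)
  then show ?thesis using is_zero_isomorphic[OF _ isomorphic_LUnit] by simp
qed

text \<open>If the product with \<open>t\<close> vanishes, the annihilator ideal lets
  \<open>t\<close> be replaced by an object \<open>u\<close> supported exactly at \<open>x\<close>.
  For such \<open>u\<close> the terms with \<open>f1\<close> and \<open>e2\<close> vanish by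
  support, and the two triangles give \<open>u = 0\<close>. The triangles are arbitrary, to include
  those chosen in the definition of \<open>Supp\<close>.\<close>

lemma stalk:
  assumes x: "{x} = Y1 \<inter> (topspace X - Y2)"
    and t1: "tri e1 (Unit T) f1 u1 v1 w1" "\<sigma> e1 \<subseteq> Y1" "\<sigma> f1 \<subseteq> topspace X - Y1"
    and t2: "tri e2 (Unit T) f2 u2 v2 w2" "\<sigma> e2 \<subseteq> Y2" "\<sigma> f2 \<subseteq> topspace X - Y2"
  shows "x \<in> \<sigma> t \<longleftrightarrow> \<not> is_zero T ((e1 \<boxtimes> f2) \<boxtimes> t)" and "\<sigma> (e1 \<boxtimes> f2) \<subseteq> {x}"
proof -
  show g: "\<sigma> (e1 \<boxtimes> f2) \<subseteq> {x}" using \<sigma>_tensor[of e1 f2] t1(2) t2(3) x by blast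
  show "x \<in> \<sigma> t \<longleftrightarrow> \<not> is_zero T ((e1 \<boxtimes> f2) \<boxtimes> t)"
  proof (intro iffI notI)
    assume xt: "x \<in> \<sigma> t" and z: "is_zero T ((e1 \<boxtimes> f2) \<boxtimes> t)"
    obtain u where u: "\<sigma> u = {x}" using point_object[of x] xt \<sigma>_topspace by blast
    have "t \<in> {v. is_zero T (v \<boxtimes> (e1 \<boxtimes> f2))}" using z is_zero_tensor_commute by blast
    then have "u \<in> {v. is_zero T (v \<boxtimes> (e1 \<boxtimes> f2))}"
      by (rule ideal_contains[OF annihilator_ideal]) (use u xt in simp)
    then have "is_zero T ((e1 \<boxtimes> f2) \<boxtimes> u)" using is_zero_tensor_commute by blast
    then have ev: "is_zero T (e1 \<boxtimes> (f2 \<boxtimes> u))" by (rule is_zero_isomorphic[OF _ isomorphic_Assoc])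
    have "\<sigma> (f1 \<boxtimes> (f2 \<boxtimes> u)) = {}"
      using \<sigma>_tensor[of f1 "f2 \<boxtimes> u"] \<sigma>_tensor[of f2 u] u t1(3) x by blast
    then have "is_zero T (f2 \<boxtimes> u)" using triangle_kills[OF t1(1) ev] \<sigma>_empty by blast
    moreover have "is_zero T (e2 \<boxtimes> u)"
      by (rule \<sigma>_empty) (use \<sigma>_tensor[of e2 u] u t2(2) x in blast)
    ultimately have "is_zero T u" using triangle_kills[OF t2(1)] by blast
    then show False using \<sigma>_zero u by simp
  next
    assume nz: "\<not> is_zero T ((e1 \<boxtimes> f2) \<boxtimes> t)"
    then have "\<sigma> ((e1 \<boxtimes> f2) \<boxtimes> t) \<noteq> {}" using \<sigma>_empty by blast
    then show "x \<in> \<sigma> t" using \<sigma>_tensor[of "e1 \<boxtimes> f2" t] g by blast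
  qed
qed

lemma stalk_object:
  assumes "x \<in> topspace X"
  obtains g where "\<sigma> g \<subseteq> {x}" "\<And>t. x \<in> \<sigma> t \<longleftrightarrow> \<not> is_zero T (g \<boxtimes> t)"
proof -
  obtain Y1 Y2 where Y: "thomason X Y1" "thomason X Y2" "{x} = Y1 \<inter> (topspace X - Y2)"
    using noetherian assms unfolding weakly_noetherian_def weakly_visible_def by blast
  obtain e1 f1 u1 v1 w1 where t1: "tri e1 (Unit T) f1 u1 v1 w1" "\<sigma> e1 \<subseteq> Y1" "\<sigma> f1 \<subseteq> topspace X - Y1"
    using unit_triangle[OF Y(1)] .
  obtain e2 f2 u2 v2 w2 where t2: "tri e2 (Unit T) f2 u2 v2 w2" "\<sigma> e2 \<subseteq> Y2" "\<sigma> f2 \<subseteq> topspace X - Y2"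
    using unit_triangle[OF Y(2)] .
  show ?thesis by (rule that[OF stalk(2,1)[OF Y(3) t1 t2]])
qed

text \<open>Tensoring with an object that detects \<open>x\<close> reduces the claim to the fact
  that a retract of a zero object is zero.\<close>

lemma \<sigma>_retract:
  assumes "Dom T i = a" "Cod T i = b" "Dom T r = b" "r \<cdot> i = Ide T a" shows "\<sigma> a \<subseteq> \<sigma> b"
proof
  fix x assume x: "x \<in> \<sigma> a"
  have xt: "x \<in> topspace X" using x \<sigma>_topspace by blast
  obtain g where g0: "\<sigma> g \<subseteq> {x}" and g: "\<And>t. x \<in> \<sigma> t \<longleftrightarrow> \<not> is_zero T (g \<boxtimes> t)"
    by (rule stalk_object[OF xt]) (rule that)
  have r: "Cod T r = a" using Cod_Comp[of i r] assms by simp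
  have "is_zero T (a \<boxtimes> g)" if "is_zero T (b \<boxtimes> g)"
    using that
    by (rule is_zero_retract[where i = "i \<boxtimes>\<^sub>m Ide T g" and r = "r \<boxtimes>\<^sub>m Ide T g"])
       (use assms r in \<open>simp_all add: TensorMap_Comp'\<close>)
  then show "x \<in> \<sigma> b" using g x is_zero_tensor_commute by blast
qed

text \<open>Let \<open>g\<close> detect \<open>x\<close> and kill \<open>a \<boxtimes> b\<close>.
  The annihilator of \<open>g \<boxtimes> a\<close> contains \<open>b\<close>, hence also
  \<open>g\<close>, whose support is at most \<open>{x}\<close>. So \<open>x\<close> is outside the
  support of \<open>g \<boxtimes> a\<close>, although this support is nonempty and can only contain
  \<open>x\<close>.\<close>

lemma \<sigma>_tensor_eq: "\<sigma> (a \<boxtimes> b) = \<sigma> a \<inter> \<sigma> b"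
proof (rule antisym[OF \<sigma>_tensor subsetI])
  fix x assume x: "x \<in> \<sigma> a \<inter> \<sigma> b"
  have xt: "x \<in> topspace X" using x \<sigma>_topspace by blast
  obtain g where g: "\<sigma> g \<subseteq> {x}" "\<And>t. x \<in> \<sigma> t \<longleftrightarrow> \<not> is_zero T (g \<boxtimes> t)"
    by (rule stalk_object[OF xt]) (rule that)
  show "x \<in> \<sigma> (a \<boxtimes> b)"
  proof (rule ccontr)
    assume "x \<notin> \<sigma> (a \<boxtimes> b)"
    then have "is_zero T (g \<boxtimes> (a \<boxtimes> b))" using g(2) by blast
    then have "is_zero T ((g \<boxtimes> a) \<boxtimes> b)"
      by (rule is_zero_isomorphic[OF _ isomorphic_sym[OF isomorphic_Assoc]])
    then have "b \<in> {v. is_zero T (v \<boxtimes> (g \<boxtimes> a))}" using is_zero_tensor_commute by blast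
    then have "g \<in> {v. is_zero T (v \<boxtimes> (g \<boxtimes> a))}"
      by (rule ideal_contains[OF annihilator_ideal]) (use g(1) x in blast)
    then have "x \<notin> \<sigma> (g \<boxtimes> a)" using g(2) by blast
    moreover have "\<sigma> (g \<boxtimes> a) \<noteq> {}" using g(2)[of a] x \<sigma>_empty by blast
    ultimately show False using \<sigma>_tensor[of g a] g(1) by blast
  qed
qed

text \<open>Directedness gives closure under cones. The families used are the finite unions of a
  cover, the complement of a point, and a single subset pulled back from the spectrum.\<close>

lemma thick_ideal_directed:
  assumes ne: "\<S> \<noteq> {}" and dir: "\<And>S S'. S \<in> \<S> \<Longrightarrow> S' \<in> \<S> \<Longrightarrow> \<exists>S''\<in>\<S>. S \<union> S' \<subseteq> S''"
  shows "thick_ideal T {c \<in> compacts T. \<exists>S\<in>\<S>. \<sigma> c \<subseteq> S}" (is "thick_ideal T ?P")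
proof -
  note ct = compacts_triangulated[OF has_coproducts]
  show ?thesis unfolding thick_ideal_def
  proof (intro conjI allI impI ballI)
    show "?P \<subseteq> compacts T" by blast
    show "triangulated_subcategory T ?P"
    proof (rule triangulated_subcategoryI)
      fix x assume x: "is_zero T x"
      show "x \<in> ?P" using tsub_zero[OF ct x] \<sigma>_zero[OF x] ne by blast
    next
      fix x y assume "x \<in> ?P" and xy: "isomorphic T x y"
      then show "y \<in> ?P" using tsub_isomorphic[OF ct _ xy] \<sigma>_isomorphic[OF xy] by simp
    next
      fix x show "Susp T x \<in> ?P \<longleftrightarrow> x \<in> ?P" using tsub_Susp[OF ct] support_properties(4) by simp
    next
      fix x y z f g h assume t: "tri x y z f g h" and x: "x \<in> ?P" and y: "y \<in> ?P"
      obtain S S' where S: "S \<in> \<S>" "\<sigma> x \<subseteq> S" "S' \<in> \<S>" "\<sigma> y \<subseteq> S'" using x y by blast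
      obtain S'' where "S'' \<in> \<S>" "S \<union> S' \<subseteq> S''" using dir[OF S(1,3)] by blast
      moreover have "\<sigma> z \<subseteq> S \<union> S'" using \<sigma>_tri[OF t] S by blast
      moreover have "z \<in> compacts T" using tsub_third[OF ct t] x y by blast
      ultimately show "z \<in> ?P" by blast
    qed
    fix s x y assume "s \<in> ?P \<and> is_biproduct T s x y"
    then have s: "s \<in> ?P" and b: "is_biproduct T s x y" by blast+
    from b obtain i p where i: "Dom T i = x" "Cod T i = s" "Dom T p = s" "p \<cdot> i = Ide T x"
      unfolding is_biproduct_def in_Hom_iff by blast
    have "x \<in> compacts T" using compact_retract[OF _ i] s unfolding compacts_def by blast
    then show "x \<in> ?P" using \<sigma>_retract[OF i] s by blast
  next
    fix x y assume x: "x \<in> ?P" and y: "y \<in> compacts T"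
    then have "x \<boxtimes> y \<in> compacts T" using compacts_tensor by blast
    then show "x \<boxtimes> y \<in> ?P" using x \<sigma>_tensor[of x y] by blast
  qed
qed

text \<open>A thick ideal is recovered from the localizing ideal that it generates, and the latter
  is determined by supports.\<close>

lemma thick_ideal_mem_iff:
  assumes P: "thick_ideal T P" and a: "a \<in> compacts T"
  shows "a \<in> P \<longleftrightarrow> \<sigma> a \<subseteq> (\<Union>c\<in>P. \<sigma> c)"
  using compact_in_Loc_tensor[OF P a] mem_Loc_tensor_iff[of a P] by blast

text \<open>The compact objects supported on finite subunions already form a thick ideal.\<close>

lemma \<sigma>_finite_subcover:
  assumes a: "a \<in> compacts T" and C: "\<And>Z. Z \<in> \<C> \<Longrightarrow> thomason X Z" and cover: "\<sigma> a \<subseteq> \<Union>\<C>"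
  obtains F where "finite F" "F \<subseteq> \<C>" "\<sigma> a \<subseteq> \<Union>F"
proof -
  let ?S = "{\<Union>F | F. finite F \<and> F \<subseteq> \<C>}"
  let ?P = "{c \<in> compacts T. \<exists>S\<in>?S. \<sigma> c \<subseteq> S}"
  have P: "thick_ideal T ?P"
  proof (rule thick_ideal_directed)
    show "?S \<noteq> {}" by blast
    fix S S' assume "S \<in> ?S" "S' \<in> ?S"
    then obtain F F' where F: "finite F" "F \<subseteq> \<C>" "S = \<Union>F" "finite F'" "F' \<subseteq> \<C>" "S' = \<Union>F'" by blast
    then have "\<Union>(F \<union> F') \<in> ?S" by blast
    then show "\<exists>S''\<in>?S. S \<union> S' \<subseteq> S''" using F by blast
  qed
  have "\<sigma> a \<subseteq> (\<Union>c\<in>?P. \<sigma> c)"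
  proof
    fix x assume "x \<in> \<sigma> a"
    then obtain Z where Z: "Z \<in> \<C>" "x \<in> Z" using cover by blast
    \<comment> \<open>A Thomason set is covered by the supports of compact objects supported inside
      it, and these already belong to \<open>?P\<close>.\<close>
    obtain E where E: "E \<subseteq> compacts T" "Z = (\<Union>a\<in>E. \<sigma> a)" using thomason_generators[OF C[OF Z(1)]] .
    then obtain c where c: "c \<in> E" "x \<in> \<sigma> c" using Z(2) by blast
    have "finite {Z}" "{Z} \<subseteq> \<C>" using Z(1) by simp_all
    then have S: "\<Union>{Z} \<in> ?S" by blast
    have "\<sigma> c \<subseteq> \<Union>{Z}" using c E(2) by blast
    then have "\<exists>S\<in>?S. \<sigma> c \<subseteq> S" by (rule bexI[OF _ S])
    moreover have "c \<in> compacts T" using c(1) E(1) by blast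
    ultimately have "c \<in> ?P" by (intro CollectI conjI)
    then show "x \<in> (\<Union>c\<in>?P. \<sigma> c)" using c(2) by (rule UN_I)
  qed
  then have "a \<in> ?P" by (rule iffD2[OF thick_ideal_mem_iff[OF P a]])
  then have "\<exists>S\<in>?S. \<sigma> a \<subseteq> S" by (rule CollectE) (erule conjunct2)
  then obtain S where "S \<in> ?S" "\<sigma> a \<subseteq> S" by (rule bexE)
  then show ?thesis using that by blast
qed

text \<open>\<open>\<sigma> a\<close> is a union of closed sets with quasi-compact complement, each
  of them Thomason. Finitely many suffice, and finite unions keep both properties.\<close>

lemma \<sigma>_compact_closed:
  assumes a: "a \<in> compacts T" shows "closedin X (\<sigma> a)" "compactin X (topspace X - \<sigma> a)"
proof -
  have "thomason X (\<sigma> a)" using thomason_Union_\<sigma>[of "{a}"] a by simp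
  then obtain \<C> where "\<forall>Z\<in>\<C>. closedin X Z \<and> compactin X (topspace X - Z)" and C2: "\<sigma> a = \<Union>\<C>"
    unfolding thomason_def by (elim exE conjE)
  then have C1: "\<And>Z. Z \<in> \<C> \<Longrightarrow> closedin X Z \<and> compactin X (topspace X - Z)" by simp
  note C = C1 C2
  have "thomason X Z" if "Z \<in> \<C>" for Z
    unfolding thomason_def by (rule exI[of _ "{Z}"]) (use C(1)[OF that] in simp)
  then obtain F where F: "finite F" "F \<subseteq> \<C>" "\<sigma> a \<subseteq> \<Union>F"
    by (rule \<sigma>_finite_subcover[OF a _ eq_refl[OF C(2)]])
  have eq: "\<sigma> a = \<Union>F" using F C(2) by blast
  show "closedin X (\<sigma> a)" unfolding eq by (rule closedin_Union[OF F(1)]) (use C(1) F(2) in blast)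
  let ?G = "(\<lambda>Z. topspace X - Z) ` F"
  have "compactin X (topspace X \<inter> \<Inter>?G)"
    by (rule spectral_finite_Inter[OF spectral, THEN conjunct2])
       (use F(1,2) C(1) in \<open>auto intro: openin_diff\<close>)
  moreover have "topspace X \<inter> \<Inter>?G = topspace X - \<sigma> a" unfolding eq by blast
  ultimately show "compactin X (topspace X - \<sigma> a)" by simp
qed

text \<open>If no finite part of \<open>E\<close> covered \<open>Z\<close>, the quasi-compact
  complements of the supports would have the finite intersection property on \<open>Z\<close>, and a
  common point would lie outside every support.\<close>

lemma closed_qc_finite_generators:
  assumes Z: "closedin X Z" "compactin X (topspace X - Z)"
  obtains E where "finite E" "E \<subseteq> compacts T" "Z = (\<Union>a\<in>E. \<sigma> a)"
proof -
  have Zt: "Z \<subseteq> topspace X" using closedin_subset[OF Z(1)] .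
  have "thomason X Z" unfolding thomason_def by (rule exI[of _ "{Z}"]) (use Z in simp)
  then obtain E where E: "E \<subseteq> compacts T" "Z = (\<Union>a\<in>E. \<sigma> a)" by (rule thomason_generators)
  let ?U = "(\<lambda>a. topspace X - \<sigma> a) ` E"
  have "\<exists>F. finite F \<and> F \<subseteq> E \<and> Z \<subseteq> (\<Union>a\<in>F. \<sigma> a)"
  proof (rule ccontr)
    assume n: "\<not> ?thesis"
    have fip: "Z \<inter> \<Inter>G \<noteq> {}" if G: "finite G" "G \<subseteq> ?U" for G
    proof -
      obtain F where F: "finite F" "F \<subseteq> E" "G = (\<lambda>a. topspace X - \<sigma> a) ` F"
        using finite_subset_image[OF G] by blast
      then have "\<not> Z \<subseteq> (\<Union>a\<in>F. \<sigma> a)" using n by blast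
      then show ?thesis unfolding F(3) using Zt by blast
    qed
    have qc: "openin X U \<and> compactin X U" if "U \<in> ?U" for U
      using that \<sigma>_compact_closed E(1) by (auto intro: openin_diff)
    obtain x where x: "x \<in> Z" "\<And>U. U \<in> ?U \<Longrightarrow> x \<in> U"
      by (rule spectral_closed_meets_Inter[OF spectral Z(1), of ?U]) (erule qc, rule fip, assumption, assumption, rule that)
    then show False using E(2) by blast
  qed
  then obtain F where "finite F" "F \<subseteq> E" "Z \<subseteq> (\<Union>a\<in>F. \<sigma> a)" by blast
  then show ?thesis using E by (intro that[of F]) blast+
qed

section \<open>The comparison map to the Balmer spectrum\<close>

definition classifying_map :: "'x \<Rightarrow> 'o set" where
  "classifying_map = restrict (\<lambda>x. {a \<in> compacts T. x \<notin> \<sigma> a}) (topspace X)"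

lemma mem_classifying_map:
  "x \<in> topspace X \<Longrightarrow> a \<in> classifying_map x \<longleftrightarrow> a \<in> compacts T \<and> x \<notin> \<sigma> a"
  by (simp add: classifying_map_def)

lemma prime_classifying_map:
  assumes x: "x \<in> topspace X" shows "prime_ideal T (classifying_map x)"
  unfolding prime_ideal_def
proof (intro conjI ballI impI)
  \<comment> \<open>Written over a one-element directed family, with the complement of the point as
    bound on the support.\<close>
  have eq: "classifying_map x = {c \<in> compacts T. \<exists>S\<in>{- {x}}. \<sigma> c \<subseteq> S}"
    using mem_classifying_map[OF x] by blast
  show "thick_ideal T (classifying_map x)" unfolding eq by (rule thick_ideal_directed) simp_all
  \<comment> \<open>Properness: the whole space is Thomason, so some compact object has
    \<open>x\<close> in its support.\<close>
  have "thomason X (topspace X)"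
    unfolding thomason_def by (rule exI[of _ "{topspace X}"]) simp
  then obtain E where "E \<subseteq> compacts T" "topspace X = (\<Union>a\<in>E. \<sigma> a)" by (rule thomason_generators)
  then show "classifying_map x \<noteq> compacts T" using x mem_classifying_map[OF x] by blast
  fix a b assume "a \<in> compacts T" "b \<in> compacts T" "a \<boxtimes> b \<in> classifying_map x"
  then show "a \<in> classifying_map x \<or> b \<in> classifying_map x"
    using mem_classifying_map[OF x] by (simp add: \<sigma>_tensor_eq)
qed

text \<open>By T0 a quasi-compact open set contains one of two distinct points and misses the other.
  Its complement is a union of supports of compact objects, one of which separates the
  points.\<close>

lemma classifying_map_inj: "inj_on classifying_map (topspace X)"
proof (rule inj_onI, rule ccontr)
  fix x y assume x: "x \<in> topspace X" and y: "y \<in> topspace X"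
    and eq: "classifying_map x = classifying_map y" and "x \<noteq> y"
  have sep: "False" if U: "openin X U" "p \<in> U" "q \<notin> U" and p: "p \<in> topspace X" and q: "q \<in> topspace X"
    and pq: "classifying_map p = classifying_map q" for U p q
  proof -
    have "\<forall>U x. openin X U \<and> x \<in> U \<longrightarrow> (\<exists>V. openin X V \<and> compactin X V \<and> x \<in> V \<and> V \<subseteq> U)"
      using spectral by (simp add: spectral_space_def)
    then obtain V where V: "openin X V" "compactin X V" "p \<in> V" "V \<subseteq> U" using U(1,2) by blast
    have "topspace X - (topspace X - V) = V" using openin_subset[OF V(1)] by blast
    then have "compactin X (topspace X - (topspace X - V))" using V(2) by simp
    moreover have "closedin X (topspace X - V)" using V(1) by blast
    ultimately obtain E where E: "E \<subseteq> compacts T" "topspace X - V = (\<Union>a\<in>E. \<sigma> a)"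
      using closed_qc_finite_generators by metis
    obtain a where a: "a \<in> E" "q \<in> \<sigma> a" using E(2) V(4) U(3) q by blast
    have "p \<notin> \<sigma> a" using a E(2) V(3) by blast
    then show False
      using a E(1) pq mem_classifying_map[OF p, of a] mem_classifying_map[OF q, of a] by blast
  qed
  have "t0_space X" using spectral by (simp add: spectral_space_def)
  then obtain U where U: "openin X U" "x \<notin> U \<longleftrightarrow> y \<in> U"
    using x y \<open>x \<noteq> y\<close> unfolding t0_space_def by blast
  show False
  proof (cases "x \<in> U")
    case True
    then show False using sep[OF U(1) True _ x y eq] U(2) by simp
  next
    case False
    then show False using sep[OF U(1) _ False y x eq[symmetric]] U(2) by simp
  qed
qed

text \<open>Primeness makes the compact objects outside \<open>P\<close> closed under tensor
  products, and tensoring shrinks supports: these supports are filtered downwards.\<close>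

lemma prime_below_finite:
  assumes P: "prime_ideal T P" and A: "finite A" "A \<subseteq> compacts T - P"
  shows "\<exists>b\<in>compacts T - P. \<forall>a\<in>A. \<sigma> b \<subseteq> \<sigma> a"
  using A
proof (induction A rule: finite_induct)
  case empty
  have "P \<subseteq> compacts T" "P \<noteq> compacts T" using P by (simp_all add: prime_ideal_def thick_ideal_def)
  then show ?case by blast
next
  case (insert a A)
  then obtain b where b: "b \<in> compacts T - P" "\<forall>a\<in>A. \<sigma> b \<subseteq> \<sigma> a" by blast
  have a: "a \<in> compacts T - P" using insert.prems by blast
  have "b \<boxtimes> a \<in> compacts T" using compacts_tensor a b(1) by blast
  moreover have "b \<boxtimes> a \<notin> P" using P a b(1) unfolding prime_ideal_def by blast
  moreover have "\<forall>c\<in>insert a A. \<sigma> (b \<boxtimes> a) \<subseteq> \<sigma> c" using b(2) \<sigma>_tensor[of b a] by blast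
  ultimately show ?case by blast
qed

text \<open>The point sought lies in \<open>\<sigma> a\<close> for every compact \<open>a\<close>
  outside \<open>P\<close> and avoids the Thomason set formed by the supports from \<open>P\<close>.
  No compact object outside \<open>P\<close> has its support inside that set; together with
  filteredness this is the finite intersection property.\<close>

lemma classifying_map_surj:
  assumes P: "prime_ideal T P" obtains x where "x \<in> topspace X" "classifying_map x = P"
proof -
  have th: "thick_ideal T P" and Pc: "P \<subseteq> compacts T" using P by (simp_all add: prime_ideal_def thick_ideal_def)
  obtain \<C> where "\<forall>Z\<in>\<C>. closedin X Z \<and> compactin X (topspace X - Z)"
    and C2: "(\<Union>a\<in>P. \<sigma> a) = \<Union>\<C>"
    using thomason_Union_\<sigma>[OF Pc] unfolding thomason_def by (elim exE conjE)
  then have C1: "\<And>Z. Z \<in> \<C> \<Longrightarrow> closedin X Z \<and> compactin X (topspace X - Z)" by simp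
  note C = C1 C2
  let ?K = "\<sigma> ` (compacts T - P)" and ?U = "(\<lambda>Z. topspace X - Z) ` \<C>"
  have K: "closedin X K" if "K \<in> ?K" for K using that \<sigma>_compact_closed(1) by blast
  have U: "openin X U \<and> compactin X U" if "U \<in> ?U" for U
    using that C(1) by (auto intro: openin_diff)
  have fip: "topspace X \<inter> \<Inter>F \<inter> \<Inter>G \<noteq> {}" if G: "finite G" "G \<subseteq> ?K" and F: "finite F" "F \<subseteq> ?U" for G F
  proof -
    obtain A where A: "finite A" "A \<subseteq> compacts T - P" "G = \<sigma> ` A" using finite_subset_image[OF G] by blast
    obtain b where b: "b \<in> compacts T - P" "\<forall>a\<in>A. \<sigma> b \<subseteq> \<sigma> a" using prime_below_finite[OF P A(1,2)] by blast
    have "\<not> \<sigma> b \<subseteq> \<Union>\<C>" using thick_ideal_mem_iff[OF th, of b] b(1) C(2) by simp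
    then obtain y where y: "y \<in> \<sigma> b" "y \<notin> \<Union>\<C>" by blast
    then have "y \<in> topspace X" using \<sigma>_topspace by blast
    moreover have "y \<in> \<Inter>F" using F(2) y(2) \<open>y \<in> topspace X\<close> by blast
    moreover have "y \<in> \<Inter>G" using A(3) b(2) y(1) by blast
    ultimately show ?thesis by blast
  qed
  obtain x where x: "x \<in> topspace X" "\<And>K. K \<in> ?K \<Longrightarrow> x \<in> K" "\<And>U. U \<in> ?U \<Longrightarrow> x \<in> U"
    by (rule spectral_fip[OF spectral, of ?K ?U]) (erule K, erule U, rule fip, assumption+, rule that)
  have "a \<in> classifying_map x \<longleftrightarrow> a \<in> P" for a
  proof
    assume "a \<in> classifying_map x"
    then show "a \<in> P" using x(2)[of "\<sigma> a"] mem_classifying_map[OF x(1)] by blast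
  next
    assume a: "a \<in> P"
    then have "\<sigma> a \<subseteq> \<Union>\<C>" using C(2) by blast
    then have "x \<notin> \<sigma> a" using x(3) by blast
    then show "a \<in> classifying_map x" using a Pc mem_classifying_map[OF x(1)] by blast
  qed
  then show ?thesis using that[OF x(1)] by blast
qed

section \<open>The topology of the spectrum\<close>

lemma topspace_Spc: "topspace (Spc T) = {P. prime_ideal T P}"
proof -
  obtain z where z: "is_zero T z" using ex_zero by blast
  \<comment> \<open>A zero object lies in every prime, so its basic open set is the set of all
    primes.\<close>
  have "P \<in> {P. prime_ideal T P} - supp T z" if "prime_ideal T P" for P
    using that tsub_zero[OF _ z, of P] by (simp add: supp_def prime_ideal_def thick_ideal_def)
  moreover have "z \<in> compacts T" using tsub_zero[OF compacts_triangulated[OF has_coproducts] z] .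
  ultimately show ?thesis unfolding Spc_def topology_generated_by_topspace by blast
qed

lemma openin_Spc_compl: "a \<in> compacts T \<Longrightarrow> openin (Spc T) ({P. prime_ideal T P} - supp T a)"
  unfolding Spc_def by (rule topology_generated_by_Basis) blast

lemma classifying_map_supp:
  "x \<in> topspace X \<Longrightarrow> a \<in> compacts T \<Longrightarrow> classifying_map x \<in> supp T a \<longleftrightarrow> x \<in> \<sigma> a"
  using prime_classifying_map mem_classifying_map by (simp add: supp_def)

lemma classifying_map_image: "classifying_map ` topspace X = topspace (Spc T)"
  unfolding topspace_Spc using prime_classifying_map classifying_map_surj by blast

text \<open>Basic opens of the spectrum pull back to complements of supports of compact objects,
  which are open. Conversely, quasi-compact opens form a basis of \<open>X\<close>, and each is a
  finite intersection of such complements.\<close>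

theorem classifying_map_homeomorphic: "homeomorphic_map X (Spc T) classifying_map"
proof (rule bijective_open_imp_homeomorphic_map[OF _ _ classifying_map_image classifying_map_inj])
  show "continuous_map X (Spc T) classifying_map"
    unfolding Spc_def continuous_on_generated_topo_iff
  proof (intro conjI allI impI)
    fix U assume "U \<in> {{P. prime_ideal T P} - supp T x |x. x \<in> compacts T}"
    then obtain a where a: "a \<in> compacts T" "U = {P. prime_ideal T P} - supp T a" by blast
    have "classifying_map -` U \<inter> topspace X = topspace X - \<sigma> a"
      using a classifying_map_supp[OF _ a(1)] prime_classifying_map by blast
    then show "openin X (classifying_map -` U \<inter> topspace X)" using \<sigma>_compact_closed(1)[OF a(1)] by auto
  next
    show "classifying_map ` topspace X \<subseteq> \<Union>{{P. prime_ideal T P} - supp T x |x. x \<in> compacts T}"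
      using classifying_map_image unfolding Spc_def topology_generated_by_topspace by simp
  qed
  show "open_map X (Spc T) classifying_map" unfolding open_map_def
  proof (intro allI impI)
    fix U assume U: "openin X U"
    have basis: "\<forall>U x. openin X U \<and> x \<in> U \<longrightarrow> (\<exists>V. openin X V \<and> compactin X V \<and> x \<in> V \<and> V \<subseteq> U)"
      using spectral by (simp add: spectral_space_def)
    have qc: "openin (Spc T) (classifying_map ` V)" if V: "openin X V" "compactin X V" for V
    proof -
      have "topspace X - (topspace X - V) = V" using openin_subset[OF V(1)] by blast
      then have "compactin X (topspace X - (topspace X - V))" using V(2) by simp
      moreover have "closedin X (topspace X - V)" using V(1) by blast
      ultimately obtain E where E: "finite E" "E \<subseteq> compacts T" "topspace X - V = (\<Union>a\<in>E. \<sigma> a)"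
        using closed_qc_finite_generators by metis
      let ?G = "(\<lambda>a. {P. prime_ideal T P} - supp T a) ` E"
      have "openin (Spc T) (topspace (Spc T) \<inter> \<Inter>?G)"
        by (rule openin_Int_Inter) (use E openin_Spc_compl in auto)
      moreover have "topspace (Spc T) \<inter> \<Inter>?G = classifying_map ` V"
      proof (intro equalityI subsetI)
        fix P assume P: "P \<in> topspace (Spc T) \<inter> \<Inter>?G"
        from IntD1[OF P] obtain x where x: "P = classifying_map x" "x \<in> topspace X"
          unfolding classifying_map_image[symmetric] by (rule imageE)
        have "x \<notin> \<sigma> a" if a: "a \<in> E" for a
        proof -
          have "P \<notin> supp T a" using InterD[OF IntD2[OF P] imageI[OF a]] by simp
          then show ?thesis using classifying_map_supp[OF x(2), of a] a E(2) x(1) by blast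
        qed
        then show "P \<in> classifying_map ` V" using E(3) x by blast
      next
        fix P assume "P \<in> classifying_map ` V"
        then obtain x where x: "x \<in> V" "P = classifying_map x" by blast
        have xt: "x \<in> topspace X" using x(1) openin_subset[OF V(1)] by blast
        have "P \<notin> supp T a" if "a \<in> E" for a
        proof -
          have "x \<notin> \<sigma> a" using E(3) x(1) that by blast
          then show ?thesis using classifying_map_supp[OF xt, of a] E(2) that x(2) by blast
        qed
        moreover have "prime_ideal T P" using prime_classifying_map[OF xt] x(2) by simp
        ultimately show "P \<in> topspace (Spc T) \<inter> \<Inter>?G"
          unfolding topspace_Spc by (intro IntI InterI) auto
      qed
      ultimately show ?thesis by simp
    qed
    let ?B = "{V. openin X V \<and> compactin X V \<and> V \<subseteq> U}"
    have "U \<subseteq> \<Union>?B"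
    proof
      fix p assume p: "p \<in> U"
      from basis[rule_format, OF conjI[OF U p]] obtain V where
        "openin X V \<and> compactin X V \<and> p \<in> V \<and> V \<subseteq> U" by (rule exE)
      then show "p \<in> \<Union>?B" by (intro UnionI[of V]) simp_all
    qed
    then have UB: "U = \<Union>?B" by (intro equalityI) auto
    have "openin (Spc T) (\<Union>((`) classifying_map ` ?B))"
      by (rule openin_Union) (use qc in auto)
    then have "openin (Spc T) (classifying_map ` \<Union>?B)" unfolding image_Union .
    then show "openin (Spc T) (classifying_map ` U)" using UB by simp
  qed
qed

lemma weakly_noetherian_Spc: "weakly_noetherian (Spc T)"
  unfolding weakly_noetherian_def weakly_visible_def
proof
  fix P assume "P \<in> topspace (Spc T)"
  then obtain x where x: "P = classifying_map x" "x \<in> topspace X"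
    unfolding classifying_map_image[symmetric] by (rule imageE)
  obtain Y1 Y2 where Y: "thomason X Y1" "thomason X Y2" "{x} = Y1 \<inter> (topspace X - Y2)"
    using noetherian x(2) unfolding weakly_noetherian_def weakly_visible_def by blast
  note h = classifying_map_homeomorphic
  have "classifying_map ` (topspace X - Y2) = topspace (Spc T) - classifying_map ` Y2"
    unfolding classifying_map_image[symmetric]
    by (rule inj_on_image_set_diff[OF classifying_map_inj _ thomason_subset[OF Y(2)]]) blast
  then have "classifying_map ` Y1 \<inter> (topspace (Spc T) - classifying_map ` Y2) =
      classifying_map ` Y1 \<inter> classifying_map ` (topspace X - Y2)" by simp
  also have "\<dots> = classifying_map ` (Y1 \<inter> (topspace X - Y2))"
    by (rule inj_on_image_Int[OF classifying_map_inj thomason_subset[OF Y(1)], symmetric]) blast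
  also have "\<dots> = {P}" unfolding Y(3)[symmetric] x(1) by simp
  finally have eq: "{P} = classifying_map ` Y1 \<inter> (topspace (Spc T) - classifying_map ` Y2)" by simp
  show "\<exists>Y1 Y2. thomason (Spc T) Y1 \<and> thomason (Spc T) Y2 \<and> {P} = Y1 \<inter> (topspace (Spc T) - Y2)"
    using thomason_homeomorphic_image[OF h Y(1)] thomason_homeomorphic_image[OF h Y(2)] eq by blast
qed

section \<open>Identification with the Balmer-Favi support\<close>

definition pullback :: "'o set set \<Rightarrow> 'x set" where
  "pullback Y = {x \<in> topspace X. classifying_map x \<in> Y}"

lemma thomason_pullback: "thomason (Spc T) Y \<Longrightarrow> thomason X (pullback Y)"
  unfolding pullback_def by (rule thomason_homeomorphic_vimage[OF classifying_map_homeomorphic])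

lemma supp_subset_iff:
  assumes a: "a \<in> compacts T" shows "supp T a \<subseteq> Y \<longleftrightarrow> \<sigma> a \<subseteq> pullback Y"
proof
  assume "supp T a \<subseteq> Y"
  then show "\<sigma> a \<subseteq> pullback Y"
    using classifying_map_supp[OF _ a] \<sigma>_topspace[of a] unfolding pullback_def by blast
next
  assume *: "\<sigma> a \<subseteq> pullback Y"
  show "supp T a \<subseteq> Y"
  proof
    fix P assume P: "P \<in> supp T a"
    then have "prime_ideal T P" by (simp add: supp_def)
    then obtain x where "x \<in> topspace X" "classifying_map x = P" by (rule classifying_map_surj)
    then show "P \<in> Y" using P * classifying_map_supp[OF _ a] unfolding pullback_def by blast
  qed
qed

text \<open>The compact objects supported on \<open>Y\<close> form a thick ideal, so
  \<open>Loc\<close> and \<open>Loc_tensor\<close> agree on it. Their supports fill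
  \<open>pullback Y\<close> because that set is Thomason.\<close>

lemma Loc_compacts_on:
  assumes Y: "thomason (Spc T) Y" shows "Loc T (compacts_on T Y) = supported_on (pullback Y)"
proof -
  have eq: "compacts_on T Y = {c \<in> compacts T. \<exists>S\<in>{pullback Y}. \<sigma> c \<subseteq> S}"
    unfolding compacts_on_def using supp_subset_iff by blast
  have "thick_ideal T (compacts_on T Y)" unfolding eq by (rule thick_ideal_directed) simp_all
  then have L: "Loc_tensor T (compacts_on T Y) = Loc T (compacts_on T Y)"
    by (intro Loc_tensor_eq_Loc thick_ideal_tensor)
  obtain E where E: "E \<subseteq> compacts T" "pullback Y = (\<Union>a\<in>E. \<sigma> a)"
    using thomason_generators[OF thomason_pullback[OF Y]] .
  have U: "(\<Union>a\<in>compacts_on T Y. \<sigma> a) = pullback Y"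
  proof (intro equalityI UN_least)
    show "\<sigma> a \<subseteq> pullback Y" if "a \<in> compacts_on T Y" for a using that unfolding eq by simp
    have "a \<in> compacts_on T Y" if "a \<in> E" for a
      using that E(1) UN_upper[OF that, of \<sigma>] unfolding eq E(2) by auto
    then show "pullback Y \<subseteq> (\<Union>a\<in>compacts_on T Y. \<sigma> a)" unfolding E(2) by blast
  qed
  have "s \<in> Loc T (compacts_on T Y) \<longleftrightarrow> s \<in> supported_on (pullback Y)" for s
    unfolding L[symmetric] mem_Loc_tensor_iff U supported_on_iff by (rule refl)
  then show ?thesis by (intro equalityI subsetI) simp_all
qed

text \<open>Translating the defining conditions into supports makes the triangle built from the unit
  and the chosen idempotents interchangeable.\<close>

lemma idempotent_triangle_iff:
  assumes Y: "thomason (Spc T) Y"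
  shows "idempotent_triangle T Y e f \<longleftrightarrow>
    (\<exists>u v w. tri e (Unit T) f u v w) \<and> \<sigma> e \<subseteq> pullback Y \<and> \<sigma> f \<subseteq> topspace X - pullback Y"
proof
  assume *: "idempotent_triangle T Y e f"
  have tr: "\<exists>u v w. tri e (Unit T) f u v w"
    using * unfolding idempotent_triangle_def tri_def by blast
  have "Loc_tensor T {e} = {t. is_zero T (f \<boxtimes> t)} \<and> Loc_tensor T {e} = Loc T (compacts_on T Y)"
    using * unfolding idempotent_triangle_def by (elim conjE) (rule conjI)
  then have Le: "Loc_tensor T {e} = supported_on (pullback Y)"
    and ker: "{t. is_zero T (f \<boxtimes> t)} = supported_on (pullback Y)"
    using Loc_compacts_on[OF Y] by metis+
  have e: "\<sigma> e \<subseteq> pullback Y" using Loc_tensor_superset[of "{e}"] unfolding Le by (simp add: supported_on_iff)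
  \<comment> \<open>An object detecting \<open>x\<close> would be supported on
    \<open>pullback Y\<close> and hence killed by \<open>f\<close>, against
    \<open>x \<in> \<sigma> f\<close>.\<close>
  have "x \<notin> pullback Y" if x: "x \<in> \<sigma> f" for x
  proof
    assume xY: "x \<in> pullback Y"
    have xt: "x \<in> topspace X" using x \<sigma>_topspace by blast
    obtain g where g: "\<sigma> g \<subseteq> {x}" "\<And>t. x \<in> \<sigma> t \<longleftrightarrow> \<not> is_zero T (g \<boxtimes> t)"
      by (rule stalk_object[OF xt]) (rule that)
    have "g \<in> supported_on (pullback Y)" using g(1) xY unfolding supported_on_iff by blast
    then have "is_zero T (f \<boxtimes> g)" using ker by blast
    then show False using g(2) x is_zero_tensor_commute by blast
  qed
  then show "(\<exists>u v w. tri e (Unit T) f u v w) \<and> \<sigma> e \<subseteq> pullback Y \<and> \<sigma> f \<subseteq> topspace X - pullback Y"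
    using tr e \<sigma>_topspace by blast
next
  assume *: "(\<exists>u v w. tri e (Unit T) f u v w) \<and> \<sigma> e \<subseteq> pullback Y \<and> \<sigma> f \<subseteq> topspace X - pullback Y"
  then obtain u v w where t: "tri e (Unit T) f u v w" by blast
  note d = triD[OF t]
  \<comment> \<open>Tensoring the triangle with \<open>s\<close> shows that the outer terms cover
    the support of \<open>s\<close>; this determines both the support of \<open>e\<close> and the
    kernel of \<open>f\<close>.\<close>
  have \<sigma>_split: "\<sigma> s \<subseteq> \<sigma> (e \<boxtimes> s) \<union> \<sigma> (f \<boxtimes> s)" for s
  proof -
    have "Unit T \<boxtimes> s \<in> supported_on (\<sigma> (e \<boxtimes> s) \<union> \<sigma> (f \<boxtimes> s))"
      by (rule tsub_second[OF ideal_triangulated[OF supported_on_ideal] tensor_tri[OF t, of s]])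
         (simp_all add: supported_on_iff)
    then show ?thesis using \<sigma>_isomorphic[OF isomorphic_LUnit, of s] by (simp add: supported_on_iff)
  qed
  have e_eq: "\<sigma> e = pullback Y"
  proof
    show "pullback Y \<subseteq> \<sigma> e"
    proof
      fix x assume x: "x \<in> pullback Y"
      obtain s where s: "\<sigma> s = {x}" using point_object[of x] x by (auto simp: pullback_def)
      have "x \<in> \<sigma> (e \<boxtimes> s) \<union> \<sigma> (f \<boxtimes> s)" using \<sigma>_split[of s] s by blast
      then show "x \<in> \<sigma> e" using \<sigma>_tensor[of e s] \<sigma>_tensor[of f s] * x by blast
    qed
  qed (use * in blast)
  have Le: "Loc_tensor T {e} = supported_on (pullback Y)"
    using mem_Loc_tensor_iff[of _ "{e}"] e_eq by (auto simp: supported_on_iff)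
  have ker: "is_zero T (f \<boxtimes> s) \<longleftrightarrow> \<sigma> s \<subseteq> pullback Y" for s
  proof
    assume "is_zero T (f \<boxtimes> s)"
    then show "\<sigma> s \<subseteq> pullback Y" using \<sigma>_split[of s] \<sigma>_zero \<sigma>_tensor[of e s] e_eq by blast
  next
    assume s: "\<sigma> s \<subseteq> pullback Y"
    show "is_zero T (f \<boxtimes> s)" by (rule \<sigma>_empty) (use \<sigma>_tensor[of f s] s * in blast)
  qed
  have "is_zero T (e \<boxtimes> f)" by (rule \<sigma>_empty) (use \<sigma>_tensor[of e f] * in blast)
  moreover have "\<exists>u\<in>Hom T e (Unit T). \<exists>v\<in>Hom T (Unit T) f. \<exists>w\<in>Hom T f (Susp T e). (u, v, w) \<in> Triangles T"
    using t unfolding tri_def by blast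
  moreover have "Loc_tensor T {e} = {t. is_zero T (f \<boxtimes> t)}"
    unfolding Le using ker by (simp add: supported_on_def)
  ultimately show "idempotent_triangle T Y e f"
    unfolding idempotent_triangle_def using Le Loc_compacts_on[OF Y] by simp
qed

text \<open>The triangle obtained from the unit shows that \<open>idempotents\<close> has something
  to choose; the characterisation by supports then holds for the choice.\<close>

lemma idempotents_triangle:
  assumes Y: "thomason (Spc T) Y"
  obtains u v w where "tri (e_object T Y) (Unit T) (f_object T Y) u v w"
    "\<sigma> (e_object T Y) \<subseteq> pullback Y" "\<sigma> (f_object T Y) \<subseteq> topspace X - pullback Y"
proof -
  obtain e f u v w where "tri e (Unit T) f u v w" "\<sigma> e \<subseteq> pullback Y" "\<sigma> f \<subseteq> topspace X - pullback Y"
    using unit_triangle[OF thomason_pullback[OF Y]] .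
  then have "case (e, f) of (e, f) \<Rightarrow> idempotent_triangle T Y e f"
    unfolding prod.case idempotent_triangle_iff[OF Y] by blast
  then have "case idempotents T Y of (e, f) \<Rightarrow> idempotent_triangle T Y e f"
    unfolding idempotents_def by (rule someI)
  then have "idempotent_triangle T Y (e_object T Y) (f_object T Y)"
    by (simp add: e_object_def f_object_def case_prod_beta)
  then show ?thesis unfolding idempotent_triangle_iff[OF Y] using that by blast
qed

text \<open>The chosen \<open>visibility_pair\<close> pulls back to Thomason subsets of
  \<open>X\<close> isolating \<open>x\<close>, and the detection criterion applies to the chosen
  idempotents themselves.\<close>

theorem \<sigma>_eq_Supp: "\<sigma> t = {x \<in> topspace X. classifying_map x \<in> Supp T t}"
proof -
  have "x \<in> \<sigma> t \<longleftrightarrow> classifying_map x \<in> Supp T t" if x: "x \<in> topspace X" for x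
  proof -
    let ?P = "classifying_map x"
    have P: "?P \<in> topspace (Spc T)" using x classifying_map_image by blast
    then obtain Z1 Z2 where "thomason (Spc T) Z1" "thomason (Spc T) Z2" "{?P} = Z1 \<inter> (topspace (Spc T) - Z2)"
      using weakly_noetherian_Spc unfolding weakly_noetherian_def weakly_visible_def by blast
    then have "case (Z1, Z2) of (Y1, Y2) \<Rightarrow>
        thomason (Spc T) Y1 \<and> thomason (Spc T) Y2 \<and> {?P} = Y1 \<inter> (topspace (Spc T) - Y2)" by simp
    then have "case visibility_pair T ?P of (Y1, Y2) \<Rightarrow>
        thomason (Spc T) Y1 \<and> thomason (Spc T) Y2 \<and> {?P} = Y1 \<inter> (topspace (Spc T) - Y2)"
      unfolding visibility_pair_def by (rule someI)
    moreover obtain Y1 Y2 where vp: "visibility_pair T ?P = (Y1, Y2)" by (rule prod.exhaust)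
    ultimately have Y: "thomason (Spc T) Y1" "thomason (Spc T) Y2" "{?P} = Y1 \<inter> (topspace (Spc T) - Y2)"
      by simp_all
    have "{x} = pullback Y1 \<inter> (topspace X - pullback Y2)"
    proof (intro equalityI subsetI)
      fix y assume "y \<in> {x}"
      then show "y \<in> pullback Y1 \<inter> (topspace X - pullback Y2)" using Y(3) x unfolding pullback_def by blast
    next
      fix y assume y: "y \<in> pullback Y1 \<inter> (topspace X - pullback Y2)"
      then have "classifying_map y \<in> {?P}"
        unfolding Y(3) pullback_def using classifying_map_image by blast
      then show "y \<in> {x}" using inj_onD[OF classifying_map_inj, of y x] x y by blast
    qed
    moreover obtain u1 v1 w1 where t1: "tri (e_object T Y1) (Unit T) (f_object T Y1) u1 v1 w1"
      "\<sigma> (e_object T Y1) \<subseteq> pullback Y1" "\<sigma> (f_object T Y1) \<subseteq> topspace X - pullback Y1"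
      using idempotents_triangle[OF Y(1)] .
    moreover obtain u2 v2 w2 where t2: "tri (e_object T Y2) (Unit T) (f_object T Y2) u2 v2 w2"
      "\<sigma> (e_object T Y2) \<subseteq> pullback Y2" "\<sigma> (f_object T Y2) \<subseteq> topspace X - pullback Y2"
      using idempotents_triangle[OF Y(2)] .
    ultimately have "x \<in> \<sigma> t \<longleftrightarrow> \<not> is_zero T ((e_object T Y1 \<boxtimes> f_object T Y2) \<boxtimes> t)"
      by (rule stalk(1))
    then show ?thesis using P by (simp add: Supp_def g_object_def vp)
  qed
  then show ?thesis using \<sigma>_topspace[of t] by blast
qed

text \<open>\<open>f x\<close> is the prime of some point \<open>y\<close>. The two support formulas
  put \<open>x\<close> and \<open>y\<close> in the support of the same objects, so their primes
  coincide.\<close>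

lemma homeomorphism_unique:
  assumes f: "f \<in> extensional (topspace X)" "homeomorphic_map X (Spc T) f"
    and Supp: "\<And>t. \<sigma> t = {x \<in> topspace X. f x \<in> Supp T t}"
  shows "f = classifying_map"
proof (rule extensionalityI[OF f(1)])
  show "classifying_map \<in> extensional (topspace X)" by (simp add: classifying_map_def)
  fix x assume x: "x \<in> topspace X"
  have "f x \<in> topspace (Spc T)" using x homeomorphic_imp_surjective_map[OF f(2)] by blast
  then obtain y where y: "y \<in> topspace X" "f x = classifying_map y" using classifying_map_image by blast
  have "x \<in> \<sigma> t \<longleftrightarrow> y \<in> \<sigma> t" for t
  proof -
    have "x \<in> \<sigma> t \<longleftrightarrow> f x \<in> Supp T t" using Supp[of t] x by blast
    moreover have "y \<in> \<sigma> t \<longleftrightarrow> classifying_map y \<in> Supp T t" using \<sigma>_eq_Supp[of t] y(1) by blast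
    ultimately show ?thesis using y(2) by simp
  qed
  then have "a \<in> classifying_map x \<longleftrightarrow> a \<in> classifying_map y" for a
    using mem_classifying_map[OF x] mem_classifying_map[OF y(1)] by simp
  then have "classifying_map x = classifying_map y" by (intro equalityI subsetI) simp_all
  then show "f x = classifying_map x" using y(2) by simp
qed

end

text \<open>Functions are total, so uniqueness is meant among maps taking the default value outside
  \<open>topspace X\<close>, as \<open>extensional\<close> expresses.\<close>

theorem theoremC:
  fixes T :: "('o, 'm, 'u) tt_data"
    and X :: "'x topology"
    and \<sigma> :: "'o \<Rightarrow> 'x set"
  assumes "rigidly_compactly_generated_tt_category T"
    and "spectral_space X"
    and "weakly_noetherian X"
    and "support_function T X \<sigma>"
    and "bij_betw (\<lambda>L. \<Union>t\<in>L. \<sigma> t) {L. localizing_ideal T L} (Pow (topspace X))"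
    and "(\<lambda>L. \<Union>t\<in>L. \<sigma> t) ` {L. localizing_ideal T L \<and> compactly_generated_ideal T L} =
           {Y. thomason X Y}"
  shows "weakly_noetherian (Spc T) \<and>
    (\<exists>!f. f \<in> extensional (topspace X) \<and> homeomorphic_map X (Spc T) f \<and>
          (\<forall>t. \<sigma> t = {x \<in> topspace X. f x \<in> Supp T t}))"
proof -
  interpret stratified_tt_category T X \<sigma>
    using assms by (intro stratified_tt_category.intro stratified_tt_category_axioms.intro)
  have "\<exists>!f. f \<in> extensional (topspace X) \<and> homeomorphic_map X (Spc T) f \<and>
          (\<forall>t. \<sigma> t = {x \<in> topspace X. f x \<in> Supp T t})"
  proof (rule ex1I)
    show "classifying_map \<in> extensional (topspace X) \<and> homeomorphic_map X (Spc T) classifying_map \<and>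
        (\<forall>t. \<sigma> t = {x \<in> topspace X. classifying_map x \<in> Supp T t})"
    proof (intro conjI allI)
      show "classifying_map \<in> extensional (topspace X)" by (simp add: classifying_map_def)
    qed (fact classifying_map_homeomorphic, fact \<sigma>_eq_Supp)
    fix f assume f: "f \<in> extensional (topspace X) \<and> homeomorphic_map X (Spc T) f \<and>
          (\<forall>t. \<sigma> t = {x \<in> topspace X. f x \<in> Supp T t})"
    show "f = classifying_map" by (rule homeomorphism_unique) (use f in blast)+
  qed
  then show ?thesis using weakly_noetherian_Spc by blast
qed

end
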